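(* Let $F$ and $G$ be $\varphi$-functions such that $G$ is dilatory and $p(L_{F,G})>0$, and let $0<q<\infty$. (i) If the upper Boyd index satisfies $q(L_{F,G})<q$, and if $T^q\circ G^{-1}\succ H^{-1}$ for some $N$-function $H$ satisfying condition $(J)$, then $L_{F,G}$ is $q$-concave. (ii) If $L_{F,G}$ is $q$-concave, then the upper Boyd index satisfies $q(L_{F,G})\le q$, and $T^q\circ G^{-1}\succ H^{-1}$ for some $N$-function $H$ satisfying condition $(J)$.
   Context: A $\varphi$-function is a continuous, strictly increasing function $F:[0,\infty)\to[0,\infty)$ with $F(0)=0$ and $\lim_{t\to\infty}F(t)=\infty$; it is dilatory if there are $1<c_1,c_2<\infty$ with $F(c_1t)\ge c_2F(t)$ for all $t\ge0$. $T^q$ denotes $t\mapsto t^q$. Two $\varphi$-functions $F,G$ are equivalent if for some $c<\infty$, $F(t/c)\le G(t)\le F(ct)$ for all $t\ge0$. For $\varphi$-functions $F,G$, write $G\succ F$ if $G\circ F^{-1}$ is equivalent to a convex function. An $N$-function is a $\varphi$-function equivalent to a $\varphi$-function $F_0$ such that $F_0(t)/t$ is strictly increasing, $F_0(t)/t\to\infty$ as $t\to\infty$, and $F_0(t)/t\to0$ as $t\to0$. A $\varphi$-function $H^*$ is complementary to $H$ if for some $c<\infty$, $t/c\le H^{-1}(t)\,(H^* )^{-1}(t)\le ct$ for all $t\ge0$. For a $\varphi$-function $F$ put $\tilde F(t)=1/F(1/t)$ for $t>0$, $\tilde F(0)=0$. Functions live on $[0,\infty)$ with Lebesgue measure $\lambda$;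 $f^*(x)=\sup\{t:\lambda(|f|\ge t)\ge x\}$. Luxemburg functional: $\|f\|_G=\inf\{c>0:\int_0^\infty G(|f(x)|/c)\,dx\le1\}$. An $N$-function $H$ satisfies condition $(J)$ if, for a function $H^*$ complementary to $H$, the function $x\mapsto1/(\widetilde{H^*})^{-1}(x)$ has finite Luxemburg functional $\|\cdot\|_{H^*}$. Orlicz--Lorentz functional: $\|f\|_{F,G}=\|f^*\circ\tilde F\circ\tilde G^{-1}\|_G$, space $L_{F,G}=\{f:\|f\|_{F,G}<\infty\}$. Dilation operators $d_af(x)=f(ax)$, $\|d_a\|_{X\to X}=\sup\{\|d_af\|_X/\|f\|_X:0<\|f\|_X<\infty\}$; lower Boyd index $p(X)=\sup\{p:\exists c<\infty,\ \|d_a\|_{X\to X}\le c\,a^{-1/p}\ \forall a<1\}$; upper Boyd index $q(X)=\inf\{q:\exists c<\infty,\ \|d_a\|_{X\to X}\le c\,a^{-1/q}\ \forall a>1\}$. $X$ is $q$-concave if there is $C<\infty$ with $\|(\sum_{i=1}^n|f_i|^q)^{1/q}\|_X\ge C^{-1}(\sum_{i=1}^n\|f_i\|_X^q)^{1/q}$ for all $n$ and $f_1,\dots,f_n\in X$. *)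

theory Defs
  imports "HOL-Analysis.Analysis"
begin

text \<open>Functions on [0,\<infinity>) are represented as real \<Rightarrow> real; only values on {0..} matter.\<close>

definition phi_function :: "(real \<Rightarrow> real) \<Rightarrow> bool" where
  "phi_function F \<longleftrightarrow> continuous_on {0..} F \<and> strict_mono_on {0..} F \<and> F 0 = 0
     \<and> (\<forall>t\<ge>0. F t \<ge> 0) \<and> filterlim F at_top at_top"

definition dilatory :: "(real \<Rightarrow> real) \<Rightarrow> bool" where
  "dilatory F \<longleftrightarrow> (\<exists>c1 c2::real. 1 < c1 \<and> 1 < c2 \<and> (\<forall>t\<ge>0. F (c1 * t) \<ge> c2 * F t))"

definition phi_inv :: "(real \<Rightarrow> real) \<Rightarrow> real \<Rightarrow> real" where
  "phi_inv F = inv_into {0..} F"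

definition phi_equiv :: "(real \<Rightarrow> real) \<Rightarrow> (real \<Rightarrow> real) \<Rightarrow> bool" where
  "phi_equiv F G \<longleftrightarrow> (\<exists>c>0. \<forall>t\<ge>0. F (t / c) \<le> G t \<and> G t \<le> F (c * t))"

definition phi_succ :: "(real \<Rightarrow> real) \<Rightarrow> (real \<Rightarrow> real) \<Rightarrow> bool" where
  "phi_succ G F \<longleftrightarrow> (\<exists>K. convex_on {0..} K \<and> phi_equiv (G \<circ> phi_inv F) K)"

definition N_function :: "(real \<Rightarrow> real) \<Rightarrow> bool" where
  "N_function H \<longleftrightarrow> phi_function H \<and> (\<exists>F0. phi_function F0 \<and> phi_equiv H F0
     \<and> strict_mono_on {0<..} (\<lambda>t. F0 t / t)
     \<and> filterlim (\<lambda>t. F0 t / t) at_top at_top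
     \<and> ((\<lambda>t. F0 t / t) \<longlongrightarrow> 0) (at_right 0))"

definition complementary :: "(real \<Rightarrow> real) \<Rightarrow> (real \<Rightarrow> real) \<Rightarrow> bool" where
  "complementary H Hs \<longleftrightarrow> phi_function Hs \<and>
     (\<exists>c>0. \<forall>t\<ge>0. t / c \<le> phi_inv H t * phi_inv Hs t \<and> phi_inv H t * phi_inv Hs t \<le> c * t)"

definition tilde :: "(real \<Rightarrow> real) \<Rightarrow> real \<Rightarrow> real" where
  "tilde F t = (if t \<le> 0 then 0 else 1 / F (1 / t))"

definition fstar :: "(real \<Rightarrow> real) \<Rightarrow> real \<Rightarrow> ereal" where
  "fstar f x = Sup {ereal t | t. emeasure lborel {y\<in>{0..}. t \<le> \<bar>f y\<bar>} \<ge> ennreal x}"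

definition luxemburg :: "(real \<Rightarrow> real) \<Rightarrow> (real \<Rightarrow> ereal) \<Rightarrow> ennreal" where
  "luxemburg G f = Inf {ennreal c | c. c > 0 \<and>
     (\<integral>\<^sup>+ x\<in>{0..}. (if \<bar>f x\<bar> = \<infinity> then \<infinity> else ennreal (G (real_of_ereal \<bar>f x\<bar> / c))) \<partial>lborel) \<le> 1}"

definition condition_J :: "(real \<Rightarrow> real) \<Rightarrow> bool" where
  "condition_J H \<longleftrightarrow> (\<exists>Hs. complementary H Hs \<and>
      luxemburg Hs (\<lambda>x. ereal (1 / phi_inv (tilde Hs) x)) < \<infinity>)"

definition OL_norm :: "(real \<Rightarrow> real) \<Rightarrow> (real \<Rightarrow> real) \<Rightarrow> (real \<Rightarrow> real) \<Rightarrow> ennreal" where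
  "OL_norm F G f = luxemburg G (\<lambda>x. fstar f (tilde F (phi_inv (tilde G) x)))"

text \<open>A function space X given by a functional N: X = {f measurable. N f < \<infinity>}.\<close>
definition in_space :: "((real \<Rightarrow> real) \<Rightarrow> ennreal) \<Rightarrow> (real \<Rightarrow> real) \<Rightarrow> bool" where
  "in_space N f \<longleftrightarrow> f \<in> borel_measurable lborel \<and> N f < \<infinity>"

definition dil :: "real \<Rightarrow> (real \<Rightarrow> real) \<Rightarrow> real \<Rightarrow> real" where
  "dil a f = (\<lambda>x. f (a * x))"

definition dil_norm :: "((real \<Rightarrow> real) \<Rightarrow> ennreal) \<Rightarrow> real \<Rightarrow> ennreal" where
  "dil_norm N a = Sup {N (dil a f) / N f | f. in_space N f \<and> 0 < N f}"

definition boyd_lower :: "((real \<Rightarrow> real) \<Rightarrow> ennreal) \<Rightarrow> ereal" where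
  "boyd_lower N = Sup {ereal p | p. p > 0 \<and>
     (\<exists>c::real. \<forall>a. 0 < a \<and> a < 1 \<longrightarrow> dil_norm N a \<le> ennreal (c * a powr (-1 / p)))}"

definition boyd_upper :: "((real \<Rightarrow> real) \<Rightarrow> ennreal) \<Rightarrow> ereal" where
  "boyd_upper N = Inf {ereal q | q. q > 0 \<and>
     (\<exists>c::real. \<forall>a. 1 < a \<longrightarrow> dil_norm N a \<le> ennreal (c * a powr (-1 / q)))}"

definition q_concave :: "((real \<Rightarrow> real) \<Rightarrow> ennreal) \<Rightarrow> real \<Rightarrow> bool" where
  "q_concave N q \<longleftrightarrow> (\<exists>C>0. \<forall>(n::nat) (f::nat \<Rightarrow> real \<Rightarrow> real).
      (\<forall>i<n. in_space N (f i)) \<longrightarrow>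
      N (\<lambda>x. (\<Sum>i<n. \<bar>f i x\<bar> powr q) powr (1 / q))
        \<ge> ennreal ((1 / C) * (\<Sum>i<n. enn2real (N (f i)) powr q) powr (1 / q)))"

end

theory Submission
  imports Defs
begin

text \<open>Write \<open>N\<close> for the Orlicz--Lorentz functional, \<open>G1(t) = G (t powr (1/q))\<close> and \<open>\<rho>(t) = G1(t) / t\<close>.
  The condition on \<open>H\<close> says exactly that \<open>G1\<close> is concave up to a constant on intervals
  \<open>[e, t]\<close> whose lower ends satisfy a summability condition \<open>\<Sum> G1(e) / G1(t) < \<infinity>\<close>; it does not involve \<open>F\<close>.

  For (i), replace each \<open>f\<close> by \<open>s \<mapsto> inf {\<integral>\<^bsub>-E\<^esub> |f| powr q : |E| \<le> s/2} / s\<close>. This is superadditive in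
  \<open>|f| powr q\<close>, dominates the rearrangement of \<open>f\<close>, and, because the upper Boyd index is below \<open>q\<close>, its
  functional is dominated by \<open>N f\<close>. Hence it suffices to treat antitone functions, where the almost
  concavity of \<open>G1\<close> gives a weight that linearises the modular.

  For (ii), \<open>n\<close> disjoint copies of a dilate of \<open>f\<close> give the Boyd index, and step functions on disjoint
  intervals give the inequality: \<open>\<Sum> G1(s\<^sub>k) / G1(\<beta>\<^sup>k) \<le> 1\<close> implies \<open>\<Sum> s\<^sub>k / \<beta>\<^sup>k \<le> C\<close>. An argument on
  subsums turns this into almost concavity of \<open>G1\<close> with summable thresholds. Cutting \<open>(0,\<infinity>)\<close> greedily
  into maximal blocks on which \<open>\<rho>\<close> does not grow by more than a factor \<open>B\<close>, and letting the inverse of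
  the complementary function grow by \<open>B\<close> per block, yields \<open>H\<close>.\<close>

section \<open>Inverses and dilation of phi-functions\<close>

text \<open>The weight \<open>wt\<close> carries \<open>1 / G t\<close> to \<open>1 / F t\<close>,
  so an interval of length \<open>1 / F t\<close> is seen by the modular as one of length
  \<open>1 / G t\<close>; this is why the final criterion mentions \<open>G\<close> alone. The
  positive lower Boyd index gives boundedness of dilation by 1/2: in (i) this is the first term of a
  dyadic series, in (ii) it makes \<open>F\<close> doubling, so that the test intervals shrink fast
  enough to be disjoint. In (i) neither the rearrangement nor the functional is additive, and
  \<open>G1\<close> is almost concave only above the thresholds. The thresholds form an antitone
  function of modular at most 1, so raising every argument to its threshold costs only a constant.
  The strict inequality between index and \<open>q\<close> leaves a surplus exponent, which is
  halved to pay for two geometric series. In (ii) the concavity of \<open>G1\<close> can fail at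
  infinitely many places, so no single constant works. Each failure is charged to a threshold, and
  the thresholds have bounded total. Blocks are cut where a failure occurs, so that the same total
  bounds the sum behind condition (J); the doubling of \<open>G\<close> makes block heights grow
  fast enough for \<open>H\<close>.\<close>

lemma phi_functionD:
  assumes "phi_function F"
  shows phi_function_cont: "continuous_on {0..} F"
    and phi_function_zero: "F 0 = 0"
    and phi_function_top: "filterlim F at_top at_top"
    and phi_function_less_iff: "\<And>s t. 0 \<le> s \<Longrightarrow> 0 \<le> t \<Longrightarrow> F s < F t \<longleftrightarrow> s < t"
    and phi_function_le_iff: "\<And>s t. 0 \<le> s \<Longrightarrow> 0 \<le> t \<Longrightarrow> F s \<le> F t \<longleftrightarrow> s \<le> t"
    and phi_function_nonneg: "\<And>t. 0 \<le> t \<Longrightarrow> 0 \<le> F t"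
    and phi_function_pos: "\<And>t. 0 < t \<Longrightarrow> 0 < F t"
proof -
  show "continuous_on {0..} F" "F 0 = 0" "filterlim F at_top at_top"
    "\<And>t. 0 \<le> t \<Longrightarrow> 0 \<le> F t"
    using assms by (auto simp: phi_function_def)
  have sm: "strict_mono_on {0..} F"
    using assms by (auto simp: phi_function_def)
  show 1: "F s < F t \<longleftrightarrow> s < t" if "0 \<le> s" "0 \<le> t" for s t
    using sm that unfolding strict_mono_on_def
    by (metis atLeast_iff linorder_less_linear order_less_asym order_less_irrefl)
  show "F s \<le> F t \<longleftrightarrow> s \<le> t" if "0 \<le> s" "0 \<le> t" for s t
    using 1[OF that(2,1)] by linarith
  show "0 < F t" if "0 < t" for t
    using 1[of 0 t] that \<open>F 0 = 0\<close> by simp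
qed

lemma phi_function_image:
  assumes "phi_function F"
  shows "F ` {0..} = {0..}"
proof
  show "F ` {0..} \<subseteq> {0..}"
    using phi_function_nonneg[OF assms] by auto
  show "{0..} \<subseteq> F ` {0..}"
  proof
    fix y :: real assume y: "y \<in> {0..}"
    have "eventually (\<lambda>t. F t \<ge> y) at_top"
      using phi_function_top[OF assms] by (simp add: filterlim_at_top)
    then obtain T where T: "\<And>t. t \<ge> T \<Longrightarrow> F t \<ge> y"
      by (auto simp: eventually_at_top_linorder)
    define b where "b = max T 0"
    have "\<exists>x\<ge>0. x \<le> b \<and> F x = y"
      using y T[of b] phi_function_zero[OF assms]
      by (intro IVT') (auto simp: b_def intro: continuous_on_subset[OF phi_function_cont[OF assms]])
    then show "y \<in> F ` {0..}" by auto
  qed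
qed

lemma phi_inv_right:
  assumes "phi_function F" "0 \<le> y"
  shows "F (phi_inv F y) = y" and phi_inv_nonneg: "0 \<le> phi_inv F y"
proof -
  have "y \<in> F ` {0..}" using phi_function_image[OF assms(1)] assms(2) by auto
  then show "F (phi_inv F y) = y" "0 \<le> phi_inv F y"
    unfolding phi_inv_def using f_inv_into_f[of y F "{0..}"] inv_into_into[of y F "{0..}"] by simp_all
qed

lemma phi_inv_left:
  assumes "phi_function F" "0 \<le> t"
  shows "phi_inv F (F t) = t"
proof (rule antisym)
  have *: "0 \<le> F t" using assms phi_function_nonneg by blast
  note f = phi_function_le_iff[OF assms(1)]
  show "phi_inv F (F t) \<le> t" "t \<le> phi_inv F (F t)"
    using f[of "phi_inv F (F t)" t] f[of t "phi_inv F (F t)"]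
      phi_inv_right[OF assms(1) *] phi_inv_nonneg[OF assms(1) *] assms(2) by auto
qed

lemma phi_inv_le_iff:
  assumes "phi_function F" "0 \<le> x" "0 \<le> y"
  shows "phi_inv F x \<le> y \<longleftrightarrow> x \<le> F y" and le_phi_inv_iff: "y \<le> phi_inv F x \<longleftrightarrow> F y \<le> x"
    and less_phi_inv_iff: "y < phi_inv F x \<longleftrightarrow> F y < x"
proof -
  note [simp] = phi_inv_right[OF assms(1,2)] phi_inv_nonneg[OF assms(1,2)]
  show "phi_inv F x \<le> y \<longleftrightarrow> x \<le> F y" "y \<le> phi_inv F x \<longleftrightarrow> F y \<le> x"
    "y < phi_inv F x \<longleftrightarrow> F y < x"
    using phi_function_le_iff[OF assms(1), of "phi_inv F x" y] phi_function_le_iff[OF assms(1), of y "phi_inv F x"]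
      phi_function_less_iff[OF assms(1), of y "phi_inv F x"] assms(3) by auto
qed

lemma phi_inv_eqI:
  assumes "phi_function F" "0 \<le> t" "F t = y"
  shows "phi_inv F y = t"
  using phi_inv_left[OF assms(1,2)] assms(3) by simp

text \<open>A monotone function whose image has no gaps cannot jump, so continuity and the limit at
  infinity come for free. Inverses, compositions and \<open>tilde\<close> are recognised as
  phi-functions this way.\<close>

lemma phi_functionI_surj:
  assumes sm: "strict_mono_on {0..} F" and im: "F ` {0..} = {0..}"
  shows "phi_function F"
proof -
  have nn: "0 \<le> F t" if "0 \<le> t" for t using im that by auto
  have le: "F s \<le> F t" if "0 \<le> s" "s \<le> t" for s t
    using strict_mono_onD[OF sm, of s t] that by (cases "s = t") auto
  obtain z where z: "z \<ge> 0" "F z = 0" using im by (metis atLeast_iff image_iff order_refl)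
  have 0: "F 0 = 0" using le[of 0 z] nn[of 0] z by simp
  \<comment> \<open>Extending by the identity to the left gives a monotone surjection of the whole
    line, whose image is open; this is the form in which monotonicity yields continuity.\<close>
  define g where "g t = (if t \<le> 0 then t else F t)" for t
  have "range g = UNIV"
  proof -
    have "y \<in> range g" for y
    proof (cases "y \<le> 0")
      case True then show ?thesis by (auto simp: g_def image_iff intro!: exI[of _ y])
    next
      case False
      then obtain t where "t \<ge> 0" "F t = y" using im by (metis atLeast_iff image_iff linear)
      with False 0 show ?thesis by (auto simp: g_def image_iff intro!: exI[of _ t])
    qed
    then show ?thesis by auto
  qed
  then have "continuous_on UNIV g"
    by (intro continuous_onI_mono) (auto simp: g_def intro: le order_trans[OF _ nn])
  then have "continuous_on {0..} g" by (rule continuous_on_subset) auto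
  then have "continuous_on {0..} F"
    by (subst continuous_on_cong[OF refl, of _ _ g]) (auto simp: g_def 0)
  moreover have "filterlim F at_top at_top"
    unfolding filterlim_at_top eventually_at_top_linorder
  proof
    fix Z :: real
    obtain t where "t \<ge> 0" "F t = max Z 0" using im by (metis atLeast_iff image_iff max.cobounded2)
    then show "\<exists>N. \<forall>n\<ge>N. Z \<le> F n" using le[of t] by (intro exI[of _ t]) (auto simp: max_def split: if_splits; smt)
  qed
  ultimately show ?thesis using sm 0 nn by (auto simp: phi_function_def)
qed

lemma phi_function_phi_inv:
  assumes "phi_function F"
  shows "phi_function (phi_inv F)"
proof (rule phi_functionI_surj)
  show "strict_mono_on {0..} (phi_inv F)"
    by (intro strict_mono_onI) (metis assms atLeast_iff less_phi_inv_iff phi_inv_nonneg phi_inv_right)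
  show "phi_inv F ` {0..} = {0..}"
    using phi_inv_nonneg[OF assms] phi_inv_left[OF assms] phi_function_nonneg[OF assms]
    by (auto simp: image_iff) (metis atLeast_iff)
qed

lemma phi_inv_phi_inv:
  assumes "phi_function F" "0 \<le> t"
  shows "phi_inv (phi_inv F) t = F t"
  by (rule phi_inv_eqI[OF phi_function_phi_inv[OF assms(1)] phi_function_nonneg[OF assms] phi_inv_left[OF assms]])

lemma phi_inv_pos:
  assumes "phi_function F" "0 < y"
  shows "0 < phi_inv F y"
  using phi_function_pos[OF phi_function_phi_inv[OF assms(1)] assms(2)] .

lemma phi_inv_zero:
  assumes "phi_function F"
  shows "phi_inv F 0 = 0"
  using phi_function_zero[OF phi_function_phi_inv[OF assms(1)]] .

lemma phi_inv_mono:
  assumes "phi_function F" "0 \<le> x" "x \<le> y"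
  shows "phi_inv F x \<le> phi_inv F y"
  using phi_function_le_iff[OF phi_function_phi_inv[OF assms(1)], of x y] assms by auto

lemma phi_function_mono:
  assumes "phi_function F" "0 \<le> x" "x \<le> y"
  shows "F x \<le> F y"
  using phi_function_le_iff[OF assms(1), of x y] assms by auto

lemma phi_function_tilde:
  assumes "phi_function F"
  shows "phi_function (tilde F)"
proof (rule phi_functionI_surj)
  note p = phi_function_pos[OF assms]
  show "strict_mono_on {0..} (tilde F)"
  proof (rule strict_mono_onI)
    fix r s :: real assume *: "r \<in> {0..}" "s \<in> {0..}" "r < s"
    show "tilde F r < tilde F s"
    proof (cases "r = 0")
      case True with * p[of "1/s"] show ?thesis by (auto simp: tilde_def)
    next
      case False
      then have "1 / s < 1 / r" using * by (auto simp: field_simps)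
      then have "F (1/s) < F (1/r)" using * False by (subst phi_function_less_iff[OF assms]) auto
      then show ?thesis using * False p[of "1/r"] p[of "1/s"] by (auto simp: tilde_def intro!: divide_strict_left_mono)
    qed
  qed
  show "tilde F ` {0..} = {0..}"
  proof
    show "tilde F ` {0..} \<subseteq> {0..}" 
    proof
      fix y assume "y \<in> tilde F ` {0..}"
      then obtain t where "y = tilde F t" by auto
      then show "y \<in> {0..}" using phi_function_nonneg[OF assms, of "1/t"] by (auto simp: tilde_def)
    qed
    show "{0..} \<subseteq> tilde F ` {0..}"
    proof
      fix y :: real assume "y \<in> {0..}"
      then have "tilde F (if y = 0 then 0 else 1 / phi_inv F (1/y)) = y"
        using phi_inv_pos[OF assms, of "1/y"] phi_inv_right[OF assms, of "1/y"] by (auto simp: tilde_def)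
      moreover have "(if y = 0 then 0 else 1 / phi_inv F (1/y)) \<in> {0..}"
        using \<open>y \<in> _\<close> phi_inv_nonneg[OF assms, of "1/y"] by auto
      ultimately show "y \<in> tilde F ` {0..}" by (metis imageI)
    qed
  qed
qed

lemma phi_inv_tilde:
  assumes "phi_function F" "0 < x"
  shows "phi_inv (tilde F) x = 1 / phi_inv F (1 / x)"
  using assms phi_inv_pos[OF assms(1), of "1/x"] phi_inv_right[OF assms(1), of "1/x"]
  by (intro phi_inv_eqI phi_function_tilde) (auto simp: tilde_def)

text \<open>Its inverse is the function \<open>\<lambda>t. phi_inv G t powr q\<close> of the
  theorem. Passing to it turns statements about \<open>q\<close>-th power sums into statements about
  ordinary sums.\<close>

definition power_comp :: "(real \<Rightarrow> real) \<Rightarrow> real \<Rightarrow> real \<Rightarrow> real" where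
  "power_comp G q t = G (t powr (1 / q))"

lemma phi_function_power_comp:
  assumes "phi_function G" "0 < q"
  shows "phi_function (power_comp G q)"
proof (rule phi_functionI_surj)
  show "strict_mono_on {0..} (power_comp G q)"
    using assms phi_function_less_iff[OF assms(1)]
    by (auto intro!: strict_mono_onI powr_less_mono2 simp: power_comp_def)
  have "power_comp G q ` {0..} = G ` ((\<lambda>t. t powr (1/q)) ` {0..})"
    by (auto simp: power_comp_def)
  also have "(\<lambda>t. t powr (1/q)) ` {0..} = {0..}"
  proof
    show "{0..} \<subseteq> (\<lambda>t. t powr (1/q)) ` {0..}"
    proof
      fix y :: real assume "y \<in> {0..}"
      then have "(y powr q) powr (1/q) = y" using assms by (simp add: powr_powr)
      then show "y \<in> (\<lambda>t. t powr (1/q)) ` {0..}" by (metis atLeast_iff imageI powr_ge_zero)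
    qed
  qed auto
  finally show "power_comp G q ` {0..} = {0..}" using phi_function_image[OF assms(1)] by simp
qed

lemma power_comp_powr:
  assumes "0 < q" "0 \<le> t"
  shows "power_comp G q (t powr q) = G t"
  using assms by (simp add: power_comp_def powr_powr)

lemma phi_inv_power_comp:
  assumes "phi_function G" "0 < q" "0 \<le> y"
  shows "phi_inv (power_comp G q) y = phi_inv G y powr q"
  using assms phi_inv_nonneg[OF assms(1,3)] phi_inv_right[OF assms(1,3)]
  by (intro phi_inv_eqI phi_function_power_comp) (auto simp: power_comp_powr)

text \<open>Iterate the dilation inequality as often as \<open>c1 ^ n \<le> 1 / e\<close> allows.
  The exponent is \<open>ln c2 / ln c1\<close>, and the factor \<open>C = c2\<close> pays for
  rounding the number of iterations down.\<close>

lemma dilatory_power_bound: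
  assumes "phi_function G" "dilatory G"
  obtains C p where "1 \<le> C" "0 < p" "\<And>e z. 0 < e \<Longrightarrow> e \<le> 1 \<Longrightarrow> 0 \<le> z \<Longrightarrow> G (e * z) \<le> C * e powr p * G z"
proof -
  obtain c1 c2 where c: "1 < c1" "1 < c2" "\<And>t. t \<ge> 0 \<Longrightarrow> c2 * G t \<le> G (c1 * t)"
    using assms(2) unfolding dilatory_def by blast
  have it: "c2 ^ n * G t \<le> G (c1 ^ n * t)" if "t \<ge> 0" for n t
  proof (induction n)
    case (Suc n)
    have "c2 ^ Suc n * G t = c2 * (c2 ^ n * G t)" by simp
    also have "\<dots> \<le> c2 * G (c1 ^ n * t)" using Suc c by (intro mult_left_mono) auto
    also have "\<dots> \<le> G (c1 ^ Suc n * t)" using c(3)[of "c1 ^ n * t"] that c by (simp add: mult.assoc)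
    finally show ?case .
  qed auto
  define p where "p = ln c2 / ln c1"
  have p: "0 < p" using c by (simp add: p_def)
  show ?thesis
  proof (rule that[of c2 p])
    fix e z :: real assume e: "0 < e" "e \<le> 1" "0 \<le> z"
    define n where "n = nat \<lfloor>- ln e / ln c1\<rfloor>"
    have n: "real n \<le> - ln e / ln c1" "- ln e / ln c1 < real n + 1"
    proof -
      have "0 \<le> - ln e / ln c1" using e c by (intro divide_nonneg_pos) auto
      then show "real n \<le> - ln e / ln c1" "- ln e / ln c1 < real n + 1" unfolding n_def by linarith+
    qed
    have "c1 ^ n \<le> 1 / e"
    proof -
      have "ln (c1 ^ n) \<le> ln (1/e)" using n(1) c e by (simp add: ln_realpow field_simps ln_div)
      then show ?thesis using c e by (subst (asm) ln_le_cancel_iff) auto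
    qed
    then have "G (c1 ^ n * (e * z)) \<le> G z"
      using e c mult_right_mono[of "e * c1 ^ n" 1 z] by (intro phi_function_mono[OF assms(1)]) (auto simp: field_simps)
    then have 1: "c2 ^ n * G (e * z) \<le> G z" using it[of "e*z" n] e by auto
    have "1 \<le> c2 * e powr p * c2 ^ n"
    proof -
      have "- ln e < (real n + 1) * ln c1" using n(2) c by (simp add: field_simps)
      then have "0 \<le> (real n + 1) * ln c1 + ln e" by simp
      then have "0 \<le> p * ((real n + 1) * ln c1 + ln e)" using p by simp
      also have "\<dots> = ln (c2 * e powr p * c2 ^ n)"
        using c e by (simp add: ln_mult ln_powr ln_realpow p_def field_simps)
      finally show ?thesis using c e by (subst (asm) ln_ge_zero_iff) auto
    qed
    then have "G (e * z) \<le> (c2 * e powr p * c2 ^ n) * G (e*z)"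
      using e phi_function_nonneg[OF assms(1), of "e*z"] by (simp add: mult_le_cancel_right1)
    also have "\<dots> \<le> c2 * e powr p * G z" using 1 c e by (simp add: mult.assoc mult_left_mono)
    finally show "G (e * z) \<le> c2 * e powr p * G z" .
  qed (use c p in auto)
qed

lemma dilatory_multiple:
  assumes "phi_function G" "dilatory G" "0 < M"
  obtains k where "1 \<le> k" "\<And>t. 0 \<le> t \<Longrightarrow> M * G t \<le> G (k * t)"
proof -
  obtain C p where C: "1 \<le> C" "0 < p" "\<And>e z. 0 < e \<Longrightarrow> e \<le> 1 \<Longrightarrow> 0 \<le> z \<Longrightarrow> G (e * z) \<le> C * e powr p * G z"
    using dilatory_power_bound[OF assms(1,2)] by metis
  define k where "k = max 1 ((C * M) powr (1/p))"
  have k: "1 \<le> k" by (simp add: k_def)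
  have "C * M = ((C * M) powr (1/p)) powr p" using C assms by (simp add: powr_powr)
  also have "\<dots> \<le> k powr p" using C by (intro powr_mono2) (auto simp: k_def)
  finally have kp: "C * M \<le> k powr p" .
  show ?thesis
  proof (rule that[OF k])
    fix t :: real assume t: "0 \<le> t"
    have "G t \<le> C * (1/k) powr p * G (k * t)" using C(3)[of "1/k" "k*t"] k t by simp
    also have "(1/k) powr p = 1 / k powr p" using k by (simp add: powr_divide)
    finally have *: "k powr p * G t \<le> C * G (k * t)" using k by (simp add: field_simps)
    have "C * M * G t \<le> k powr p * G t" using kp phi_function_nonneg[OF assms(1) t] by (intro mult_right_mono) auto
    with * have "C * (M * G t) \<le> C * G (k * t)" by (simp add: mult_ac)
    then show "M * G t \<le> G (k * t)" using C by simp
  qed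
qed

lemma dilatory_power_comp:
  assumes "phi_function G" "dilatory G" "0 < q"
  shows "dilatory (power_comp G q)"
proof -
  obtain c1 c2 where c: "1 < c1" "1 < c2" "\<And>t. t \<ge> 0 \<Longrightarrow> c2 * G t \<le> G (c1 * t)"
    using assms(2) unfolding dilatory_def by blast
  have "1 < c1 powr q" using c assms by (simp add: gr_one_powr)
  moreover have "c2 * power_comp G q t \<le> power_comp G q (c1 powr q * t)" if "t \<ge> 0" for t
    using c(3)[of "t powr (1/q)"] that assms c by (simp add: power_comp_def powr_mult powr_powr)
  ultimately show ?thesis unfolding dilatory_def using c by blast
qed

section \<open>Rearrangements and the Orlicz--Lorentz functional\<close>

lemma antitone_borel_measurable:
  fixes u :: "real \<Rightarrow> real"
  assumes "\<And>x y. 0 < x \<Longrightarrow> x \<le> y \<Longrightarrow> u y \<le> u x"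
  shows "(\<lambda>x. u x * indicator {0<..} x) \<in> borel_measurable borel"
proof -
  have "mono_on {0<..} (\<lambda>x. - u x)"
    using assms by (auto simp: mono_on_def)
  then have "(\<lambda>x. - u x) \<in> borel_measurable (restrict_space borel {0<..})"
    by (rule borel_measurable_mono_on_fnc)
  then have "(\<lambda>x. - (- u x)) \<in> borel_measurable (restrict_space borel {0<..})"
    by (rule borel_measurable_uminus)
  then show ?thesis
    by (subst (asm) borel_measurable_restrict_space_iff) (auto simp: mult.commute)
qed

lemma antitone_borel_measurable_ennreal:
  fixes u :: "real \<Rightarrow> real"
  assumes "\<And>x y. 0 < x \<Longrightarrow> x \<le> y \<Longrightarrow> u y \<le> u x"
  shows "(\<lambda>x. ennreal (u x) * indicator {0<..} x) \<in> borel_measurable borel"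
proof -
  have "(\<lambda>x. ennreal (u x) * indicator {0<..} x) = (\<lambda>x. ennreal (u x * indicator {0<..} x))"
    by (auto simp: indicator_def)
  then show ?thesis using antitone_borel_measurable[of u, OF assms] by simp
qed

text \<open>Lets functionals defined as infima be compared through their admissible real constants,
  with no separate treatment of infinite values and no attained infimum.\<close>

lemma ennreal_le_by_real_bounds:
  fixes a b :: ennreal
  assumes "\<And>t. 0 < t \<Longrightarrow> b < ennreal t \<Longrightarrow> a \<le> ennreal t"
  shows "a \<le> b"
proof (rule dense_ge)
  fix x assume "b < x"
  then obtain z where z: "b < z" "z < x" using dense by blast
  then have "z < \<infinity>" "0 < z" by (auto simp: top_unique less_top intro: order_less_le_trans le_less_trans[OF _ z(1)])
  then have e: "z = ennreal (enn2real z)" "0 < enn2real z" by (auto simp: less_top enn2real_positive_iff)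
  then have "a \<le> z" using assms[of "enn2real z"] z by simp
  then show "a \<le> x" using z by simp
qed

abbreviation distr_fn :: "(real \<Rightarrow> real) \<Rightarrow> real \<Rightarrow> ennreal" where
  "distr_fn f t \<equiv> emeasure lborel {y\<in>{0..}. t \<le> \<bar>f y\<bar>}"

lemma emeasure_lborel_nonneg_reals: "emeasure lborel {0::real..} = \<infinity>"
proof -
  have *: "emeasure lborel {0..x} \<le> emeasure lborel {0::real..}" if "0 \<le> x" for x :: real
    by (rule emeasure_mono) auto
  then have "ennreal x \<le> emeasure lborel {0::real..}" if "0 \<le> x" for x using *[OF that] that by simp
  then have "ennreal x \<le> emeasure lborel {0::real..}" for x by (metis ennreal_neg linear zero_le)
  then show ?thesis
    by (metis ennreal_le_by_real_bounds infinity_ennreal_def linorder_not_le order_antisym top_greatest)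
qed

lemma distr_fn_nonpos: "t \<le> 0 \<Longrightarrow> distr_fn f t = \<infinity>"
proof -
  assume "t \<le> 0"
  then have "{y\<in>{0..}. t \<le> \<bar>f y\<bar>} = {0..}" by (auto intro: order_trans)
  then show ?thesis using emeasure_lborel_nonneg_reals by simp
qed

lemma le_fstar: "ennreal x \<le> distr_fn f t \<Longrightarrow> ereal t \<le> fstar f x"
  unfolding fstar_def by (rule Sup_upper) auto

lemma fstar_nonneg: "0 \<le> fstar f x"
  using le_fstar[of x 0 f] distr_fn_nonpos[of 0 f] by (simp add: zero_ereal_def)

lemma fstar_le:
  assumes "\<And>t. c < t \<Longrightarrow> distr_fn f t < ennreal x"
  shows "fstar f x \<le> ereal c"
  unfolding fstar_def
proof (rule Sup_least)
  fix z assume "z \<in> {ereal t |t. ennreal x \<le> distr_fn f t}"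
  then obtain t where "z = ereal t" "ennreal x \<le> distr_fn f t" by auto
  with assms[of t] show "z \<le> ereal c" by (metis ereal_less_eq(3) leD le_less_linear)
qed

lemma fstar_less_imp: "fstar f x < ereal t \<Longrightarrow> distr_fn f t < ennreal x"
  using le_fstar by (metis leD linorder_le_less_linear)

text \<open>Nonpositive levels can be ignored: there the level set is the whole half-line, and
  \<open>fstar\<close> is nonnegative anyway.\<close>

lemma fstar_mono:
  assumes "\<And>t. 0 < t \<Longrightarrow> ennreal x \<le> distr_fn f t \<Longrightarrow> ennreal y \<le> distr_fn g t"
  shows "fstar f x \<le> fstar g y"
  unfolding fstar_def[of f]
proof (rule Sup_least)
  fix z assume "z \<in> {ereal t |t. ennreal x \<le> distr_fn f t}"
  then obtain t where t: "z = ereal t" "ennreal x \<le> distr_fn f t" by auto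
  show "z \<le> fstar g y"
  proof (cases "0 < t")
    case True
    then show ?thesis using assms t le_fstar by auto
  next
    case False
    then have "z \<le> 0" using t by auto
    also have "0 \<le> fstar g y" by (rule fstar_nonneg)
    finally show ?thesis .
  qed
qed

lemma fstar_antimono: "x \<le> y \<Longrightarrow> fstar f y \<le> fstar f x"
  by (rule fstar_mono) (meson ennreal_leI order_trans)

lemma distr_fn_dil:
  assumes "f \<in> borel_measurable borel" "0 < a"
  shows "distr_fn f t = ennreal a * distr_fn (dil a f) t"
proof -
  have m: "{y\<in>{0..}. t \<le> \<bar>f y\<bar>} \<in> sets borel" "{y\<in>{0..}. t \<le> \<bar>dil a f y\<bar>} \<in> sets borel"
    unfolding dil_def using assms by measurable
  have "distr_fn f t = (\<integral>\<^sup>+x. indicator {y\<in>{0..}. t \<le> \<bar>f y\<bar>} x \<partial>lborel)" using m by simp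
  also have "\<dots> = ennreal \<bar>a\<bar> * (\<integral>\<^sup>+x. indicator {y\<in>{0..}. t \<le> \<bar>f y\<bar>} (0 + a * x) \<partial>lborel)"
    using m assms by (intro nn_integral_real_affine) auto
  also have "(\<lambda>x. indicator {y\<in>{0..}. t \<le> \<bar>f y\<bar>} (0 + a * x)) = (indicator {y\<in>{0..}. t \<le> \<bar>dil a f y\<bar>} :: real \<Rightarrow> ennreal)"
    using assms by (auto simp: fun_eq_iff indicator_def dil_def zero_le_mult_iff)
  also have "(\<integral>\<^sup>+x. indicator {y\<in>{0..}. t \<le> \<bar>dil a f y\<bar>} x \<partial>lborel) = distr_fn (dil a f) t" using m by simp
  finally show ?thesis using assms by simp
qed

lemma fstar_dil:
  assumes "f \<in> borel_measurable borel" "0 < a" "0 \<le> x"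
  shows "fstar (dil a f) x = fstar f (a * x)"
proof -
  have "ennreal (a * x) \<le> distr_fn f t \<longleftrightarrow> ennreal x \<le> distr_fn (dil a f) t" for t
    unfolding distr_fn_dil[OF assms(1,2)] ennreal_mult'[OF less_imp_le[OF assms(2)]]
    using assms(2) by (subst ennreal_mult_le_mult_iff) auto
  then show ?thesis unfolding fstar_def by simp
qed

text \<open>An infinite value is sent to 0, so this is the decreasing rearrangement only together
  with \<open>fin_rearr\<close>.\<close>

definition rearr :: "(real \<Rightarrow> real) \<Rightarrow> real \<Rightarrow> real" where
  "rearr f s = real_of_ereal (fstar f s)"

definition fin_rearr :: "(real \<Rightarrow> real) \<Rightarrow> bool" where
  "fin_rearr f \<longleftrightarrow> (\<forall>s>0. fstar f s < \<infinity>)"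

lemma rearr_nonneg: "0 \<le> rearr f s"
  unfolding rearr_def using fstar_nonneg by (simp add: real_of_ereal_pos)

lemma ereal_rearr: "fin_rearr f \<Longrightarrow> 0 < s \<Longrightarrow> ereal (rearr f s) = fstar f s"
  unfolding rearr_def fin_rearr_def using fstar_nonneg[of f s]
  by (simp add: ereal_real')

lemma rearr_antimono: "fin_rearr f \<Longrightarrow> 0 < s \<Longrightarrow> s \<le> t \<Longrightarrow> rearr f t \<le> rearr f s"
  using fstar_antimono[of s t f] by (metis ereal_less_eq(3) ereal_rearr order.strict_trans2)

lemma rearr_dil:
  assumes "f \<in> borel_measurable borel" "0 < a" "0 \<le> x"
  shows "rearr (dil a f) x = rearr f (a * x)"
  unfolding rearr_def fstar_dil[OF assms] ..

lemma fin_rearr_mono: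
  assumes "fin_rearr g" "\<And>x. 0 < x \<Longrightarrow> fstar f x \<le> fstar g x"
  shows "fin_rearr f"
  using assms unfolding fin_rearr_def by (meson le_less_trans)

lemma rearr_mono:
  assumes "fin_rearr g" "\<And>x. 0 < x \<Longrightarrow> fstar f x \<le> fstar g x" "0 < x"
  shows "rearr f x \<le> rearr g x"
  using assms fin_rearr_mono[OF assms(1,2)] by (simp flip: ereal_less_eq(3) add: ereal_rearr)

text \<open>The strict inequality matters: the set where \<open>\<bar>f y\<bar>\<close> is at least
  \<open>rearr f s\<close> can be larger than \<open>s\<close> when \<open>f\<close> has a plateau.
  The strict level set is the increasing union of the sets at levels
  \<open>rearr f s + 1 / (n + 1)\<close>, each of measure below \<open>s\<close>.\<close>

lemma emeasure_gt_rearr: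
  assumes "f \<in> borel_measurable borel" "fin_rearr f" "0 < s"
  shows "emeasure lborel {y\<in>{0..}. rearr f s < \<bar>f y\<bar>} \<le> ennreal s"
proof -
  let ?A = "\<lambda>n. {y\<in>{0..}. rearr f s + 1 / real (Suc n) \<le> \<bar>f y\<bar>}"
  have 1: "incseq ?A"
  proof (rule incseq_SucI, safe)
    fix n y assume "rearr f s + 1 / real (Suc n) \<le> \<bar>f y\<bar>"
    moreover have "1 / real (Suc (Suc n)) \<le> 1 / real (Suc n)" by (simp add: field_simps)
    ultimately show "rearr f s + 1 / real (Suc (Suc n)) \<le> \<bar>f y\<bar>" by linarith
  qed
  have 2: "range ?A \<subseteq> sets lborel" using assms(1) by auto
  have 3: "{y\<in>{0..}. rearr f s < \<bar>f y\<bar>} = (\<Union>n. ?A n)"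
  proof safe
    fix y assume y: "0 \<le> y" "rearr f s < \<bar>f y\<bar>"
    then obtain n where "1 / real (Suc n) < \<bar>f y\<bar> - rearr f s" using nat_approx_posE by (metis diff_gt_0_iff_gt)
    with y show "y \<in> (\<Union>n. ?A n)" by (auto intro!: exI[of _ n])
  next
    fix n y assume "rearr f s + 1 / real (Suc n) \<le> \<bar>f y\<bar>"
    moreover have "0 < 1 / real (Suc n)" by simp
    ultimately show "rearr f s < \<bar>f y\<bar>" by linarith
  qed
  have "emeasure lborel (\<Union>n. ?A n) = (SUP n. emeasure lborel (?A n))"
    using SUP_emeasure_incseq[OF 2 1] by simp
  also have "\<dots> \<le> ennreal s"
  proof (rule SUP_least)
    fix n :: nat
    have "fstar f s < ereal (rearr f s + 1 / real (Suc n))"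
      unfolding ereal_rearr[OF assms(2,3), symmetric] by simp
    then show "emeasure lborel (?A n) \<le> ennreal s" using fstar_less_imp by (metis less_imp_le)
  qed
  finally show ?thesis using 3 by simp
qed

section \<open>The weight and the modular of the Orlicz--Lorentz functional\<close>

text \<open>This is the change of variables inside the functional. For \<open>t > 0\<close> it sends
  \<open>1 / G t\<close> to \<open>1 / F t\<close>.\<close>

definition wt :: "(real \<Rightarrow> real) \<Rightarrow> (real \<Rightarrow> real) \<Rightarrow> real \<Rightarrow> real" where
  "wt F G x = tilde F (phi_inv (tilde G) x)"

lemma wt_eq:
  assumes "phi_function F" "phi_function G" "0 < x"
  shows "wt F G x = 1 / F (phi_inv G (1 / x))" and wt_pos: "0 < wt F G x"
  using assms phi_inv_pos[OF assms(2), of "1/x"] phi_function_pos[OF assms(1)]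
  by (auto simp: wt_def phi_inv_tilde tilde_def)

lemma wt_mono:
  assumes "phi_function F" "phi_function G" "0 \<le> x" "x \<le> y"
  shows "wt F G x \<le> wt F G y"
  unfolding wt_def using assms
  by (intro phi_function_mono[OF phi_function_tilde] phi_inv_mono phi_inv_nonneg phi_function_tilde)

lemma wt_le_iff:
  assumes "phi_function F" "phi_function G" "0 < x" "0 < t"
  shows "wt F G x \<le> 1 / F t \<longleftrightarrow> x \<le> 1 / G t"
proof -
  note pos = phi_function_pos[OF assms(1)] phi_function_pos[OF assms(2)] phi_inv_pos[OF assms(2)]
  have "wt F G x \<le> 1 / F t \<longleftrightarrow> F t \<le> F (phi_inv G (1/x))"
    using assms pos(1)[of t] pos(1)[of "phi_inv G (1/x)"] pos(3)[of "1/x"] by (simp add: wt_eq field_simps)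
  also have "\<dots> \<longleftrightarrow> G t \<le> 1 / x"
    using assms pos(3)[of "1/x"] phi_function_le_iff[OF assms(1), of t "phi_inv G (1/x)"] le_phi_inv_iff[OF assms(2), of "1/x" t] by simp
  also have "\<dots> \<longleftrightarrow> x \<le> 1 / G t" using assms pos(2)[of t] by (simp add: field_simps)
  finally show ?thesis .
qed

text \<open>The point 0 is left out because the weight vanishes there and \<open>fstar f 0\<close>
  is always infinite; the integral does not notice it.\<close>

definition modular :: "(real \<Rightarrow> real) \<Rightarrow> (real \<Rightarrow> real) \<Rightarrow> ennreal" where
  "modular G u = (\<integral>\<^sup>+ x\<in>{0<..}. ennreal (G (u x)) \<partial>lborel)"

lemma modular_mono:
  assumes "phi_function G" "\<And>x. 0 < x \<Longrightarrow> 0 \<le> u x \<and> u x \<le> v x"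
  shows "modular G u \<le> modular G v"
  unfolding modular_def
proof (intro nn_integral_mono)
  fix x :: real
  show "ennreal (G (u x)) * indicator {0<..} x \<le> ennreal (G (v x)) * indicator {0<..} x"
    using phi_function_mono[OF assms(1), of "u x" "v x"] assms(2)[of x]
    by (auto simp: indicator_def intro: ennreal_leI)
qed

lemma nn_integral_nonneg_pos:
  "(\<integral>\<^sup>+ x\<in>{0..}. g x \<partial>lborel) = (\<integral>\<^sup>+ x\<in>{0<..}. g x \<partial>lborel)" for g :: "real \<Rightarrow> ennreal"
proof (rule nn_integral_cong_AE)
  have "AE x in lborel. x \<noteq> (0::real)" by (rule AE_lborel_singleton)
  then show "AE x in lborel. g x * indicator {0..} x = g x * indicator {0<..} x"
    by eventually_elim (auto simp: indicator_def)
qed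

lemma OL_norm_eq:
  "OL_norm F G f = Inf {ennreal c | c. c > 0 \<and>
     (\<integral>\<^sup>+ x\<in>{0<..}. (if fstar f (wt F G x) = \<infinity> then \<infinity> else ennreal (G (rearr f (wt F G x) / c))) \<partial>lborel) \<le> 1}"
  unfolding OL_norm_def luxemburg_def nn_integral_nonneg_pos rearr_def wt_def abs_ereal_ge0[OF fstar_nonneg] ..

text \<open>The infimum need not be attained, but some admissible constant lies below
  \<open>\<theta>\<close>, and enlarging the constant only lowers the modular.\<close>

lemma OL_norm_lessD:
  assumes F: "phi_function F" and G: "phi_function G" and "OL_norm F G f < ennreal \<theta>"
  shows "fin_rearr f" "modular G (\<lambda>x. rearr f (wt F G x) / \<theta>) \<le> 1"
proof -
  let ?I = "\<lambda>c. (\<integral>\<^sup>+ x\<in>{0<..}. (if fstar f (wt F G x) = \<infinity> then \<infinity> else ennreal (G (rearr f (wt F G x) / c))) \<partial>lborel)"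
  obtain c where c: "c > 0" "ennreal c < ennreal \<theta>" "?I c \<le> 1"
    using assms(3) unfolding OL_norm_eq Inf_less_iff by auto
  show fin: "fin_rearr f"
    unfolding fin_rearr_def
  proof (intro allI impI, rule ccontr)
    fix s :: real assume s: "0 < s" "\<not> fstar f s < \<infinity>"
    \<comment> \<open>This is the point with \<open>wt F G x = s\<close>. An infinite value at
      \<open>s\<close> would make the integrand infinite on all of \<open>{0<..x}\<close>.\<close>
    define x where "x = 1 / G (phi_inv F (1/s))"
    have ps: "0 < phi_inv F (1/s)" using phi_inv_pos[OF F] s by simp
    then have x: "0 < x" using phi_function_pos[OF G] by (simp add: x_def)
    have "wt F G y \<le> s" if "0 < y" "y \<le> x" for y
      using wt_le_iff[OF F G that(1) ps] that phi_inv_right[OF F, of "1/s"] s by (simp add: x_def)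
    then have "fstar f (wt F G y) = \<infinity>" if "0 < y" "y \<le> x" for y
      using that s(2) fstar_antimono[of "wt F G y" s f] by (metis ereal_infty_less_eq(1) less_ereal.simps(2) linorder_not_less ereal_less_PInfty)
    then have "(\<integral>\<^sup>+ y\<in>{0<..x}. \<infinity> \<partial>lborel) \<le> ?I c"
      by (intro nn_integral_mono) (auto simp: indicator_def)
    moreover have "(\<integral>\<^sup>+ y\<in>{0<..x}. \<infinity> \<partial>lborel) = \<infinity>"
      using x by (subst nn_integral_cmult_indicator) (auto simp: ennreal_top_mult)
    ultimately show False using c(3) by (simp add: top_unique)
  qed
  have "modular G (\<lambda>x. rearr f (wt F G x) / \<theta>) \<le> ?I c"
    unfolding modular_def
  proof (intro nn_integral_mono)
    fix x :: real
    have "c \<le> \<theta>" using c by (metis ennreal_less_iff less_imp_le)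
    then have "rearr f (wt F G x) / \<theta> \<le> rearr f (wt F G x) / c"
      using c rearr_nonneg[of f "wt F G x"] by (intro divide_left_mono) auto
    then have "G (rearr f (wt F G x) / \<theta>) \<le> G (rearr f (wt F G x) / c)"
      using c rearr_nonneg[of f "wt F G x"] \<open>c \<le> \<theta>\<close> by (intro phi_function_mono[OF G]) auto
    then show "ennreal (G (rearr f (wt F G x) / \<theta>)) * indicator {0<..} x
       \<le> (if fstar f (wt F G x) = \<infinity> then \<infinity> else ennreal (G (rearr f (wt F G x) / c))) * indicator {0<..} x"
      by (auto simp: indicator_def intro: ennreal_leI)
  qed
  then show "modular G (\<lambda>x. rearr f (wt F G x) / \<theta>) \<le> 1" using c by auto
qed

lemma OL_norm_leI:
  assumes F: "phi_function F" and G: "phi_function G" and "0 < \<theta>" "fin_rearr f"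
    "modular G (\<lambda>x. rearr f (wt F G x) / \<theta>) \<le> 1"
  shows "OL_norm F G f \<le> ennreal \<theta>"
proof -
  have "(\<integral>\<^sup>+ x\<in>{0<..}. (if fstar f (wt F G x) = \<infinity> then \<infinity> else ennreal (G (rearr f (wt F G x) / \<theta>))) \<partial>lborel)
     = modular G (\<lambda>x. rearr f (wt F G x) / \<theta>)"
    unfolding modular_def using assms(4) wt_pos[OF F G]
    by (intro nn_integral_cong) (auto simp: indicator_def fin_rearr_def)
  then show ?thesis unfolding OL_norm_eq using assms by (intro Inf_lower) auto
qed

lemma OL_norm_leI_compare:
  assumes F: "phi_function F" and G: "phi_function G" and "\<And>x. 0 < x \<Longrightarrow> fstar f x \<le> fstar g x"
  shows "OL_norm F G f \<le> OL_norm F G g"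
proof (rule ennreal_le_by_real_bounds)
  fix t :: real assume t: "0 < t" "OL_norm F G g < ennreal t"
  note g = OL_norm_lessD[OF F G t(2)]
  have "modular G (\<lambda>x. rearr f (wt F G x) / t) \<le> modular G (\<lambda>x. rearr g (wt F G x) / t)"
    using t rearr_nonneg rearr_mono[OF g(1) assms(3)] wt_pos[OF F G]
    by (intro modular_mono[OF G]) (auto intro!: divide_right_mono)
  then show "OL_norm F G f \<le> ennreal t"
    using g t fin_rearr_mono[OF g(1) assms(3)] by (intro OL_norm_leI[OF F G]) auto
qed

lemma fstar_mono_abs:
  assumes "g \<in> borel_measurable borel" "\<And>y. 0 \<le> y \<Longrightarrow> \<bar>f y\<bar> \<le> \<bar>g y\<bar>"
  shows "fstar f x \<le> fstar g x"
proof (rule fstar_mono)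
  fix t :: real assume t: "ennreal x \<le> distr_fn f t"
  have "distr_fn f t \<le> distr_fn g t"
    using assms by (intro emeasure_mono) (auto intro: order_trans)
  with t show "ennreal x \<le> distr_fn g t" by simp
qed

text \<open>Needed because the supremum in \<open>dil_norm\<close> leaves out functions of
  functional zero; for those the dilation estimate has to come from the vanishing of the
  rearrangement.\<close>

lemma OL_norm_eq_0D:
  assumes F: "phi_function F" and G: "phi_function G" and N: "OL_norm F G f = 0" and s: "0 < s"
  shows "fstar f s = 0"
proof (rule ccontr)
  assume ne: "fstar f s \<noteq> 0"
  have fin: "fin_rearr f" using OL_norm_lessD(1)[OF F G, of f 1] N by simp
  then have r: "0 < rearr f s" using ne rearr_nonneg[of f s] ereal_rearr[OF fin s] by (metis order_le_less zero_ereal_def)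
  define x where "x = 1 / G (phi_inv F (1/s))"
  have ps: "0 < phi_inv F (1/s)" using phi_inv_pos[OF F] s by simp
  then have x: "0 < x" using phi_function_pos[OF G] by (simp add: x_def)
  have wy: "wt F G y \<le> s" if "0 < y" "y \<le> x" for y
    using wt_le_iff[OF F G that(1) ps] that phi_inv_right[OF F, of "1/s"] s by (simp add: x_def)
  \<comment> \<open>With \<open>G z = 2 / x\<close> the integral over \<open>{0<..x}\<close> is at
    least 2, which no constant admissible for \<open>f\<close> permits.\<close>
  define z where "z = phi_inv G (2 / x)"
  have z: "0 < z" "G z = 2 / x" using phi_inv_pos[OF G] phi_inv_right[OF G] x by (auto simp: z_def)
  have "modular G (\<lambda>y. rearr f (wt F G y) / (rearr f s / z)) \<le> 1"
    using OL_norm_lessD(2)[OF F G, of f "rearr f s / z"] N r z by simp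
  moreover have "(\<integral>\<^sup>+ y. ennreal (2 / x) * indicator {0<..x} y \<partial>lborel) \<le> modular G (\<lambda>y. rearr f (wt F G y) / (rearr f s / z))"
    unfolding modular_def
  proof (intro nn_integral_mono)
    fix y :: real
    have "2 / x \<le> G (rearr f (wt F G y) / (rearr f s / z))" if y: "0 < y" "y \<le> x"
    proof -
      have "rearr f s \<le> rearr f (wt F G y)" using wy[OF y] wt_pos[OF F G y(1)] by (intro rearr_antimono[OF fin]) auto
      then have "z \<le> rearr f (wt F G y) / (rearr f s / z)" using r z by (simp add: field_simps)
      then show ?thesis using z phi_function_mono[OF G, of z] by simp
    qed
    then show "ennreal (2 / x) * indicator {0<..x} y \<le> ennreal (G (rearr f (wt F G y) / (rearr f s / z))) * indicator {0<..} y"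
      by (auto simp: indicator_def intro: ennreal_leI)
  qed
  moreover have "(\<integral>\<^sup>+ y. ennreal (2 / x) * indicator {0<..x} y \<partial>lborel) = 2"
    using x by (subst nn_integral_cmult_indicator) (auto simp flip: ennreal_mult)
  ultimately show False using order_trans by (metis one_less_numeral_iff leD semiring_norm(76) )
qed

lemma OL_norm_dil_le:
  assumes F: "phi_function F" and G: "phi_function G" and f: "in_space (OL_norm F G) f" and "0 < a"
    and K: "dil_norm (OL_norm F G) a \<le> ennreal K"
  shows "OL_norm F G (dil a f) \<le> ennreal K * OL_norm F G f"
proof (cases "OL_norm F G f = 0")
  case True
  have fm: "f \<in> borel_measurable borel" using f by (simp add: in_space_def)
  have "fstar (dil a f) x \<le> fstar f x" if "0 < x" for x
    using OL_norm_eq_0D[OF F G True, of "a * x"] fstar_nonneg[of f x] that assms(4) fstar_dil[OF fm assms(4), of x] by simp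
  then have "OL_norm F G (dil a f) \<le> OL_norm F G f" by (rule OL_norm_leI_compare[OF F G])
  then show ?thesis using True by simp
next
  case False
  have fin: "OL_norm F G f < top" using f by (simp add: in_space_def)
  have "OL_norm F G (dil a f) / OL_norm F G f \<le> dil_norm (OL_norm F G) a"
    unfolding dil_norm_def using f False by (intro Sup_upper) (auto simp: zero_less_iff_neq_zero)
  then have *: "OL_norm F G (dil a f) / OL_norm F G f \<le> ennreal K" using K by simp
  have "OL_norm F G (dil a f) = OL_norm F G (dil a f) / OL_norm F G f * OL_norm F G f"
    using False fin by (simp add: ennreal_divide_times ennreal_times_divide less_top mult_divide_eq_ennreal)
  also have "\<dots> \<le> ennreal K * OL_norm F G f" using * by (rule mult_right_mono) simp
  finally show ?thesis .
qed

section \<open>Almost concavity on antitone functions\<close>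

text \<open>Chebyshev's inequality on \<open>{0<..x}\<close>, where \<open>u\<close> is at least
  \<open>u x\<close>.\<close>

lemma antitone_le_of_modular:
  assumes G: "phi_function G" and u: "\<And>x y. 0 < x \<Longrightarrow> x \<le> y \<Longrightarrow> u y \<le> u x" "\<And>x. 0 < x \<Longrightarrow> 0 \<le> u x"
    and m: "modular G u \<le> 1" and x: "0 < x"
  shows "u x \<le> phi_inv G (1 / x)"
proof -
  have "ennreal (G (u x) * x) = (\<integral>\<^sup>+ y. ennreal (G (u x)) * indicator {0<..x} y \<partial>lborel)"
    using x phi_function_nonneg[OF G u(2)[OF x]] by (subst nn_integral_cmult_indicator) (auto simp: ennreal_mult)
  also have "\<dots> \<le> modular G u"
    unfolding modular_def
  proof (intro nn_integral_mono)
    fix y :: real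
    show "ennreal (G (u x)) * indicator {0<..x} y \<le> ennreal (G (u y)) * indicator {0<..} y"
      using phi_function_mono[OF G u(2)[OF x] u(1)[of y x]] x by (auto simp: indicator_def intro: ennreal_leI)
  qed
  also have "\<dots> \<le> 1" by (rule m)
  finally have "ennreal (G (u x) * x) \<le> ennreal 1" by simp
  then have "G (u x) * x \<le> 1" by (subst (asm) ennreal_le_iff) auto
  then show ?thesis using x u(2)[OF x] by (subst le_phi_inv_iff[OF G]) (auto simp: field_simps)
qed

text \<open>The weight \<open>v = G (max u e) / max u e\<close> linearises the modular at \<open>u\<close>: integrating against it
  is additive and bounded at \<open>u\<close>, while the hypothesis \<open>conc\<close> makes it dominate the
  functional on every antitone function.\<close>

lemma antitone_concavity:
  assumes G: "phi_function G" "dilatory G"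
    and e: "\<And>x y. 0 < x \<Longrightarrow> x \<le> y \<Longrightarrow> e y \<le> e x" "\<And>x. 0 < x \<Longrightarrow> 0 < e x"
      "\<And>x. 0 < x \<Longrightarrow> e x \<le> phi_inv G (1 / x)" "modular G e \<le> 1"
    and conc: "\<And>x s t. 0 < x \<Longrightarrow> e x \<le> s \<Longrightarrow> s \<le> t \<Longrightarrow> t \<le> phi_inv G (1 / x) \<Longrightarrow> G t / t \<le> C * (G s / s)"
    and C: "1 \<le> C"
  shows "\<exists>D>0. \<forall>(n::nat) (u::nat \<Rightarrow> real \<Rightarrow> real).
      (\<forall>i<n. \<forall>x>0. 0 \<le> u i x \<and> (\<forall>y\<ge>x. u i y \<le> u i x)) \<longrightarrow> modular G (\<lambda>x. \<Sum>i<n. u i x) \<le> 1 \<longrightarrow>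
      (\<exists>c. (\<forall>i<n. 0 \<le> c i) \<and> (\<Sum>i<n. c i) \<le> D \<and>
         (\<forall>i<n. \<forall>d>0. c i \<le> d \<longrightarrow> modular G (\<lambda>x. u i x / (D * d)) \<le> 1))"
proof -
  define T where "T x = phi_inv G (1 / x)" for x
  obtain k where k: "1 \<le> k" "\<And>t. 0 \<le> t \<Longrightarrow> 2 * G t \<le> G (k * t)"
    using dilatory_multiple[OF G, of 2] by auto
  have Tpos: "0 < T x" if "0 < x" for x using phi_inv_pos[OF G(1)] that by (simp add: T_def)
  have GT: "G (T x) = 1 / x" if "0 < x" for x using phi_inv_right[OF G(1)] that by (simp add: T_def)
  have Thalf: "T (x/2) \<le> k * T x" if "0 < x" for x
  proof -
    have "2 * (1 / x) \<le> G (k * T x)" using k(2)[of "T x"] GT[OF that] Tpos[OF that] by simp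
    then show ?thesis unfolding T_def using that k Tpos[OF that] by (subst phi_inv_le_iff[OF G(1)]) (auto simp: T_def)
  qed
  \<comment> \<open>The constant of the bound \<open>gT\<close> below: the factor 2 comes from
    integrating over half of \<open>{0<..x}\<close>, \<open>C\<close> from \<open>vlow\<close>, and
    \<open>k\<close> from comparing \<open>T (x/2)\<close> with \<open>T x\<close>.\<close>
  define C' where "C' = 2 * C * k"
  have C': "1 \<le> C'" "C \<le> C'" using C k mult_mono[of 1 C 1 k] mult_mono[of C C 1 k] by (auto simp: C'_def)
  obtain k' where k': "1 \<le> k'" "\<And>t. 0 \<le> t \<Longrightarrow> 3 * G t \<le> G (k' * t)"
    using dilatory_multiple[OF G, of 3] by auto
  \<comment> \<open>The 2 bounds the total of the integrals against the weight; \<open>k'\<close>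
    brings a modular of at most 3 down to 1 after the scaling by \<open>C'\<close>.\<close>
  define D where "D = max 2 (C' * k')"
  show ?thesis
  proof (intro exI[of _ D] conjI allI impI)
    show "0 < D" by (simp add: D_def)
    fix n :: nat and u :: "nat \<Rightarrow> real \<Rightarrow> real"
    assume u: "\<forall>i<n. \<forall>x>0. 0 \<le> u i x \<and> (\<forall>y\<ge>x. u i y \<le> u i x)" and um: "modular G (\<lambda>x. \<Sum>i<n. u i x) \<le> 1"
    have ua: "\<And>i x y. i < n \<Longrightarrow> 0 < x \<Longrightarrow> x \<le> y \<Longrightarrow> u i y \<le> u i x"
      and un: "\<And>i x. i < n \<Longrightarrow> 0 < x \<Longrightarrow> 0 \<le> u i x" using u by auto
    define U where "U x = (\<Sum>i<n. u i x)" for x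
    define V where "V x = max (U x) (e x)" for x
    define v where "v x = G (V x) / V x" for x
    have Ua: "U y \<le> U x" if "0 < x" "x \<le> y" for x y unfolding U_def by (intro sum_mono ua that) auto
    have Un: "0 \<le> U x" if "0 < x" for x unfolding U_def by (intro sum_nonneg un that) auto
    have UT: "U x \<le> T x" if "0 < x" for x
      unfolding T_def using antitone_le_of_modular[OF G(1) Ua Un _ that] um by (simp add: U_def)
    have Va: "V y \<le> V x" if "0 < x" "x \<le> y" for x y using Ua[OF that] e(1)[OF that] by (auto simp: V_def)
    have Vb: "0 < V x" "e x \<le> V x" "V x \<le> T x" if "0 < x" for x
      using e(2,3)[OF that] UT[OF that] by (auto simp: V_def T_def)
    have vpos: "0 < v x" if "0 < x" for x using Vb(1)[OF that] phi_function_pos[OF G(1)] by (simp add: v_def)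
    have vlow: "1 / (x * T x) \<le> C * v x" if "0 < x" for x
      using conc[OF that Vb(2)[OF that] Vb(3)[OF that], folded T_def] GT[OF that] by (simp add: v_def)
    have GVm: "(\<lambda>x. ennreal (G (V x)) * indicator {0<..} x) \<in> borel_measurable borel"
      using Va Vb by (intro antitone_borel_measurable_ennreal phi_function_mono[OF G(1)]) (auto intro: less_imp_le order_less_le_trans)
    have Vm: "(\<lambda>x. V x * indicator {0<..} x) \<in> borel_measurable borel"
      by (intro antitone_borel_measurable Va)
    have vm: "(\<lambda>x. ennreal (v x) * indicator {0<..} x) \<in> borel_measurable borel"
    proof -
      have "(\<lambda>x. G (V x) * indicator {0<..} x) \<in> borel_measurable borel"
        using Va Vb by (intro antitone_borel_measurable phi_function_mono[OF G(1)]) (auto intro: less_imp_le order_less_le_trans)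
      then have "(\<lambda>x. ennreal ((G (V x) * indicator {0<..} x) / (V x * indicator {0<..} x))) \<in> borel_measurable borel"
        using Vm by measurable
      also have "(\<lambda>x. ennreal ((G (V x) * indicator {0<..} x) / (V x * indicator {0<..} x))) = (\<lambda>x. ennreal (v x) * indicator {0<..} x)"
        by (auto simp: indicator_def v_def)
      finally show ?thesis .
    qed
    define I where "I i = (\<integral>\<^sup>+ x\<in>{0<..}. ennreal (u i x * v x) \<partial>lborel)" for i
    have uvm: "(\<lambda>x. ennreal (u i x * v x) * indicator {0<..} x) \<in> borel_measurable borel" if "i < n" for i
    proof -
      have "(\<lambda>x. (ennreal (u i x) * indicator {0<..} x) * (ennreal (v x) * indicator {0<..} x)) \<in> borel_measurable borel"
        by (intro borel_measurable_times_ennreal vm antitone_borel_measurable_ennreal ua that)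
      also have "(\<lambda>x. (ennreal (u i x) * indicator {0<..} x) * (ennreal (v x) * indicator {0<..} x))
          = (\<lambda>x. ennreal (u i x * v x) * indicator {0<..} x)"
        using un[OF that] vpos by (auto simp: fun_eq_iff indicator_def ennreal_mult less_imp_le)
      finally show ?thesis .
    qed
    have GVI: "(\<integral>\<^sup>+ x\<in>{0<..}. ennreal (G (V x)) \<partial>lborel) \<le> 2"
    proof -
      have "(\<integral>\<^sup>+ x\<in>{0<..}. ennreal (G (V x)) \<partial>lborel) \<le>
         (\<integral>\<^sup>+ x. ennreal (G (U x)) * indicator {0<..} x + ennreal (G (e x)) * indicator {0<..} x \<partial>lborel)"
        by (intro nn_integral_mono) (auto simp: indicator_def V_def max_def)
      also have "\<dots> = modular G U + modular G e"
        unfolding modular_def using Ua Un e(1,2)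
        by (intro nn_integral_add) (auto intro!: antitone_borel_measurable_ennreal phi_function_mono[OF G(1)] intro: less_imp_le order_less_le_trans)
      also have "\<dots> \<le> 1 + 1" using um e(4) by (intro add_mono) (auto simp: U_def[abs_def])
      finally show ?thesis by simp
    qed
    have Isum: "(\<Sum>i<n. I i) \<le> 2"
    proof -
      have "(\<Sum>i<n. I i) = (\<integral>\<^sup>+ x. (\<Sum>i<n. ennreal (u i x * v x) * indicator {0<..} x) \<partial>lborel)"
        unfolding I_def using uvm by (subst nn_integral_sum) auto
      also have "\<dots> \<le> (\<integral>\<^sup>+ x\<in>{0<..}. ennreal (G (V x)) \<partial>lborel)"
      proof (intro nn_integral_mono)
        fix x :: real
        show "(\<Sum>i<n. ennreal (u i x * v x) * indicator {0<..} x) \<le> ennreal (G (V x)) * indicator {0<..} x"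
        proof (cases "0 < x")
          case True
          have "(\<Sum>i<n. ennreal (u i x * v x)) = ennreal (\<Sum>i<n. u i x * v x)"
            using un True vpos[OF True] by (intro sum_ennreal) (auto intro: less_imp_le)
          also have "(\<Sum>i<n. u i x * v x) = U x * v x" by (simp add: U_def sum_distrib_right)
          also have "\<dots> \<le> V x * v x" using vpos[OF True] by (intro mult_right_mono) (auto simp: V_def)
          also have "\<dots> = G (V x)" using Vb(1)[OF True] by (simp add: v_def)
          finally show ?thesis using True by (auto simp: ennreal_leI)
        qed auto
      qed
      finally show ?thesis using GVI by simp
    qed
    have Ifin: "I i < top" if "i < n" for i
    proof -
      have "I i \<le> (\<Sum>i<n. I i)" using that by (intro member_le_sum) auto
      also have "\<dots> \<le> 2" by (rule Isum)
      also have "\<dots> < top" by simp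
      finally show ?thesis .
    qed
    define c where "c i = enn2real (I i)" for i
    have cI: "ennreal (c i) = I i" if "i < n" for i using Ifin[OF that] by (simp add: c_def less_top)
    have "ennreal (\<Sum>i<n. c i) \<le> ennreal 2"
      using Isum cI by (subst sum_ennreal[symmetric]) (auto simp: c_def)
    then have csum: "(\<Sum>i<n. c i) \<le> D" by (subst (asm) ennreal_le_iff) (auto simp: D_def)
    have main: "modular G (\<lambda>x. u i x / (D * d)) \<le> 1" if i: "i < n" and d: "0 < d" "c i \<le> d" for i d
    proof -
      define g where "g x = u i x / d" for x
      have gn: "0 \<le> g x" if "0 < x" for x using un[OF i that] d by (simp add: g_def)
      have ga: "g y \<le> g x" if "0 < x" "x \<le> y" for x y using ua[OF i that] d by (simp add: g_def divide_right_mono)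
      have gv: "(\<integral>\<^sup>+ x\<in>{0<..}. ennreal (g x * v x) \<partial>lborel) \<le> 1"
      proof -
        have "(\<integral>\<^sup>+ x\<in>{0<..}. ennreal (g x * v x) \<partial>lborel) = (\<integral>\<^sup>+ x. ennreal (1/d) * (ennreal (u i x * v x) * indicator {0<..} x) \<partial>lborel)"
          using d by (intro nn_integral_cong) (auto simp: g_def indicator_def simp flip: ennreal_mult')
        also have "\<dots> = ennreal (1/d) * ennreal (c i)"
          unfolding cI[OF i] I_def using uvm[OF i] by (intro nn_integral_cmult) auto
        also have "\<dots> = ennreal (c i / d)" using d by (simp flip: ennreal_mult')
        also have "\<dots> \<le> ennreal 1" using d by (intro ennreal_leI) auto
        finally show ?thesis by simp
      qed
      \<comment> \<open>The hypothesis \<open>conc\<close> reaches only up to \<open>T x\<close>, so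
        \<open>g\<close> must first be brought below \<open>T\<close>. On \<open>{x/2<..x}\<close>
        the weight is bounded below by \<open>vlow\<close>, and \<open>g\<close> is antitone, so a
        larger value would make the integral exceed 1.\<close>
      have gT: "g x / C' \<le> T x" if x: "0 < x" for x
      proof -
        have "ennreal (g x / (C * x * T (x/2)) * (x/2)) = (\<integral>\<^sup>+ y. ennreal (g x / (C * x * T (x/2))) * indicator {x/2<..x} y \<partial>lborel)"
          using x gn[OF x] C Tpos[of "x/2"] by (subst nn_integral_cmult_indicator) (auto simp flip: ennreal_mult simp del: times_divide_eq_left times_divide_eq_right)
        also have "\<dots> \<le> (\<integral>\<^sup>+ x\<in>{0<..}. ennreal (g x * v x) \<partial>lborel)"
        proof (intro nn_integral_mono)
          fix y :: real
          have "g x / (C * x * T (x/2)) \<le> g y * v y" if y: "x/2 < y" "y \<le> x"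
          proof -
            have y0: "0 < y" using y x by simp
            have "T y \<le> T (x/2)" unfolding T_def using y x y0 by (intro phi_inv_mono[OF G(1)]) (auto simp: field_simps)
            then have "y * T y \<le> x * T (x/2)" using y y0 Tpos[OF y0] by (intro mult_mono) auto
            then have "1 / (x * T (x/2)) \<le> 1 / (y * T y)" using y0 Tpos[OF y0] by (simp add: divide_mono)
            also have "\<dots> \<le> C * v y" by (rule vlow[OF y0])
            finally have "1 / (x * T (x/2)) / C \<le> v y"
              using C by (simp add: pos_divide_le_eq mult.commute del: divide_divide_eq_left)
            then have "g x * (1 / (x * T (x/2)) / C) \<le> g y * v y"
              using ga[OF y0 y(2)] gn[OF x] gn[OF y0] C x Tpos[of "x/2"] by (intro mult_mono) auto
            then show ?thesis by (simp add: mult_ac)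
          qed
          then show "ennreal (g x / (C * x * T (x/2))) * indicator {x/2<..x} y \<le> ennreal (g y * v y) * indicator {0<..} y"
            using x by (auto simp: indicator_def intro!: ennreal_leI)
        qed
        also have "\<dots> \<le> 1" by (rule gv)
        finally have "ennreal (g x / (C * x * T (x/2)) * (x/2)) \<le> ennreal 1" by (simp only: ennreal_1)
        then have "g x / (C * x * T (x/2)) * (x/2) \<le> 1" by (subst (asm) ennreal_le_iff) auto
        then have "g x \<le> 2 * C * T (x/2)" using x C Tpos[of "x/2"] by (simp add: field_simps)
        also have "\<dots> \<le> 2 * C * (k * T x)" using Thalf[OF x] C by (intro mult_left_mono) auto
        also have "\<dots> = C' * T x" by (simp add: C'_def)
        finally show ?thesis using C' by (simp add: field_simps)
      qed
      have "modular G (\<lambda>x. g x / C') \<le> (\<integral>\<^sup>+ x. ennreal (G (V x)) * indicator {0<..} x + ennreal (g x * v x) * indicator {0<..} x \<partial>lborel)"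
        unfolding modular_def
      proof (intro nn_integral_mono)
        fix x :: real
        show "ennreal (G (g x / C')) * indicator {0<..} x \<le> ennreal (G (V x)) * indicator {0<..} x + ennreal (g x * v x) * indicator {0<..} x"
        proof (cases "0 < x")
          case True
          have g0: "0 \<le> g x / C'" using gn[OF True] C' by simp
          \<comment> \<open>Where \<open>g / C'\<close> stays below \<open>V\<close> the first
            summand suffices. Elsewhere \<open>conc\<close> compares it with \<open>V\<close>, and
            \<open>C \<le> C'\<close> absorbs the constant.\<close>
          have "G (g x / C') \<le> G (V x) + g x * v x"
          proof (cases "g x / C' \<le> V x")
            case le: True
            have "G (g x / C') \<le> G (V x)" by (rule phi_function_mono[OF G(1) g0 le])
            then show ?thesis using gn[OF True] vpos[OF True] mult_nonneg_nonneg[of "g x" "v x"] by linarith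
          next
            case False
            then have "V x \<le> g x / C'" by simp
            then have "G (g x / C') / (g x / C') \<le> C * v x"
              unfolding v_def using gT[OF True, unfolded T_def] Vb(2)[OF True] by (intro conc[OF True]) auto
            moreover have "0 < g x / C'" using False Vb(1)[OF True] by linarith
            ultimately have "G (g x / C') \<le> C * v x * (g x / C')" by (simp only: pos_divide_le_eq)
            also have "\<dots> = (C / C') * (g x * v x)" by simp
            also have "\<dots> \<le> 1 * (g x * v x)"
              using C' C gn[OF True] vpos[OF True] by (intro mult_right_mono) auto
            finally show ?thesis using phi_function_pos[OF G(1) Vb(1)[OF True]] by simp
          qed
          then have "ennreal (G (g x / C')) \<le> ennreal (G (V x) + g x * v x)" by (rule ennreal_leI)
          also have "\<dots> = ennreal (G (V x)) + ennreal (g x * v x)"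
            using phi_function_pos[OF G(1) Vb(1)[OF True]] gn[OF True] vpos[OF True] by (intro ennreal_plus) auto
          finally show ?thesis using True by simp
        qed auto
      qed
      also have "\<dots> = (\<integral>\<^sup>+ x\<in>{0<..}. ennreal (G (V x)) \<partial>lborel) + (\<integral>\<^sup>+ x\<in>{0<..}. ennreal (g x * v x) \<partial>lborel)"
      proof (intro nn_integral_add)
        have "(\<lambda>x. ennreal (1/d) * (ennreal (u i x * v x) * indicator {0<..} x)) \<in> borel_measurable lborel"
          using uvm[OF i] by simp
        also have "(\<lambda>x. ennreal (1/d) * (ennreal (u i x * v x) * indicator {0<..} x)) = (\<lambda>x. ennreal (g x * v x) * indicator {0<..} x)"
          using d by (auto simp: fun_eq_iff g_def indicator_def simp flip: ennreal_mult')
        finally show "(\<lambda>x. ennreal (g x * v x) * indicator {0<..} x) \<in> borel_measurable lborel" .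
      qed (use GVm in auto)
      also have "\<dots> \<le> 2 + 1" by (intro add_mono GVI gv)
      finally have m3: "modular G (\<lambda>x. g x / C') \<le> 3" by simp
      have Gm: "(\<lambda>x. ennreal (G (u i x / (D * d))) * indicator {0<..} x) \<in> borel_measurable lborel"
      proof -
        have "0 < D" by (simp add: D_def)
        then show ?thesis using ua[OF i] un[OF i] d
          by (simp, intro antitone_borel_measurable_ennreal phi_function_mono[OF G(1)] divide_right_mono) (auto intro: order_less_le_trans)
      qed
      have "3 * modular G (\<lambda>x. u i x / (D * d)) = (\<integral>\<^sup>+ x. 3 * (ennreal (G (u i x / (D * d))) * indicator {0<..} x) \<partial>lborel)"
        unfolding modular_def using Gm by (intro nn_integral_cmult[symmetric]) auto
      also have "\<dots> \<le> modular G (\<lambda>x. g x / C')"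
        unfolding modular_def
      proof (intro nn_integral_mono)
        fix x :: real
        show "3 * (ennreal (G (u i x / (D * d))) * indicator {0<..} x) \<le> ennreal (G (g x / C')) * indicator {0<..} x"
        proof (cases "0 < x")
          case True
          have "C' * k' \<le> D" by (simp add: D_def)
          then have "u i x / (D * d) \<le> u i x / (C' * k' * d)"
            using un[OF i True] d C' k' by (intro divide_left_mono mult_right_mono mult_pos_pos) (auto simp: D_def)
          also have "\<dots> = g x / C' / k'" by (simp add: g_def mult_ac)
          finally have le: "u i x / (D * d) \<le> g x / C' / k'" .
          have "3 * G (u i x / (D * d)) \<le> 3 * G (g x / C' / k')"
            using le un[OF i True] d \<open>0 < D\<close> by (intro mult_left_mono phi_function_mono[OF G(1)]) auto
          also have "\<dots> \<le> G (k' * (g x / C' / k'))" using gn[OF True] C' k' by (intro k'(2)) auto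
          also have "k' * (g x / C' / k') = g x / C'" using k' by simp
          finally have "ennreal (3 * G (u i x / (D * d))) \<le> ennreal (G (g x / C'))" by (rule ennreal_leI)
          then show ?thesis using True by (simp add: ennreal_mult')
        qed auto
      qed
      also have "\<dots> \<le> 3 * 1" using m3 by simp
      finally show ?thesis by (subst (asm) ennreal_mult_le_mult_iff) auto
    qed
    show "\<exists>c. (\<forall>i<n. 0 \<le> c i) \<and> (\<Sum>i<n. c i) \<le> D \<and>
         (\<forall>i<n. \<forall>d>0. c i \<le> d \<longrightarrow> modular G (\<lambda>x. u i x / (D * d)) \<le> 1)"
      using csum main by (intro exI[of _ c]) (auto simp: c_def)
  qed
qed

section \<open>From condition (J) to concavity\<close>

text \<open>A convex \<open>K\<close> with \<open>K 0 = 0\<close> has increasing quotient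
  \<open>K t / t\<close>. Here \<open>K\<close> is equivalent to the inverse of
  \<open>power_comp G q\<close> after \<open>H\<close>, so the quotient
  \<open>s / phi_inv H (power_comp G q s)\<close> inherits the monotonicity up to a
  constant.\<close>

lemma phi_succ_ratio_bound:
  assumes G: "phi_function G" and H: "phi_function H" and q: "0 < q"
    and succ: "phi_succ (\<lambda>t. phi_inv G t powr q) (phi_inv H)"
  obtains c where "1 \<le> c" "\<And>s t. 0 < s \<Longrightarrow> s \<le> t \<Longrightarrow>
    s / phi_inv H (power_comp G q s) \<le> c * (t / phi_inv H (power_comp G q t))"
proof -
  define G1 where "G1 = power_comp G q"
  have G1: "phi_function G1" unfolding G1_def by (rule phi_function_power_comp[OF G q])
  obtain K c0 where K: "convex_on {0..} K" and c0: "0 < c0"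
    and eq: "\<And>t. 0 \<le> t \<Longrightarrow> phi_inv G (phi_inv (phi_inv H) (t / c0)) powr q \<le> K t \<and>
       K t \<le> phi_inv G (phi_inv (phi_inv H) (c0 * t)) powr q"
    using succ unfolding phi_succ_def phi_equiv_def by (auto simp: o_def)
  have eq': "phi_inv G1 (H (t / c0)) \<le> K t" "K t \<le> phi_inv G1 (H (c0 * t))" if "0 \<le> t" for t
    using eq[OF that] that c0 phi_inv_phi_inv[OF H] phi_function_nonneg[OF H]
    by (auto simp: G1_def phi_inv_power_comp[OF G q])
  define c where "c = max 1 c0"
  have c: "1 \<le> c" "c0 \<le> c" by (auto simp: c_def)
  have lowK: "phi_inv G1 (H (t / c)) \<le> K t" if "0 \<le> t" for t
  proof -
    have "t / c \<le> t / c0" using that c c0 by (intro divide_left_mono) auto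
    then have "H (t / c) \<le> H (t / c0)" using that c by (intro phi_function_mono[OF H]) auto
    then have "phi_inv G1 (H (t / c)) \<le> phi_inv G1 (H (t / c0))"
      using that c by (intro phi_inv_mono[OF G1] phi_function_nonneg[OF H]) auto
    then show ?thesis using eq'(1)[OF that] by simp
  qed
  have uppK: "K t \<le> phi_inv G1 (H (c * t))" if "0 \<le> t" for t
  proof -
    have "H (c0 * t) \<le> H (c * t)" using that c c0 by (intro phi_function_mono[OF H] mult_right_mono) auto
    then have "phi_inv G1 (H (c0 * t)) \<le> phi_inv G1 (H (c * t))"
      using that c0 by (intro phi_inv_mono[OF G1] phi_function_nonneg[OF H]) auto
    then show ?thesis using eq'(2)[OF that] by simp
  qed
  have K0: "K 0 = 0"
    using lowK[of 0] uppK[of 0] phi_inv_zero[OF G1] phi_function_zero[OF H] by simp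
  have Kr: "K t \<le> t / t' * K t'" if "0 < t" "t \<le> t'" for t t'
    using convex_onD[OF K, of "t / t'" 0 t'] that K0 by simp
  have main: "s / phi_inv H (G1 s) \<le> c\<^sup>2 * (t / phi_inv H (G1 t))" if st: "0 < s" "s \<le> t" for s t
  proof -
    define a where "a = phi_inv H (G1 s)"
    define b where "b = phi_inv H (G1 t)"
    have p: "0 < G1 s" "0 < G1 t" using phi_function_pos[OF G1] st by auto
    have a: "0 < a" "H a = G1 s" and b: "0 < b" "H b = G1 t"
      using phi_inv_pos[OF H] phi_inv_right[OF H] p by (auto simp: a_def b_def)
    \<comment> \<open>Equivalence rescales arguments by \<open>c\<close> on both sides. If
      \<open>a\<close> and \<open>b\<close> are too close to leave room for this, they differ by at
      most \<open>c\<^sup>2\<close> and \<open>s \<le> t\<close> is already enough.\<close>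
    show ?thesis
    proof (cases "c * a \<le> b / c")
      case True
      have "s \<le> K (c * a)" using lowK[of "c * a"] a c phi_inv_left[OF G1, of s] st by simp
      also have "\<dots> \<le> c * a / (b / c) * K (b / c)" using True a c by (intro Kr) auto
      also have "\<dots> \<le> c * a / (b / c) * t"
        using uppK[of "b / c"] a b c phi_inv_left[OF G1, of t] st by (intro mult_left_mono) auto
      finally have "s \<le> a * (c\<^sup>2 * (t / b))" by (simp add: power2_eq_square mult_ac)
      then show ?thesis unfolding a_def[symmetric] b_def[symmetric] using a by (simp add: pos_divide_le_eq mult.commute)
    next
      case False
      then have "b < c\<^sup>2 * a" using c by (simp add: field_simps power2_eq_square)
      then have "s * b \<le> t * (c\<^sup>2 * a)" using st b by (intro mult_mono) auto
      then show ?thesis unfolding a_def[symmetric] b_def[symmetric] using a b by (simp add: field_simps)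
    qed
  qed
  have "1 \<le> c\<^sup>2" using c by simp
  with main show ?thesis using that unfolding G1_def by blast
qed

text \<open>With \<open>m\<close> the inverse of the complementary function, \<open>G1 s\<close> is
  comparable to \<open>phi_inv H (G1 s) * m (G1 s)\<close>. The quotient of the first factor by
  \<open>s\<close> is almost decreasing by the ratio bound, so \<open>G1 s / s\<close> can grow only
  through \<open>m (G1 s)\<close>. The threshold \<open>e x\<close> is placed where
  \<open>m (G1 s)\<close> has dropped to \<open>m (1 / x) / d\<close>, and condition (J) says that
  the modular of these thresholds is at most 1.\<close>

lemma condition_J_concavity:
  assumes G: "phi_function G" and H: "phi_function H" and q: "0 < q"
    and succ: "phi_succ (\<lambda>t. phi_inv G t powr q) (phi_inv H)" and J: "condition_J H"
  obtains e C where
    "\<And>x y. 0 < x \<Longrightarrow> x \<le> y \<Longrightarrow> e y \<le> e x" "\<And>x. 0 < x \<Longrightarrow> 0 < e x"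
    "\<And>x. 0 < x \<Longrightarrow> e x \<le> phi_inv (power_comp G q) (1 / x)" "modular (power_comp G q) e \<le> 1"
    "\<And>x s t. 0 < x \<Longrightarrow> e x \<le> s \<Longrightarrow> s \<le> t \<Longrightarrow> t \<le> phi_inv (power_comp G q) (1 / x) \<Longrightarrow>
      power_comp G q t / t \<le> C * (power_comp G q s / s)"
    "1 \<le> C"
proof -
  define G1 where "G1 = power_comp G q"
  have G1: "phi_function G1" unfolding G1_def by (rule phi_function_power_comp[OF G q])
  obtain c where c: "1 \<le> c" and ratio: "\<And>s t. 0 < s \<Longrightarrow> s \<le> t \<Longrightarrow>
    s / phi_inv H (G1 s) \<le> c * (t / phi_inv H (G1 t))"
    using phi_succ_ratio_bound[OF G H q succ] unfolding G1_def by metis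
  obtain Hs where comp: "complementary H Hs" and lux: "luxemburg Hs (\<lambda>x. ereal (1 / phi_inv (tilde Hs) x)) < \<infinity>"
    using J unfolding condition_J_def by blast
  have Hs: "phi_function Hs" using comp by (simp add: complementary_def)
  define m where "m = phi_inv Hs"
  obtain cc where cc: "0 < cc" "\<And>t. 0 \<le> t \<Longrightarrow> t / cc \<le> phi_inv H t * m t \<and> phi_inv H t * m t \<le> cc * t"
    using comp unfolding complementary_def m_def by blast
  obtain cj where cj: "0 < cj" and int: "(\<integral>\<^sup>+ x\<in>{0..}. ennreal (Hs (\<bar>1 / phi_inv (tilde Hs) x\<bar> / cj)) \<partial>lborel) \<le> 1"
    using lux unfolding luxemburg_def Inf_less_iff by auto
  \<comment> \<open>Taking the constant at least 1 keeps the threshold \<open>e x\<close> below the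
    upper end \<open>phi_inv G1 (1 / x)\<close>; enlarging it preserves the integral bound.\<close>
  define d where "d = max 1 cj"
  have d: "1 \<le> d" "cj \<le> d" by (auto simp: d_def)
  define e where "e x = phi_inv G1 (Hs (m (1 / x) / d))" for x
  have mpos: "0 < m y" if "0 < y" for y using phi_inv_pos[OF Hs that] by (simp add: m_def)
  have md: "0 < m (1/x) / d" "m (1/x) / d \<le> m (1/x)" if "0 < x" for x
    using mpos[of "1/x"] d that mult_left_mono[of 1 d "m (1/x)"] by (auto simp: field_simps)
  have Hpos: "0 < Hs (m (1/x) / d)" if "0 < x" for x using phi_function_pos[OF Hs md(1)[OF that]] .
  have Hle: "Hs (m (1/x) / d) \<le> 1 / x" if "0 < x" for x
    using phi_function_mono[OF Hs _ md(2)[OF that]] md(1)[OF that] phi_inv_right[OF Hs, of "1/x"] that by (simp add: m_def)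
  show ?thesis
  proof (rule that[of e "max 1 (cc * c * cc * d)"], goal_cases)
    case (1 x y)
    then have "m (1/y) \<le> m (1/x)" unfolding m_def by (intro phi_inv_mono[OF Hs]) (auto simp: field_simps)
    then have "m (1/y) / d \<le> m (1/x) / d" using d by (intro divide_right_mono) auto
    then show ?case unfolding e_def using 1 md(1)[of y] Hpos[of y]
      by (intro phi_inv_mono[OF G1] phi_function_mono[OF Hs]) (auto intro: less_imp_le)
  next
    case (2 x)
    then show ?case unfolding e_def using Hpos by (intro phi_inv_pos[OF G1])
  next
    case (3 x)
    then show ?case unfolding e_def G1_def[symmetric] using Hpos[of x] Hle[of x] by (intro phi_inv_mono[OF G1]) auto
  next
    case 4
    have "modular G1 e \<le> (\<integral>\<^sup>+ x\<in>{0..}. ennreal (Hs (\<bar>1 / phi_inv (tilde Hs) x\<bar> / cj)) \<partial>lborel)"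
      unfolding modular_def
    proof (intro nn_integral_mono)
      fix x :: real
      have "G1 (e x) \<le> Hs (\<bar>1 / phi_inv (tilde Hs) x\<bar> / cj)" if x: "0 < x"
      proof -
        have "G1 (e x) = Hs (m (1/x) / d)" unfolding e_def using Hpos[OF x] by (intro phi_inv_right[OF G1]) auto
        also have "\<dots> \<le> Hs (m (1/x) / cj)"
          using md(1)[OF x] cj d mpos[of "1/x"] x by (intro phi_function_mono[OF Hs] divide_left_mono) auto
        also have "m (1/x) = \<bar>1 / phi_inv (tilde Hs) x\<bar>"
          using mpos[of "1/x"] x by (simp add: phi_inv_tilde[OF Hs x] m_def)
        finally show ?thesis .
      qed
      then show "ennreal (G1 (e x)) * indicator {0<..} x \<le> ennreal (Hs (\<bar>1 / phi_inv (tilde Hs) x\<bar> / cj)) * indicator {0..} x"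
        by (auto simp: indicator_def intro: ennreal_leI)
    qed
    then show ?case unfolding G1_def[symmetric] using int by simp
  next
    case (5 x s t)
    note x = \<open>0 < x\<close>
    have s0: "0 < s" using 5 phi_inv_pos[OF G1 Hpos[OF x]] by (simp add: e_def)
    have t0: "0 < t" using s0 5 by simp
    have p: "0 < G1 s" "0 < G1 t" using phi_function_pos[OF G1] s0 t0 by auto
    have "Hs (m (1/x) / d) \<le> G1 s"
      using 5(2) s0 Hpos[OF x] phi_inv_le_iff[OF G1, of "Hs (m (1/x) / d)" s] by (simp add: e_def)
    then have "m (1/x) / d \<le> m (G1 s)"
      unfolding m_def using p md(1)[OF x] by (subst le_phi_inv_iff[OF Hs]) (auto simp: m_def)
    then have ms: "m (1/x) \<le> d * m (G1 s)" using d by (simp add: field_simps)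
    have "G1 t \<le> 1 / x" using 5(4) t0 x le_phi_inv_iff[OF G1, of "1/x" t] by (simp add: G1_def)
    then have "m (G1 t) \<le> m (1/x)" unfolding m_def using p by (intro phi_inv_mono[OF Hs]) auto
    with ms have mts: "m (G1 t) \<le> d * m (G1 s)" by simp
    define a where "a = phi_inv H (G1 s)"
    define b where "b = phi_inv H (G1 t)"
    have ab: "0 < a" "0 < b" using phi_inv_pos[OF H] p by (auto simp: a_def b_def)
    have r: "s / a \<le> c * (t / b)" unfolding a_def b_def by (rule ratio[OF s0 5(3)])
    then have r': "b * s \<le> c * t * a" using ab by (simp add: field_simps)
    have "G1 t \<le> cc * (b * m (G1 t))" using cc(2)[of "G1 t"] cc(1) p by (simp add: b_def field_simps)
    also have "\<dots> \<le> cc * (b * (d * m (G1 s)))" using mts cc(1) ab by (intro mult_left_mono) auto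
    finally have "G1 t * s \<le> cc * (b * (d * m (G1 s))) * s" using s0 by (intro mult_right_mono) auto
    also have "\<dots> = cc * d * m (G1 s) * (b * s)" by simp
    also have "\<dots> \<le> cc * d * m (G1 s) * (c * t * a)"
      using r' cc(1) d mpos[OF p(1)] by (intro mult_left_mono) auto
    also have "\<dots> = cc * d * c * t * (a * m (G1 s))" by simp
    also have "\<dots> \<le> cc * d * c * t * (cc * G1 s)"
      using cc(2)[of "G1 s"] cc(1) d c t0 p by (intro mult_left_mono) (auto simp: a_def)
    finally have "G1 t * s \<le> (cc * c * cc * d) * (G1 s * t)" by (simp add: mult_ac)
    also have "\<dots> \<le> max 1 (cc * c * cc * d) * (G1 s * t)" using p t0 by (intro mult_right_mono) auto
    finally show ?case unfolding G1_def[symmetric] using s0 t0 by (simp add: field_simps)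
  qed auto
qed

section \<open>Tail integrals as a superadditive substitute for the rearrangement\<close>

definition tail_integral :: "real \<Rightarrow> (real \<Rightarrow> real) \<Rightarrow> real \<Rightarrow> ennreal" where
  "tail_integral q f s = Inf {\<integral>\<^sup>+ y\<in>{0..} - E. ennreal (\<bar>f y\<bar> powr q) \<partial>lborel | E.
     E \<in> sets borel \<and> emeasure lborel E \<le> ennreal (s / 2)}"

lemma tail_integral_antimono:
  assumes "s \<le> t"
  shows "tail_integral q f t \<le> tail_integral q f s"
proof -
  have *: "ennreal (s / 2) \<le> ennreal (t / 2)" using assms by (intro ennreal_leI) auto
  show ?thesis unfolding tail_integral_def
    by (intro Inf_superset_mono) (auto intro: order_trans[OF _ *])
qed

text \<open>An exceptional set \<open>E\<close> chosen for the combined function is admissible for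
  every \<open>f i\<close>, and outside \<open>E\<close> the integrals add up exactly.\<close>

lemma tail_integral_superadditive:
  assumes "0 < q" "\<And>i. i < n \<Longrightarrow> f i \<in> borel_measurable borel"
  shows "(\<Sum>i<n. tail_integral q (f i) s) \<le> tail_integral q (\<lambda>x. (\<Sum>i<n. \<bar>f i x\<bar> powr q) powr (1 / q)) s"
  unfolding tail_integral_def[of q "\<lambda>x. (\<Sum>i<n. \<bar>f i x\<bar> powr q) powr (1 / q)"]
proof (rule Inf_greatest)
  let ?f = "\<lambda>x. (\<Sum>i<n. \<bar>f i x\<bar> powr q) powr (1 / q)"
  fix z assume "z \<in> {\<integral>\<^sup>+ y\<in>{0..} - E. ennreal (\<bar>?f y\<bar> powr q) \<partial>lborel | E.
     E \<in> sets borel \<and> emeasure lborel E \<le> ennreal (s / 2)}"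
  then obtain E where E: "E \<in> sets borel" "emeasure lborel E \<le> ennreal (s / 2)"
    and z: "z = (\<integral>\<^sup>+ y\<in>{0..} - E. ennreal (\<bar>?f y\<bar> powr q) \<partial>lborel)" by auto
  have "(\<Sum>i<n. tail_integral q (f i) s) \<le> (\<Sum>i<n. \<integral>\<^sup>+ y\<in>{0..} - E. ennreal (\<bar>f i y\<bar> powr q) \<partial>lborel)"
    unfolding tail_integral_def using E by (intro sum_mono Inf_lower) auto
  also have "\<dots> = (\<integral>\<^sup>+ y. (\<Sum>i<n. ennreal (\<bar>f i y\<bar> powr q) * indicator ({0..} - E) y) \<partial>lborel)"
    using assms(2) E by (intro nn_integral_sum[symmetric]) auto
  also have "\<dots> = z"
    unfolding z
  proof (intro nn_integral_cong)
    fix y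
    have nn: "0 \<le> (\<Sum>i<n. \<bar>f i y\<bar> powr q)" by (intro sum_nonneg) auto
    have "\<bar>?f y\<bar> powr q = (\<Sum>i<n. \<bar>f i y\<bar> powr q)" using nn assms(1) by (simp add: powr_powr)
    then show "(\<Sum>i<n. ennreal (\<bar>f i y\<bar> powr q) * indicator ({0..} - E) y) = ennreal (\<bar>?f y\<bar> powr q) * indicator ({0..} - E) y"
      by (simp add: sum_distrib_right[symmetric] sum_ennreal)
  qed
  finally show "(\<Sum>i<n. tail_integral q (f i) s) \<le> z" .
qed

text \<open>A level strictly below \<open>rearr f s\<close> is exceeded on a set of measure at least
  \<open>s\<close>, and removing \<open>E\<close> leaves at least \<open>s / 2\<close> of it. Half
  the rearrangement is such a level.\<close>

lemma tail_integral_lower: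
  assumes "f \<in> borel_measurable borel" "fin_rearr f" "0 < s" "0 < q"
  shows "ennreal (s / 2 * (rearr f s / 2) powr q) \<le> tail_integral q f s"
  unfolding tail_integral_def
proof (rule Inf_greatest)
  fix z assume "z \<in> {\<integral>\<^sup>+ y\<in>{0..} - E. ennreal (\<bar>f y\<bar> powr q) \<partial>lborel | E.
     E \<in> sets borel \<and> emeasure lborel E \<le> ennreal (s / 2)}"
  then obtain E where E: "E \<in> sets borel" "emeasure lborel E \<le> ennreal (s / 2)"
    and z: "z = (\<integral>\<^sup>+ y\<in>{0..} - E. ennreal (\<bar>f y\<bar> powr q) \<partial>lborel)" by auto
  define t where "t = rearr f s / 2"
  show "ennreal (s / 2 * (rearr f s / 2) powr q) \<le> z"
  proof (cases "t = 0")
    case True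
    then show ?thesis by (simp add: t_def)
  next
    case False
    then have t: "0 < t" using rearr_nonneg[of f s] by (simp add: t_def)
    let ?L = "{y\<in>{0..}. t \<le> \<bar>f y\<bar>}"
    have Lm: "?L \<in> sets borel" using assms(1) by measurable
    have "\<not> fstar f s \<le> ereal t" using t ereal_rearr[OF assms(2,3)] by (simp add: t_def flip: \<open>ereal (rearr f s) = fstar f s\<close>)
    then obtain t' where t': "t < t'" "ennreal s \<le> distr_fn f t'"
      using fstar_le[of t f s] by (meson not_less)
    have "ennreal s \<le> emeasure lborel ?L"
      using t' Lm by (intro order_trans[OF t'(2)] emeasure_mono) auto
    also have "\<dots> \<le> emeasure lborel ((?L - E) \<union> E)" using Lm E by (intro emeasure_mono) auto
    also have "\<dots> \<le> emeasure lborel (?L - E) + emeasure lborel E"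
      using Lm E by (intro emeasure_subadditive) auto
    also have "\<dots> \<le> emeasure lborel (?L - E) + ennreal (s / 2)" using E by (intro add_left_mono)
    finally have "ennreal (s/2) + ennreal (s/2) \<le> emeasure lborel (?L - E) + ennreal (s / 2)"
      using assms(3) by (simp flip: ennreal_plus)
    then have L2: "ennreal (s/2) \<le> emeasure lborel (?L - E)"
      by (metis ennreal_add_left_cancel_le add.commute ennreal_neq_top infinity_ennreal_def)
    have "ennreal (s / 2 * t powr q) = ennreal (t powr q) * ennreal (s/2)"
      using assms(3) by (simp flip: ennreal_mult add: mult.commute)
    also have "\<dots> \<le> ennreal (t powr q) * emeasure lborel (?L - E)" using L2 by (intro mult_left_mono) auto
    also have "\<dots> = (\<integral>\<^sup>+ y. ennreal (t powr q) * indicator (?L - E) y \<partial>lborel)"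
      using Lm E by (intro nn_integral_cmult_indicator[symmetric]) auto
    also have "\<dots> \<le> z"
      unfolding z using t assms(4) by (intro nn_integral_mono) (auto simp: indicator_def intro!: ennreal_leI powr_mono2)
    finally show ?thesis by (simp add: t_def)
  qed
qed

text \<open>Discard the set where \<open>\<bar>f\<bar>\<close> exceeds
  \<open>rearr f (s / 2)\<close>, which is small enough, and slice the rest into layers between
  consecutive values \<open>rearr f (2 ^ k * s / 2)\<close>. The layer with number \<open>k\<close>
  has measure at most \<open>2 ^ k * s\<close>. The limit hypothesis ensures that every point with
  \<open>f y \<noteq> 0\<close> lies in some layer.\<close>

lemma tail_integral_upper:
  assumes "f \<in> borel_measurable borel" "fin_rearr f" "0 < s" "0 < q"
    and lim: "(\<lambda>k. rearr f (2 ^ k * s / 2)) \<longlonglongrightarrow> 0"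
  shows "tail_integral q f s \<le> (\<Sum>k. ennreal (2 ^ k * s * rearr f (2 ^ k * s / 2) powr q))"
proof -
  define r where "r k = rearr f (2 ^ k * s / 2)" for k :: nat
  define E where "E k = {y\<in>{0..}. r k < \<bar>f y\<bar>}" for k
  have Em: "E k \<in> sets borel" for k unfolding E_def using assms(1) by measurable
  have Ee: "emeasure lborel (E k) \<le> ennreal (2 ^ k * s / 2)" for k
    unfolding E_def r_def using assms by (intro emeasure_gt_rearr) auto
  have "tail_integral q f s \<le> (\<integral>\<^sup>+ y\<in>{0..} - E 0. ennreal (\<bar>f y\<bar> powr q) \<partial>lborel)"
    unfolding tail_integral_def using Em[of 0] Ee[of 0] by (intro Inf_lower) auto
  also have "\<dots> \<le> (\<integral>\<^sup>+ y. (\<Sum>k. ennreal (r k powr q) * indicator (E (Suc k)) y) \<partial>lborel)"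
  proof (intro nn_integral_mono)
    fix y
    show "ennreal (\<bar>f y\<bar> powr q) * indicator ({0..} - E 0) y \<le> (\<Sum>k. ennreal (r k powr q) * indicator (E (Suc k)) y)"
    proof (cases "y \<in> {0..} - E 0 \<and> f y \<noteq> 0")
      case True
      have "\<exists>k. r k < \<bar>f y\<bar>"
        using lim True unfolding r_def[symmetric] by (metis eventually_sequentially order_tendstoD(2) zero_less_abs_iff order_refl)
      then have ex: "\<exists>k. y \<in> E k" using True by (auto simp: E_def)
      define j where "j = (LEAST k. y \<in> E k)"
      have j: "y \<in> E j" "\<And>k. k < j \<Longrightarrow> y \<notin> E k"
        using LeastI_ex[OF ex] not_less_Least unfolding j_def by auto
      have "j \<noteq> 0" using j(1) True by (metis DiffD2)
      then obtain k where k: "j = Suc k" using not0_implies_Suc by blast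
      have "\<bar>f y\<bar> \<le> r k" using j(2)[of k] k True by (auto simp: E_def)
      then have "ennreal (\<bar>f y\<bar> powr q) \<le> ennreal (r k powr q) * indicator (E (Suc k)) y"
        using j(1) k assms(4) by (auto intro!: ennreal_leI powr_mono2)
      also have "\<dots> = (\<Sum>k\<in>{k}. ennreal (r k powr q) * indicator (E (Suc k)) y)"
        by (metis (no_types, lifting) add_0_right empty_iff finite.intros(1) sum.empty sum.insert)
      also have "\<dots> \<le> (\<Sum>k. ennreal (r k powr q) * indicator (E (Suc k)) y)" by (intro sum_le_suminf) auto
      finally show ?thesis using True by simp
    next
      case False
      then show ?thesis by (auto simp: indicator_def)
    qed
  qed
  also have "\<dots> = (\<Sum>k. \<integral>\<^sup>+ y. ennreal (r k powr q) * indicator (E (Suc k)) y \<partial>lborel)"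
    using Em by (intro nn_integral_suminf) auto
  also have "\<dots> \<le> (\<Sum>k. ennreal (2 ^ k * s * r k powr q))"
  proof (intro suminf_le)
    fix k
    have "(\<integral>\<^sup>+ y. ennreal (r k powr q) * indicator (E (Suc k)) y \<partial>lborel) = ennreal (r k powr q) * emeasure lborel (E (Suc k))"
      using Em by (intro nn_integral_cmult_indicator) auto
    also have "\<dots> \<le> ennreal (r k powr q) * ennreal (2 ^ Suc k * s / 2)" using Ee[of "Suc k"] by (intro mult_left_mono) auto
    also have "\<dots> = ennreal (2 ^ k * s * r k powr q)" using assms(3) by (simp flip: ennreal_mult add: mult_ac)
    finally show "(\<integral>\<^sup>+ y. ennreal (r k powr q) * indicator (E (Suc k)) y \<partial>lborel) \<le> ennreal (2 ^ k * s * r k powr q)" .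
  qed auto
  finally show ?thesis unfolding r_def .
qed

lemma two_powr_neg_less_one: "z < 0 \<Longrightarrow> 2 powr z < (1::real)"
  using powr_less_mono[of z 0 "2::real"] by simp

lemma modular_scale:
  assumes G: "phi_function G" and u: "\<And>x y. 0 < x \<Longrightarrow> x \<le> y \<Longrightarrow> u y \<le> u x" "\<And>x. 0 < x \<Longrightarrow> 0 \<le> u x"
    and e: "0 < e" and K: "0 \<le> K" "\<And>z. 0 \<le> z \<Longrightarrow> G (e * z) \<le> K * G z" and m: "modular G u \<le> 1"
  shows "modular G (\<lambda>x. e * u x) \<le> ennreal K"
proof -
  have "modular G (\<lambda>x. e * u x) \<le> (\<integral>\<^sup>+ x. ennreal K * (ennreal (G (u x)) * indicator {0<..} x) \<partial>lborel)"
    unfolding modular_def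
  proof (intro nn_integral_mono)
    fix x :: real
    show "ennreal (G (e * u x)) * indicator {0<..} x \<le> ennreal K * (ennreal (G (u x)) * indicator {0<..} x)"
      using K(2)[OF u(2)[of x]] K(1) by (auto simp: indicator_def intro!: ennreal_leI simp flip: ennreal_mult')
  qed
  also have "\<dots> = ennreal K * modular G u"
    unfolding modular_def using u
    by (intro nn_integral_cmult) (auto intro!: antitone_borel_measurable_ennreal phi_function_mono[OF G] intro: order_less_le_trans)
  also have "\<dots> \<le> ennreal K * 1" using m by (intro mult_left_mono) auto
  finally show ?thesis by simp
qed

text \<open>The upper Boyd index makes \<open>\<Sum>k. 2 ^ k * rearr f (2 ^ k * s / 2) powr q\<close>, which dominates the
  tail integral, converge geometrically; dilatoriness of \<open>G\<close> controls the supremum of its terms.\<close>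

lemma modular_tail_integral:
  assumes F: "phi_function F" and G: "phi_function G" "dilatory G" and q: "0 < q0" "q0 < q" and c: "0 < c"
    and dil: "\<And>f k. in_space (OL_norm F G) f \<Longrightarrow>
       OL_norm F G (dil (2 ^ k / 2) f) \<le> ennreal (c * 2 powr (- real k / q0)) * OL_norm F G f"
  obtains L where "0 < L" "\<And>f \<theta>. f \<in> borel_measurable borel \<Longrightarrow> 0 < \<theta> \<Longrightarrow> OL_norm F G f < ennreal \<theta> \<Longrightarrow>
     (\<forall>x>0. tail_integral q f (wt F G x) < \<infinity>) \<and>
     modular (power_comp G q) (\<lambda>x. enn2real (tail_integral q f (wt F G x)) / wt F G x / (L * \<theta> powr q)) \<le> 1"
proof -
  obtain C1 p where Cp: "1 \<le> C1" "0 < p" and decay: "\<And>e z. 0 < e \<Longrightarrow> e \<le> 1 \<Longrightarrow> 0 \<le> z \<Longrightarrow> G (e * z) \<le> C1 * e powr p * G z"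
    using dilatory_power_bound[OF G] by metis
  have q': "0 < q" using q by simp
  \<comment> \<open>Half of the surplus exponent: one \<open>\<eta>\<close> makes the modulars of
    \<open>Z k\<close> decay like \<open>a ^ k\<close>, the other makes the terms of the tail series
    decay like \<open>b ^ k\<close>.\<close>
  define \<eta> where "\<eta> = (1 / q0 - 1 / q) / 2"
  have \<eta>: "0 < \<eta>" "1 / q0 = 1 / q + 2 * \<eta>" using q by (auto simp: \<eta>_def field_simps)
  define a where "a = 2 powr (- \<eta> * p)"
  have a: "0 < a" "a < 1" using \<eta> Cp by (auto simp: a_def intro!: two_powr_neg_less_one)
  define b where "b = 2 powr (- \<eta> * q)"
  have b: "0 < b" "b < 1" using \<eta> q' by (auto simp: b_def intro!: two_powr_neg_less_one)
  have geo: "(\<lambda>k. K * r ^ k) sums (K * (1 / (1 - r)))" if "0 < r" "r < 1" for K r :: real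
    using sums_mult[OF geometric_sums[of r], of K] that by simp
  \<comment> \<open>Chosen so that the geometric bounds
    \<open>C1 * \<Lambda> powr (- p) * a ^ k\<close> add up to at most 1.\<close>
  define \<Lambda> where "\<Lambda> = max 1 ((C1 / (1 - a)) powr (1 / p))"
  have \<Lambda>: "1 \<le> \<Lambda>" by (simp add: \<Lambda>_def)
  have \<Lambda>p: "C1 * \<Lambda> powr (- p) \<le> 1 - a"
  proof -
    have "C1 / (1 - a) = ((C1 / (1 - a)) powr (1 / p)) powr p" using Cp a by (simp add: powr_powr)
    also have "\<dots> \<le> \<Lambda> powr p" using Cp by (intro powr_mono2) (auto simp: \<Lambda>_def)
    finally show ?thesis using a \<Lambda> by (simp add: powr_minus_divide field_simps)
  qed
  define L where "L = (c * \<Lambda>) powr q * (1 / (1 - b))"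
  have L: "0 < L" using c \<Lambda> b by (simp add: L_def)
  show ?thesis
  proof (rule that[OF L])
    fix f :: "real \<Rightarrow> real" and \<theta> :: real
    assume f: "f \<in> borel_measurable borel" and \<theta>: "0 < \<theta>" "OL_norm F G f < ennreal \<theta>"
    have fin: "fin_rearr f" by (rule OL_norm_lessD(1)[OF F G(1) \<theta>(2)])
    have insp: "in_space (OL_norm F G) f" using f \<theta>(2) by (auto simp: in_space_def intro: less_trans)
    define w where "w = wt F G"
    have wpos: "0 < w x" if "0 < x" for x using wt_pos[OF F G(1) that] by (simp add: w_def)
    have wmono: "w x \<le> w y" if "0 < x" "x \<le> y" for x y using wt_mono[OF F G(1)] that by (simp add: w_def)
    define R where "R k x = rearr f (2 ^ k / 2 * w x) / (c * \<theta>)" for k :: nat and x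
    have R: "0 \<le> R k x" for k x using c \<theta> rearr_nonneg by (simp add: R_def)
    have Ra: "R k y \<le> R k x" if "0 < x" "x \<le> y" for k x y
      unfolding R_def using that wpos[of x] wmono[OF that] c \<theta>
      by (intro divide_right_mono rearr_antimono[OF fin] mult_left_mono) auto
    have mod1: "modular G (\<lambda>x. 2 powr (real k / q0) * R k x) \<le> 1" for k
    proof -
      define h where "h = c * 2 powr (- real k / q0)"
      have h: "0 < h" using c by (simp add: h_def)
      have "OL_norm F G (dil (2 ^ k / 2) f) \<le> ennreal h * OL_norm F G f" using dil[OF insp] by (simp add: h_def)
      also have "\<dots> < ennreal h * ennreal \<theta>" using \<theta>(2) h by (intro ennreal_mult_strict_left_mono) auto
      also have "\<dots> = ennreal (h * \<theta>)" using h by (simp add: ennreal_mult')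
      finally have "modular G (\<lambda>x. rearr (dil (2 ^ k / 2) f) (w x) / (h * \<theta>)) \<le> 1"
        using OL_norm_lessD(2)[OF F G(1)] by (simp add: w_def)
      also have "modular G (\<lambda>x. rearr (dil (2 ^ k / 2) f) (w x) / (h * \<theta>)) = modular G (\<lambda>x. 2 powr (real k / q0) * R k x)"
        unfolding modular_def
      proof (intro nn_integral_cong)
        fix x :: real
        have "rearr (dil (2 ^ k / 2) f) (w x) / (h * \<theta>) = 2 powr (real k / q0) * R k x" if "0 < x"
          using rearr_dil[OF f, of "2 ^ k / 2" "w x"] wpos[OF that] by (simp add: R_def h_def powr_minus_divide)
        then show "ennreal (G (rearr (dil (2 ^ k / 2) f) (w x) / (h * \<theta>))) * indicator {0<..} x =
           ennreal (G (2 powr (real k / q0) * R k x)) * indicator {0<..} x" by (auto simp: indicator_def)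
      qed
      finally show ?thesis .
    qed
    \<comment> \<open>By the Boyd bound the bracketed function has modular at most 1; the prefactor
      spends one \<open>\<eta>\<close> to make these modulars summable in \<open>k\<close>.\<close>
    define Z where "Z k x = 2 powr (- real k * \<eta>) / \<Lambda> * (2 powr (real k / q0) * R k x)" for k x
    have Z: "0 \<le> Z k x" for k x using R \<Lambda> by (simp add: Z_def)
    have Za: "Z k y \<le> Z k x" if "0 < x" "x \<le> y" for k x y
      unfolding Z_def using Ra[OF that] \<Lambda> by (intro mult_left_mono) auto
    have GZa: "G (Z k y) \<le> G (Z k x)" if "0 < x" "x \<le> y" for k x y
      by (intro phi_function_mono[OF G(1)] Z Za that)
    have RZ: "rearr f (2 ^ k * w x / 2) = c * \<theta> * \<Lambda> * 2 powr (- real k * (1 / q + \<eta>)) * Z k x" for k x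
    proof -
      have "2 powr (- real k * (1 / q + \<eta>)) * (2 powr (- real k * \<eta>) * 2 powr (real k / q0)) = 1"
      proof -
        have "real k / q0 = real k * (1 / q + 2 * \<eta>)" unfolding \<eta>(2)[symmetric] by simp
        then show ?thesis unfolding powr_add[symmetric] by (simp add: algebra_simps)
      qed
      then have e: "R k x = \<Lambda> * 2 powr (- real k * (1 / q + \<eta>)) * Z k x"
        using \<Lambda> by (simp add: Z_def mult_ac)
      have "rearr f (2 ^ k * w x / 2) = c * \<theta> * R k x" using c \<theta> by (simp add: R_def)
      also have "\<dots> = c * \<theta> * (\<Lambda> * 2 powr (- real k * (1 / q + \<eta>)) * Z k x)" by (subst e) simp
      finally show ?thesis by (simp add: mult_ac)
    qed
    have modZ: "modular G (Z k) \<le> ennreal (C1 * \<Lambda> powr (- p) * a ^ k)" for k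
    proof -
      let ?e = "2 powr (- real k * \<eta>) / \<Lambda>"
      have "2 powr (- real k * \<eta>) \<le> 2 powr 0" using \<eta> by (intro powr_mono) auto
      then have e: "0 < ?e" "?e \<le> 1" using \<Lambda> by (auto simp: divide_le_eq)
      have "?e powr p = (2 powr (- real k * \<eta>)) powr p / \<Lambda> powr p" by (rule powr_divide)
      also have "(2 powr (- real k * \<eta>)) powr p = a ^ k"
        by (simp add: a_def powr_powr mult_ac flip: powr_realpow)
      finally have "?e powr p = \<Lambda> powr (- p) * a ^ k" by (simp add: powr_minus_divide)
      then have e2: "C1 * \<Lambda> powr (- p) * a ^ k = C1 * ?e powr p" by simp
      show ?thesis unfolding Z_def[abs_def] e2
        using R Ra Cp decay[OF e] mod1[of k] e(1)
        by (intro modular_scale[OF G(1)]) (auto intro!: mult_left_mono)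
    qed
    \<comment> \<open>The supremum of the \<open>Z k\<close> is controlled by summing under
      \<open>G\<close>: the sum is integrable, and its image \<open>Y\<close> under the inverse of
      \<open>G\<close> dominates every \<open>Z k\<close>.\<close>
    define S where "S x = (\<Sum>k. ennreal (G (Z k x)))" for x
    have Sint: "(\<integral>\<^sup>+ x\<in>{0<..}. S x \<partial>lborel) \<le> 1"
    proof -
      have "(\<integral>\<^sup>+ x\<in>{0<..}. S x \<partial>lborel) = (\<integral>\<^sup>+ x. (\<Sum>k. ennreal (G (Z k x)) * indicator {0<..} x) \<partial>lborel)"
        unfolding S_def by (intro nn_integral_cong) simp
      also have "\<dots> = (\<Sum>k. modular G (Z k))"
        unfolding modular_def using GZa by (intro nn_integral_suminf) (auto intro!: antitone_borel_measurable_ennreal)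
      also have "\<dots> \<le> (\<Sum>k. ennreal (C1 * \<Lambda> powr (- p) * a ^ k))" using modZ by (intro suminf_le) auto
      also have "\<dots> = ennreal (C1 * \<Lambda> powr (- p) * (1 / (1 - a)))"
        using a Cp \<Lambda> by (intro suminf_ennreal_eq geo) auto
      also have "\<dots> \<le> ennreal 1" using \<Lambda>p a by (intro ennreal_leI) (simp add: field_simps)
      finally show ?thesis by simp
    qed
    have Sa: "S y \<le> S x" if "0 < x" "x \<le> y" for x y
      unfolding S_def using GZa[OF that] by (intro suminf_le ennreal_leI) auto
    \<comment> \<open>An antitone function with finite integral is finite at every positive point,
      not only almost everywhere; the pointwise bounds below need this.\<close>
    have Sfin: "S x < top" if "0 < x" for x
    proof (rule ccontr)
      assume "\<not> S x < top"
      then have "S x = top" by (metis top.not_eq_extremum)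
      then have "top * ennreal x = (\<integral>\<^sup>+ y. S x * indicator {0<..x} y \<partial>lborel)"
        using that by (subst nn_integral_cmult_indicator) auto
      also have "\<dots> \<le> (\<integral>\<^sup>+ x\<in>{0<..}. S x \<partial>lborel)"
        using Sa by (intro nn_integral_mono) (auto simp: indicator_def)
      finally show False using Sint that by (simp add: ennreal_top_mult top_unique split: if_splits)
    qed
    define Y where "Y x = phi_inv G (enn2real (S x))" for x
    have Y: "0 \<le> Y x" "G (Y x) = enn2real (S x)" for x
      using phi_inv_nonneg[OF G(1)] phi_inv_right[OF G(1)] by (auto simp: Y_def)
    have ZY: "Z k x \<le> Y x" if "0 < x" for k x
    proof -
      have "ennreal (G (Z k x)) \<le> S x"
        unfolding S_def using sum_le_suminf[of "\<lambda>k. ennreal (G (Z k x))" "{k}"] by auto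
      then have "ennreal (G (Z k x)) \<le> ennreal (enn2real (S x))" using Sfin[OF that] by (simp add: less_top)
      then have "G (Z k x) \<le> enn2real (S x)" by (subst (asm) ennreal_le_iff) auto
      then show ?thesis unfolding Y_def using Z by (subst le_phi_inv_iff[OF G(1)]) auto
    qed
    have tailb: "tail_integral q f (w x) \<le> ennreal (w x * (L * \<theta> powr q) * Y x powr q)" if x: "0 < x" for x
    proof -
      have lim: "(\<lambda>k. rearr f (2 ^ k * w x / 2)) \<longlonglongrightarrow> 0"
      proof (rule tendsto_sandwich[OF _ _ tendsto_const])
        define d where "d = 2 powr (- (1 / q + \<eta>))"
        have "1 / q + \<eta> > 0" using q' \<eta> by (simp add: add_pos_pos)
        then have d: "0 < d" "d < 1" unfolding d_def by (auto intro!: two_powr_neg_less_one)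
        have de: "2 powr (- real k * (1 / q + \<eta>)) = d ^ k" for k
          by (simp add: d_def powr_powr algebra_simps flip: powr_realpow)
        have "rearr f (2 ^ k * w x / 2) \<le> (c * \<theta> * \<Lambda> * Y x) * d ^ k" for k
          unfolding RZ de using mult_left_mono[OF ZY[OF x, of k], of "c * \<theta> * \<Lambda> * d ^ k"] c \<theta> \<Lambda> d by (simp add: mult_ac)
        then show "\<forall>\<^sub>F k in sequentially. rearr f (2 ^ k * w x / 2) \<le> (c * \<theta> * \<Lambda> * Y x) * d ^ k" by simp
        show "(\<lambda>k. (c * \<theta> * \<Lambda> * Y x) * d ^ k) \<longlonglongrightarrow> 0"
          using d by (intro tendsto_mult_right_zero LIMSEQ_realpow_zero) auto
      qed (simp add: rearr_nonneg)
      have "tail_integral q f (w x) \<le> (\<Sum>k. ennreal (2 ^ k * w x * rearr f (2 ^ k * w x / 2) powr q))"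
        by (rule tail_integral_upper[OF f fin wpos[OF x] q' lim])
      also have "\<dots> \<le> (\<Sum>k. ennreal ((w x * (c * \<theta> * \<Lambda>) powr q * Y x powr q) * b ^ k))"
      proof (intro suminf_le ennreal_leI)
        fix k
        have e: "(2 powr (- real k * (1 / q + \<eta>))) powr q = b ^ k / 2 ^ k"
        proof -
          have "(2 powr (- real k * (1 / q + \<eta>))) powr q = 2 powr (- real k + (- \<eta> * q) * real k)"
          proof -
            have "- real k * (1 / q + \<eta>) * q = - real k + (- \<eta> * q) * real k" using q' by (simp add: field_simps)
            then show ?thesis by (simp only: powr_powr)
          qed
          also have "\<dots> = 2 powr (- real k) * b ^ k"
            by (subst powr_add) (simp add: b_def powr_powr flip: powr_realpow)
          also have "\<dots> = b ^ k / 2 ^ k" by (simp add: powr_minus_divide powr_realpow)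
          finally show ?thesis .
        qed
        have "rearr f (2 ^ k * w x / 2) powr q = (c * \<theta> * \<Lambda>) powr q * (b ^ k / 2 ^ k) * Z k x powr q"
          unfolding RZ powr_mult e by simp
        also have "\<dots> \<le> (c * \<theta> * \<Lambda>) powr q * (b ^ k / 2 ^ k) * Y x powr q"
          using ZY[OF x] Z q' b by (intro mult_left_mono powr_mono2) auto
        finally have "2 ^ k * w x * rearr f (2 ^ k * w x / 2) powr q \<le> 2 ^ k * w x * ((c * \<theta> * \<Lambda>) powr q * (b ^ k / 2 ^ k) * Y x powr q)"
          using wpos[OF x] by (intro mult_left_mono) auto
        then show "2 ^ k * w x * rearr f (2 ^ k * w x / 2) powr q \<le> (w x * (c * \<theta> * \<Lambda>) powr q * Y x powr q) * b ^ k"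
          by (simp add: mult_ac)
      qed auto
      also have "\<dots> = ennreal ((w x * (c * \<theta> * \<Lambda>) powr q * Y x powr q) * (1 / (1 - b)))"
        using b wpos[OF x] by (intro suminf_ennreal_eq geo) auto
      also have "(w x * (c * \<theta> * \<Lambda>) powr q * Y x powr q) * (1 / (1 - b)) = w x * (L * \<theta> powr q) * Y x powr q"
        using c \<theta> \<Lambda> by (simp add: L_def powr_mult mult_ac)
      finally show ?thesis .
    qed
    have fin_tail: "tail_integral q f (w x) < \<infinity>" if "0 < x" for x
      using le_less_trans[OF tailb[OF that]] by simp
    have "modular (power_comp G q) (\<lambda>x. enn2real (tail_integral q f (w x)) / w x / (L * \<theta> powr q)) \<le> (\<integral>\<^sup>+ x\<in>{0<..}. S x \<partial>lborel)"
      unfolding modular_def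
    proof (intro nn_integral_mono)
      fix x :: real
      have "ennreal (power_comp G q (enn2real (tail_integral q f (w x)) / w x / (L * \<theta> powr q))) \<le> S x" if x: "0 < x"
      proof -
        have "enn2real (tail_integral q f (w x)) \<le> w x * (L * \<theta> powr q) * Y x powr q"
          using enn2real_mono[OF tailb[OF x]] wpos[OF x] L \<theta> by simp
        then have "enn2real (tail_integral q f (w x)) / w x / (L * \<theta> powr q) \<le> Y x powr q"
          using wpos[OF x] L \<theta> by (simp add: field_simps)
        then have "power_comp G q (enn2real (tail_integral q f (w x)) / w x / (L * \<theta> powr q)) \<le> power_comp G q (Y x powr q)"
          using wpos[OF x] L \<theta> by (intro phi_function_mono[OF phi_function_power_comp[OF G(1) q']]) auto
        also have "\<dots> = enn2real (S x)" using Y q' by (simp add: power_comp_powr)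
        finally have "ennreal (power_comp G q (enn2real (tail_integral q f (w x)) / w x / (L * \<theta> powr q))) \<le> ennreal (enn2real (S x))"
          by (rule ennreal_leI)
        then show ?thesis using Sfin[OF x] by (simp add: less_top)
      qed
      then show "ennreal (power_comp G q (enn2real (tail_integral q f (w x)) / w x / (L * \<theta> powr q))) * indicator {0<..} x \<le> S x * indicator {0<..} x"
        by (auto simp: indicator_def)
    qed
    also have "\<dots> \<le> 1" by (rule Sint)
    finally show "(\<forall>x>0. tail_integral q f (wt F G x) < \<infinity>) \<and>
      modular (power_comp G q) (\<lambda>x. enn2real (tail_integral q f (wt F G x)) / wt F G x / (L * \<theta> powr q)) \<le> 1"
      using fin_tail by (simp add: w_def)
  qed
qed

section \<open>Dilation bounds from the Boyd indices, and concavity of the space\<close>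

text \<open>Both directions of the theorem draw on the lower index through this single
  dilation.\<close>

lemma boyd_lower_dil_half:
  assumes "boyd_lower N > 0"
  obtains K where "0 < K" "dil_norm N (1 / 2) \<le> ennreal K"
proof -
  obtain p c where "\<forall>a. 0 < a \<and> a < 1 \<longrightarrow> dil_norm N a \<le> ennreal (c * a powr (-1 / p))"
    using assms unfolding boyd_lower_def less_Sup_iff by auto
  then have "dil_norm N (1/2) \<le> ennreal (c * (1/2) powr (-1 / p))" by simp
  also have "\<dots> \<le> ennreal (max 1 (c * (1/2) powr (-1 / p)))" by (intro ennreal_leI) auto
  finally show ?thesis by (intro that[of "max 1 (c * (1/2) powr (-1 / p))"]) auto
qed

text \<open>The dilation factors \<open>2 ^ k / 2\<close> come from the levels
  \<open>2 ^ k * s / 2\<close> in the tail estimate, so they start at 1/2. The case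
  \<open>k = 0\<close> needs the lower index, \<open>k = 1\<close> is the identity, and only from
  \<open>k = 2\<close> on does the upper index apply.\<close>

lemma boyd_upper_dyadic_dil:
  assumes F: "phi_function F" and G: "phi_function G"
    and low: "boyd_lower (OL_norm F G) > 0" and upp: "boyd_upper (OL_norm F G) < ereal q"
  obtains q0 c where "0 < q0" "q0 < q" "0 < c" "\<And>f k. in_space (OL_norm F G) f \<Longrightarrow>
       OL_norm F G (dil (2 ^ k / 2) f) \<le> ennreal (c * 2 powr (- real k / q0)) * OL_norm F G f"
proof -
  obtain q0 cq where q0: "0 < q0" "q0 < q" and cq': "\<forall>a>1. dil_norm (OL_norm F G) a \<le> ennreal (cq * a powr (-1 / q0))"
    using upp unfolding boyd_upper_def Inf_less_iff by auto
  note cq = cq'[rule_format]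
  obtain K where K: "0 < K" "dil_norm (OL_norm F G) (1/2) \<le> ennreal K"
    using boyd_lower_dil_half[OF low] by blast
  \<comment> \<open>\<open>K\<close> serves \<open>k = 0\<close>; the factor
    \<open>2 powr (1 / q0)\<close> makes up for the exponent \<open>k - 1\<close> being read as
    \<open>k\<close>.\<close>
  define c where "c = max (max 1 K) (max 1 cq * 2 powr (1 / q0))"
  have c: "1 \<le> c" "K \<le> c" "cq * 2 powr (1 / q0) \<le> c"
    unfolding c_def by (auto intro: max.coboundedI1 max.coboundedI2 mult_right_mono)
  have c2: "2 powr (1 / q0) \<le> c"
    unfolding c_def using mult_right_mono[of 1 "max 1 cq" "2 powr (1/q0)"] by (auto intro!: max.coboundedI2)
  show ?thesis
  proof (rule that[of q0 c])
    fix f and k :: nat assume f: "in_space (OL_norm F G) f"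
    consider "k = 0" | "k = 1" | "2 \<le> k" by linarith
    then show "OL_norm F G (dil (2 ^ k / 2) f) \<le> ennreal (c * 2 powr (- real k / q0)) * OL_norm F G f"
    proof cases
      case 1
      have "OL_norm F G (dil (1/2) f) \<le> ennreal K * OL_norm F G f"
        by (rule OL_norm_dil_le[OF F G f _ K(2)]) simp
      also have "\<dots> \<le> ennreal c * OL_norm F G f" using c by (intro mult_right_mono ennreal_leI) auto
      finally show ?thesis using 1 by simp
    next
      case 2
      have "1 \<le> c * 2 powr (- 1 / q0)" using c2 by (simp add: powr_minus_divide field_simps)
      then have "ennreal 1 * OL_norm F G f \<le> ennreal (c * 2 powr (- 1 / q0)) * OL_norm F G f"
        by (intro mult_right_mono ennreal_leI) auto
      then show ?thesis using 2 by (simp add: dil_def)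
    next
      case 3
      have p2: "(2::real) ^ k / 2 = 2 powr (real k - 1)" by (simp add: powr_diff powr_realpow)
      have gt: "1 < (2::real) ^ k / 2" unfolding p2 using 3 powr_less_mono[of 0 "real k - 1" 2] by simp
      have "OL_norm F G (dil (2 ^ k / 2) f) \<le> ennreal (cq * (2 ^ k / 2) powr (-1 / q0)) * OL_norm F G f"
        using gt by (intro OL_norm_dil_le[OF F G f] cq) auto
      also have "cq * (2 ^ k / 2) powr (-1 / q0) = (cq * 2 powr (1 / q0)) * 2 powr (- real k / q0)"
      proof -
        have "(2 ^ k / 2) powr (-1 / q0) = 2 powr ((real k - 1) * (-1 / q0))" unfolding p2 by (simp add: powr_powr)
        also have "(real k - 1) * (-1 / q0) = 1 / q0 + (- real k / q0)" by algebra
        finally show ?thesis unfolding powr_add by simp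
      qed
      also have "ennreal \<dots> * OL_norm F G f \<le> ennreal (c * 2 powr (- real k / q0)) * OL_norm F G f"
        using c by (intro mult_right_mono ennreal_leI) auto
      finally show ?thesis .
    qed
  qed (use q0 c in auto)
qed

lemma q_concave_of_condition_J:
  assumes F: "phi_function F" and G: "phi_function G" "dilatory G" and q: "0 < q"
    and low: "boyd_lower (OL_norm F G) > 0" and upp: "boyd_upper (OL_norm F G) < ereal q"
    and H: "phi_function H" "condition_J H" "phi_succ (\<lambda>t. phi_inv G t powr q) (phi_inv H)"
  shows "q_concave (OL_norm F G) q"
proof -
  let ?N = "OL_norm F G"
  define G1 where "G1 = power_comp G q"
  have G1: "phi_function G1" "dilatory G1"
    unfolding G1_def by (rule phi_function_power_comp[OF G(1) q], rule dilatory_power_comp[OF G q])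
  obtain e C where e: "\<And>x y. 0 < x \<Longrightarrow> x \<le> y \<Longrightarrow> e y \<le> e x" "\<And>x. 0 < x \<Longrightarrow> 0 < e x"
    "\<And>x. 0 < x \<Longrightarrow> e x \<le> phi_inv G1 (1 / x)" "modular G1 e \<le> 1"
    "\<And>x s t. 0 < x \<Longrightarrow> e x \<le> s \<Longrightarrow> s \<le> t \<Longrightarrow> t \<le> phi_inv G1 (1 / x) \<Longrightarrow> G1 t / t \<le> C * (G1 s / s)"
    "1 \<le> C"
  proof (rule condition_J_concavity[OF G(1) H(1) q H(3,2), folded G1_def], goal_cases)
    case (1 e C)
    show ?case by (rule 1(1)[OF 1(2-)])
  qed
  have "\<exists>D>0. \<forall>(n::nat) (u::nat \<Rightarrow> real \<Rightarrow> real).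
      (\<forall>i<n. \<forall>x>0. 0 \<le> u i x \<and> (\<forall>y\<ge>x. u i y \<le> u i x)) \<longrightarrow> modular G1 (\<lambda>x. \<Sum>i<n. u i x) \<le> 1 \<longrightarrow>
      (\<exists>c. (\<forall>i<n. 0 \<le> c i) \<and> (\<Sum>i<n. c i) \<le> D \<and>
         (\<forall>i<n. \<forall>d>0. c i \<le> d \<longrightarrow> modular G1 (\<lambda>x. u i x / (D * d)) \<le> 1))"
    by (rule antitone_concavity[OF G1, of e C]) (fact e)+
  then obtain D where D: "0 < D" and core: "\<forall>(n::nat) (u::nat \<Rightarrow> real \<Rightarrow> real).
      (\<forall>i<n. \<forall>x>0. 0 \<le> u i x \<and> (\<forall>y\<ge>x. u i y \<le> u i x)) \<longrightarrow> modular G1 (\<lambda>x. \<Sum>i<n. u i x) \<le> 1 \<longrightarrow>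
      (\<exists>c. (\<forall>i<n. 0 \<le> c i) \<and> (\<Sum>i<n. c i) \<le> D \<and>
         (\<forall>i<n. \<forall>d>0. c i \<le> d \<longrightarrow> modular G1 (\<lambda>x. u i x / (D * d)) \<le> 1))"
    by (elim exE conjE) (rule that)
  obtain q0 c where q0: "0 < q0" "q0 < q" and c: "0 < c" and dil: "\<And>f k. in_space ?N f \<Longrightarrow>
       ?N (dil (2 ^ k / 2) f) \<le> ennreal (c * 2 powr (- real k / q0)) * ?N f"
  proof (rule boyd_upper_dyadic_dil[OF F G(1) low upp], goal_cases)
    case (1 q0 c)
    show ?case by (rule 1(1)[OF 1(2-)])
  qed
  obtain L where L: "0 < L" and tail: "\<And>f \<theta>. f \<in> borel_measurable borel \<Longrightarrow> 0 < \<theta> \<Longrightarrow> ?N f < ennreal \<theta> \<Longrightarrow>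
     (\<forall>x>0. tail_integral q f (wt F G x) < \<infinity>) \<and>
     modular G1 (\<lambda>x. enn2real (tail_integral q f (wt F G x)) / wt F G x / (L * \<theta> powr q)) \<le> 1"
  proof (rule modular_tail_integral[OF F G q0 c dil, folded G1_def], goal_cases)
    case (2 L)
    show ?case by (rule 2(1)[OF 2(2-)])
  qed
  \<comment> \<open>\<open>2 powr q * 2\<close> is lost in bounding the rearrangement by the tail
    integral, \<open>L\<close> in bounding the tail averages by the functional, and \<open>D\<close>
    in the antitone inequality.\<close>
  define B where "B = 2 powr q * 2 * L * D"
  have B: "0 < B" using L D by (simp add: B_def)
  define C' where "C' = (B * (D + 1)) powr (1 / q)"
  have C': "0 < C'" using B D by (simp add: C'_def)
  show ?thesis
    unfolding q_concave_def
  proof (intro exI[of _ C'] conjI allI impI C')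
    fix n :: nat and f :: "nat \<Rightarrow> real \<Rightarrow> real"
    assume insp: "\<forall>i<n. in_space ?N (f i)"
    have fm: "f i \<in> borel_measurable borel" if "i < n" for i using insp that by (simp add: in_space_def)
    have ffin: "fin_rearr (f i)" if "i < n" for i
    proof -
      have "?N (f i) < \<infinity>" using insp that by (simp add: in_space_def)
      then have "?N (f i) < ennreal (enn2real (?N (f i)) + 1)"
        by (cases "?N (f i)") (auto simp: ennreal_less_iff)
      then show ?thesis by (rule OL_norm_lessD(1)[OF F G(1)])
    qed
    define g where "g = (\<lambda>x. (\<Sum>i<n. \<bar>f i x\<bar> powr q) powr (1 / q))"
    have gm: "g \<in> borel_measurable borel" unfolding g_def using fm by measurable
    define w where "w = wt F G"
    have wpos: "0 < w x" if "0 < x" for x using wt_pos[OF F G(1) that] by (simp add: w_def)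
    have wmono: "w x \<le> w y" if "0 < x" "x \<le> y" for x y using wt_mono[OF F G(1)] that by (simp add: w_def)
    show "ennreal (1 / C' * (\<Sum>i<n. enn2real (?N (f i)) powr q) powr (1 / q)) \<le> ?N (\<lambda>x. (\<Sum>i<n. \<bar>f i x\<bar> powr q) powr (1 / q))"
      unfolding g_def[symmetric]
    proof (rule ennreal_le_by_real_bounds, rule ennreal_leI)
      fix \<theta> :: real assume \<theta>: "0 < \<theta>" "?N g < ennreal \<theta>"
      have tg: "tail_integral q g (w x) < \<infinity>" if "0 < x" for x using tail[OF gm \<theta>] that by (simp add: w_def)
      have sup: "(\<Sum>i<n. tail_integral q (f i) s) \<le> tail_integral q g s" for s
        unfolding g_def using tail_integral_superadditive[OF q, of n f s] fm by blast
      have tf: "tail_integral q (f i) (w x) < top" if "0 < x" "i < n" for x i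
      proof -
        have "tail_integral q (f i) (w x) \<le> (\<Sum>i<n. tail_integral q (f i) (w x))" using that by (intro member_le_sum) auto
        also have "\<dots> \<le> tail_integral q g (w x)" by (rule sup)
        finally show ?thesis using tg[OF that(1)] by (simp add: le_less_trans)
      qed
      \<comment> \<open>The averaged tail integrals are antitone in \<open>x\<close>, superadditive
        in the \<open>q\<close>-th powers, and normalised so that their sum has modular at most 1:
        this is the input for \<open>core\<close>.\<close>
      define u where "u i x = enn2real (tail_integral q (f i) (w x)) / w x / (L * \<theta> powr q)" for i x
      have un: "0 \<le> u i x" if "0 < x" for i x using wpos[OF that] L by (simp add: u_def)
      have ua: "u i y \<le> u i x" if "i < n" "0 < x" "x \<le> y" for i x y
      proof -
        have "enn2real (tail_integral q (f i) (w y)) \<le> enn2real (tail_integral q (f i) (w x))"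
          using tf that by (intro enn2real_mono tail_integral_antimono wmono) auto
        then show ?thesis unfolding u_def using wmono[OF that(2,3)] wpos[OF that(2)] L
          by (intro divide_right_mono frac_le) auto
      qed
      have "modular G1 (\<lambda>x. \<Sum>i<n. u i x) \<le> modular G1 (\<lambda>x. enn2real (tail_integral q g (w x)) / w x / (L * \<theta> powr q))"
      proof (intro modular_mono[OF G1(1)] conjI)
        fix x :: real assume x: "0 < x"
        show "0 \<le> (\<Sum>i<n. u i x)" by (intro sum_nonneg un x)
        have "(\<Sum>i<n. enn2real (tail_integral q (f i) (w x))) = enn2real (\<Sum>i<n. tail_integral q (f i) (w x))"
          using tf[OF x] by (subst enn2real_sum) auto
        also have "\<dots> \<le> enn2real (tail_integral q g (w x))" using sup tg[OF x] by (intro enn2real_mono) auto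
        finally have "(\<Sum>i<n. enn2real (tail_integral q (f i) (w x))) / w x / (L * \<theta> powr q) \<le> enn2real (tail_integral q g (w x)) / w x / (L * \<theta> powr q)"
          using wpos[OF x] L by (intro divide_right_mono) auto
        then show "(\<Sum>i<n. u i x) \<le> enn2real (tail_integral q g (w x)) / w x / (L * \<theta> powr q)"
          by (simp add: u_def sum_divide_distrib)
      qed
      also have "\<dots> \<le> 1" using tail[OF gm \<theta>] by (simp add: w_def)
      finally have "modular G1 (\<lambda>x. \<Sum>i<n. u i x) \<le> 1" .
      moreover have "\<forall>i<n. \<forall>x>0. 0 \<le> u i x \<and> (\<forall>y\<ge>x. u i y \<le> u i x)" using ua un by auto
      ultimately obtain d where d: "\<And>i. i < n \<Longrightarrow> 0 \<le> d i" "(\<Sum>i<n. d i) \<le> D"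
        "\<And>i \<delta>. i < n \<Longrightarrow> 0 < \<delta> \<Longrightarrow> d i \<le> \<delta> \<Longrightarrow> modular G1 (\<lambda>x. u i x / (D * \<delta>)) \<le> 1"
        using core[rule_format, of n u] by blast
      have Nf: "enn2real (?N (f i)) powr q \<le> B * \<theta> powr q * (d i + 1 / n)" if i: "i < n" for i
      proof -
        \<comment> \<open>\<open>d i\<close> may vanish, while \<open>core\<close> speaks of
          positive constants only; the summands \<open>1 / n\<close> repair this and add at most 1
          in total.\<close>
        define \<delta> where "\<delta> = d i + 1 / n"
        have \<delta>: "0 < \<delta>" "d i \<le> \<delta>" using d(1)[OF i] i by (auto simp: \<delta>_def add_nonneg_pos)
        define t where "t = (B * \<theta> powr q * \<delta>) powr (1 / q)"
        have t: "0 < t" "t powr q = B * \<theta> powr q * \<delta>" using B \<theta> \<delta> q by (auto simp: t_def powr_powr)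
        have "modular G (\<lambda>x. rearr (f i) (w x) / t) \<le> modular G1 (\<lambda>x. u i x / (D * \<delta>))"
          unfolding modular_def
        proof (intro nn_integral_mono)
          fix x :: real
          have "G (rearr (f i) (w x) / t) \<le> G1 (u i x / (D * \<delta>))" if x: "0 < x"
          proof -
            define r where "r = rearr (f i) (w x)"
            have r: "0 \<le> r" by (simp add: r_def rearr_nonneg)
            have "w x / 2 * (r / 2) powr q \<le> enn2real (tail_integral q (f i) (w x))"
              using enn2real_mono[OF tail_integral_lower[OF fm[OF i] ffin[OF i] wpos[OF x] q] tf[OF x i]] wpos[OF x]
              by (simp add: r_def)
            also have "\<dots> = u i x * w x * (L * \<theta> powr q)" using wpos[OF x] L \<theta> by (simp add: u_def)
            finally have "w x * (r / 2) powr q \<le> w x * (2 * u i x * (L * \<theta> powr q))" by (simp add: mult_ac)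
            then have "(r / 2) powr q \<le> 2 * u i x * (L * \<theta> powr q)" using wpos[OF x] by simp
            then have "r powr q \<le> 2 powr q * (2 * u i x * (L * \<theta> powr q))" by (simp add: powr_divide field_simps)
            then have "r powr q / (B * \<theta> powr q * \<delta>) \<le> 2 powr q * (2 * u i x * (L * \<theta> powr q)) / (B * \<theta> powr q * \<delta>)"
              using B \<theta> \<delta> by (intro divide_right_mono) auto
            then have "(r / t) powr q \<le> 2 powr q * (2 * u i x * (L * \<theta> powr q)) / (B * \<theta> powr q * \<delta>)"
              by (simp only: powr_divide t(2))
            also have "\<dots> = u i x / (D * \<delta>)" using L D \<theta> \<delta> by (simp add: B_def)
            finally have "(r / t) powr q \<le> u i x / (D * \<delta>)" .
            then have "G1 ((r / t) powr q) \<le> G1 (u i x / (D * \<delta>))" by (intro phi_function_mono[OF G1(1)]) auto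
            then show ?thesis using q r t by (simp add: G1_def power_comp_powr r_def)
          qed
          then show "ennreal (G (rearr (f i) (w x) / t)) * indicator {0<..} x \<le> ennreal (G1 (u i x / (D * \<delta>))) * indicator {0<..} x"
            by (auto simp: indicator_def intro: ennreal_leI)
        qed
        also have "\<dots> \<le> 1" by (rule d(3)[OF i \<delta>])
        finally have "?N (f i) \<le> ennreal t" unfolding w_def by (rule OL_norm_leI[OF F G(1) t(1) ffin[OF i]])
        then have "enn2real (?N (f i)) \<le> t" using t by (simp add: enn2real_leI)
        then have "enn2real (?N (f i)) powr q \<le> t powr q" using q by (intro powr_mono2) auto
        then show ?thesis using t by (simp add: \<delta>_def)
      qed
      have "(\<Sum>i<n. enn2real (?N (f i)) powr q) \<le> (\<Sum>i<n. B * \<theta> powr q * (d i + 1 / n))"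
        using Nf by (intro sum_mono) auto
      also have "\<dots> = B * \<theta> powr q * ((\<Sum>i<n. d i) + (\<Sum>i<n. 1 / real n))"
        by (simp only: sum_distrib_left[symmetric] sum.distrib)
      also have "\<dots> \<le> B * \<theta> powr q * (D + 1)"
        using d(2) B by (intro mult_left_mono add_mono) auto
      also have "\<dots> = (C' * \<theta>) powr q"
        using B D \<theta> q by (simp add: C'_def powr_mult powr_powr)
      finally have "(\<Sum>i<n. enn2real (?N (f i)) powr q) powr (1/q) \<le> ((C' * \<theta>) powr q) powr (1/q)"
        using q by (intro powr_mono2 sum_nonneg) auto
      also have "\<dots> = C' * \<theta>" using q C' \<theta> by (simp add: powr_powr)
      finally show "1 / C' * (\<Sum>i<n. enn2real (?N (f i)) powr q) powr (1 / q) \<le> \<theta>"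
        using C' by (simp add: field_simps)
    qed
  qed
qed

section \<open>The upper Boyd index of a concave space\<close>

text \<open>Every \<open>n\<close> consecutive unit intervals carry, in the one with number \<open>i\<close>, the next unit
  interval of \<open>g\<close>; so the \<open>n\<close> copies are disjoint and equimeasurable with \<open>g\<close>.\<close>

definition interleaved_copy :: "nat \<Rightarrow> nat \<Rightarrow> (real \<Rightarrow> real) \<Rightarrow> real \<Rightarrow> real" where
  "interleaved_copy n i g y =
    (if 0 \<le> y \<and> real i \<le> y - real n * of_int \<lfloor>y / real n\<rfloor> \<and> y - real n * of_int \<lfloor>y / real n\<rfloor> < real i + 1
     then g (y - (real n - 1) * of_int \<lfloor>y / real n\<rfloor> - real i) else 0)"

lemma interleaved_copy_measurable:
  assumes [measurable]: "g \<in> borel_measurable borel"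
  shows "interleaved_copy n i g \<in> borel_measurable borel"
  unfolding interleaved_copy_def[abs_def] by measurable

lemma emeasure_translate:
  fixes A :: "real set"
  assumes "A \<in> sets borel"
  shows "emeasure lborel {y. y + c \<in> A} = emeasure lborel A"
proof -
  have m: "{y. y + c \<in> A} \<in> sets borel" using assms by measurable
  have "emeasure lborel A = (\<integral>\<^sup>+x. indicator A x \<partial>lborel)" using assms by simp
  also have "\<dots> = ennreal \<bar>1\<bar> * (\<integral>\<^sup>+x. indicator A (c + 1 * x) \<partial>lborel)"
    using assms by (intro nn_integral_real_affine) auto
  also have "(\<lambda>x. indicator A (c + 1 * x)) = (indicator {y. y + c \<in> A} :: real \<Rightarrow> ennreal)"
    by (auto simp: fun_eq_iff indicator_def add.commute)
  finally show ?thesis using m by simp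
qed

text \<open>Both level sets split into countably many disjoint pieces, one per unit interval, and
  corresponding pieces are translates of each other.\<close>

lemma distr_fn_interleaved_copy:
  assumes g[measurable]: "g \<in> borel_measurable borel" and i: "i < n" and t: "0 < t"
  shows "distr_fn (interleaved_copy n i g) t = distr_fn g t"
proof -
  define B where "B m = {z\<in>{real m..<real m + 1}. t \<le> \<bar>g z\<bar>}" for m :: nat
  define A where "A m = {y. y + (real m - (real n * real m + real i)) \<in> B m}" for m :: nat
  have Bm: "B m \<in> sets borel" for m unfolding B_def by measurable
  have Am: "A m \<in> sets borel" for m unfolding A_def using Bm by measurable
  have fl: "\<lfloor>y / real n\<rfloor> = int m" if "real n * real m + real i \<le> y" "y < real n * real m + real i + 1" for y m
  proof -
    have "real n * real m \<le> y" "y < real n * (real m + 1)" using that i by (auto simp: algebra_simps)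
    then have "real m \<le> y / real n" "y / real n < real m + 1" using i by (auto simp: field_simps)
    then show ?thesis by (intro floor_unique) auto
  qed
  have "(\<Union>m. B m) = {y\<in>{0..}. t \<le> \<bar>g y\<bar>}"
  proof safe
    fix y :: real assume "0 \<le> y" "t \<le> \<bar>g y\<bar>"
    then have "y \<in> B (nat \<lfloor>y\<rfloor>)" by (auto simp: B_def)
    then show "y \<in> (\<Union>m. B m)" by blast
  qed (auto simp: B_def)
  moreover have "(\<Union>m. A m) = {y\<in>{0..}. t \<le> \<bar>interleaved_copy n i g y\<bar>}"
  proof safe
    fix y assume y: "0 \<le> y" "t \<le> \<bar>interleaved_copy n i g y\<bar>"
    define m where "m = nat \<lfloor>y / real n\<rfloor>"
    have m: "\<lfloor>y / real n\<rfloor> = int m" using y by (simp add: m_def)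
    have "real i \<le> y - real n * real m" "y - real n * real m < real i + 1" "t \<le> \<bar>g (y - (real n - 1) * real m - real i)\<bar>"
      using y t unfolding interleaved_copy_def m by (auto split: if_splits)
    then have "y \<in> A m" by (auto simp: A_def B_def algebra_simps)
    then show "y \<in> (\<Union>m. A m)" by blast
  next
    fix y m assume "y \<in> A m"
    then have y: "real n * real m + real i \<le> y" "y < real n * real m + real i + 1" "t \<le> \<bar>g (y - (real n - 1) * real m - real i)\<bar>"
      by (auto simp: A_def B_def algebra_simps)
    show "0 \<le> y" using y(1) by (auto intro: order_trans[rotated])
    then show "t \<le> \<bar>interleaved_copy n i g y\<bar>"
      unfolding interleaved_copy_def fl[OF y(1,2)] using y by auto
  qed
  moreover have "emeasure lborel (\<Union>m. A m) = (\<Sum>m. emeasure lborel (A m))"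
  proof (rule suminf_emeasure[symmetric])
    show "disjoint_family A"
    proof (unfold disjoint_family_on_def, intro ballI impI)
      fix m m' :: nat assume "m \<noteq> m'"
      moreover have "m = m'" if "y \<in> A m" "y \<in> A m'" for y
      proof -
        have "\<lfloor>y / real n\<rfloor> = int m" "\<lfloor>y / real n\<rfloor> = int m'" using that by (auto simp: A_def B_def intro!: fl)
        then show ?thesis by simp
      qed
      ultimately show "A m \<inter> A m' = {}" by blast
    qed
  qed (use Am in auto)
  moreover have "emeasure lborel (\<Union>m. B m) = (\<Sum>m. emeasure lborel (B m))"
  proof (rule suminf_emeasure[symmetric])
    show "disjoint_family B"
    proof (unfold disjoint_family_on_def, intro ballI impI)
      fix m m' :: nat assume "m \<noteq> m'"
      moreover have "m = m'" if "y \<in> B m" "y \<in> B m'" for y using that by (auto simp: B_def)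
      ultimately show "B m \<inter> B m' = {}" by blast
    qed
  qed (use Bm in auto)
  moreover have "emeasure lborel (A m) = emeasure lborel (B m)" for m
    unfolding A_def by (rule emeasure_translate[OF Bm])
  ultimately show ?thesis by simp
qed

text \<open>The \<open>n\<close> disjoint copies of \<open>g = dil n f\<close> combine to a function
  whose distribution is at most \<open>n\<close> times that of \<open>g\<close>, which is the
  distribution of \<open>f\<close>. Concavity bounds \<open>n powr (1 / q)\<close> times the
  functional of \<open>g\<close> by that of the combination.\<close>

lemma q_concave_dil_nat:
  assumes F: "phi_function F" and G: "phi_function G" and q: "0 < q" and C: "0 < C"
    and conc: "\<forall>(n::nat) (f::nat \<Rightarrow> real \<Rightarrow> real). (\<forall>i<n. in_space (OL_norm F G) (f i)) \<longrightarrow>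
      OL_norm F G (\<lambda>x. (\<Sum>i<n. \<bar>f i x\<bar> powr q) powr (1 / q))
        \<ge> ennreal ((1 / C) * (\<Sum>i<n. enn2real (OL_norm F G (f i)) powr q) powr (1 / q))"
    and f: "in_space (OL_norm F G) f" and n: "1 \<le> (n::nat)"
  shows "OL_norm F G (dil (real n) f) \<le> ennreal (C * real n powr (- 1 / q)) * OL_norm F G f"
proof -
  let ?N = "OL_norm F G"
  have fm: "f \<in> borel_measurable borel" and Nf: "?N f < top" using f by (auto simp: in_space_def)
  define g where "g = dil (real n) f"
  have gm: "g \<in> borel_measurable borel" unfolding g_def dil_def using fm by measurable
  define h where "h i = interleaved_copy n i g" for i
  have hm: "h i \<in> borel_measurable borel" for i unfolding h_def by (rule interleaved_copy_measurable[OF gm])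
  have hd: "distr_fn (h i) t = distr_fn g t" if "i < n" "0 < t" for i t
    unfolding h_def by (rule distr_fn_interleaved_copy[OF gm that])
  have "fstar (h i) x = fstar g x" if "i < n" for i x
    using hd[OF that] by (intro antisym fstar_mono) auto
  then have Nh: "?N (h i) = ?N g" if "i < n" for i
    using that by (intro antisym OL_norm_leI_compare[OF F G]) auto
  have "?N g \<le> ?N f"
  proof (rule OL_norm_leI_compare[OF F G])
    fix x :: real assume "0 < x"
    then show "fstar g x \<le> fstar f x"
      unfolding g_def using n fm mult_right_mono[of 1 "real n" x] by (subst fstar_dil) (auto intro!: fstar_antimono)
  qed
  then have Ng: "?N g < top" using Nf by simp
  define s where "s = (\<lambda>x. (\<Sum>i<n. \<bar>h i x\<bar> powr q) powr (1 / q))"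
  have "?N s \<le> ?N f"
  proof (rule OL_norm_leI_compare[OF F G], rule fstar_mono)
    fix x t :: real assume t: "0 < t" and x: "ennreal x \<le> distr_fn s t"
    have sub: "{y\<in>{0..}. t \<le> \<bar>s y\<bar>} \<subseteq> (\<Union>i<n. {y\<in>{0..}. t \<le> \<bar>h i y\<bar>})"
    proof
      fix y assume y: "y \<in> {y\<in>{0..}. t \<le> \<bar>s y\<bar>}"
      have "\<exists>i<n. h i y \<noteq> 0"
      proof (rule ccontr)
        assume "\<not> ?thesis"
        then have "(\<Sum>i<n. \<bar>h i y\<bar> powr q) = 0" by (intro sum.neutral) auto
        then show False using y t by (simp add: s_def)
      qed
      then obtain i where i: "i < n" "h i y \<noteq> 0" by blast
      have "h j y = 0" if "j \<noteq> i" for j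
      proof -
        define r where "r = y - real n * of_int \<lfloor>y / real n\<rfloor>"
        have "real i \<le> r" "r < real i + 1" using i(2) by (auto simp: h_def interleaved_copy_def r_def split: if_splits)
        then have "\<not> (real j \<le> r \<and> r < real j + 1)" using that by linarith
        then show ?thesis by (auto simp: h_def interleaved_copy_def r_def)
      qed
      then have "(\<Sum>j<n. \<bar>h j y\<bar> powr q) = (\<Sum>j\<in>{i}. \<bar>h j y\<bar> powr q)"
        using i(1) by (intro sum.mono_neutral_right) auto
      then have "s y = \<bar>h i y\<bar>" using q by (simp add: s_def powr_powr)
      then show "y \<in> (\<Union>i<n. {y\<in>{0..}. t \<le> \<bar>h i y\<bar>})" using y i(1) by auto
    qed
    have "distr_fn s t \<le> emeasure lborel (\<Union>i<n. {y\<in>{0..}. t \<le> \<bar>h i y\<bar>})"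
      using hm by (intro emeasure_mono sub) measurable
    also have "\<dots> \<le> (\<Sum>i<n. distr_fn (h i) t)"
      using hm by (intro emeasure_subadditive_finite) (auto, measurable)
    also have "\<dots> = of_nat n * distr_fn g t" using hd t by simp
    also have "\<dots> = distr_fn f t" unfolding g_def using distr_fn_dil[OF fm, of "real n" t] n by (simp add: ennreal_of_nat_eq_real_of_nat)
    finally show "ennreal x \<le> distr_fn f t" using x by simp
  qed
  moreover have "\<forall>i<n. in_space ?N (h i)" using hm Nh Ng by (auto simp: in_space_def)
  then have "ennreal ((1 / C) * (\<Sum>i<n. enn2real (?N (h i)) powr q) powr (1 / q)) \<le> ?N s"
    using conc unfolding s_def by blast
  ultimately have "ennreal ((1 / C) * (\<Sum>i<n. enn2real (?N (h i)) powr q) powr (1 / q)) \<le> ?N f" by simp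
  also have "(\<Sum>i<n. enn2real (?N (h i)) powr q) = real n * enn2real (?N g) powr q" using Nh by simp
  also have "(real n * enn2real (?N g) powr q) powr (1 / q) = real n powr (1 / q) * enn2real (?N g)"
    using q by (simp add: powr_mult powr_powr)
  finally have "ennreal (1 / C * (real n powr (1 / q) * enn2real (?N g))) \<le> ennreal (enn2real (?N f))" using Nf by (simp add: less_top)
  then have "1 / C * (real n powr (1 / q) * enn2real (?N g)) \<le> enn2real (?N f)" by (subst (asm) ennreal_le_iff) auto
  then have "enn2real (?N g) \<le> C * real n powr (- 1 / q) * enn2real (?N f)"
    using C n by (simp add: powr_minus_divide field_simps)
  then have "ennreal (enn2real (?N g)) \<le> ennreal (C * real n powr (- 1 / q) * enn2real (?N f))" by (rule ennreal_leI)
  also have "\<dots> = ennreal (C * real n powr (- 1 / q)) * ennreal (enn2real (?N f))" using C by (intro ennreal_mult) auto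
  finally show ?thesis using Nf Ng by (simp add: less_top g_def)
qed

text \<open>A real factor \<open>a\<close> is replaced by its integer part, which is at least
  \<open>a / 2\<close>; this costs the factor \<open>2 powr (1 / q)\<close>.\<close>

lemma boyd_upper_le_of_q_concave:
  assumes F: "phi_function F" and G: "phi_function G" and q: "0 < q" and conc: "q_concave (OL_norm F G) q"
  shows "boyd_upper (OL_norm F G) \<le> ereal q"
proof -
  let ?N = "OL_norm F G"
  obtain C where C: "0 < C" and c: "\<forall>(n::nat) (f::nat \<Rightarrow> real \<Rightarrow> real). (\<forall>i<n. in_space ?N (f i)) \<longrightarrow>
      ?N (\<lambda>x. (\<Sum>i<n. \<bar>f i x\<bar> powr q) powr (1 / q))
        \<ge> ennreal ((1 / C) * (\<Sum>i<n. enn2real (?N (f i)) powr q) powr (1 / q))"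
    using conc unfolding q_concave_def by (elim exE conjE) (rule that)
  have "dil_norm ?N a \<le> ennreal (C * 2 powr (1 / q) * a powr (- 1 / q))" if a: "1 < a" for a
    unfolding dil_norm_def
  proof (rule Sup_least)
    fix z assume "z \<in> {?N (dil a f) / ?N f |f. in_space ?N f \<and> 0 < ?N f}"
    then obtain f where z: "z = ?N (dil a f) / ?N f" and f: "in_space ?N f" "0 < ?N f" by auto
    have fm: "f \<in> borel_measurable borel" and Nf: "?N f < top" using f by (auto simp: in_space_def)
    define n where "n = nat \<lfloor>a\<rfloor>"
    have n: "1 \<le> n" "real n \<le> a" and "a \<le> real n + 1" using a unfolding n_def by linarith+
    then have n3: "a \<le> 2 * real n" by linarith
    have "?N (dil a f) \<le> ?N (dil (real n) f)"
    proof (rule OL_norm_leI_compare[OF F G])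
      fix x :: real assume x: "0 < x"
      then show "fstar (dil a f) x \<le> fstar (dil (real n) f) x"
        using n a fm mult_right_mono[OF n(2), of x] by (simp add: fstar_dil fstar_antimono)
    qed
    also have "\<dots> \<le> ennreal (C * real n powr (- 1 / q)) * ?N f"
      by (rule q_concave_dil_nat[OF F G q C c f(1) n(1)])
    also have "\<dots> \<le> ennreal (C * 2 powr (1 / q) * a powr (- 1 / q)) * ?N f"
    proof (intro mult_right_mono ennreal_leI)
      have "a powr (1/q) \<le> (2 * real n) powr (1/q)" using n3 a q by (intro powr_mono2) auto
      then have "real n powr (- 1 / q) \<le> 2 powr (1/q) * a powr (- 1 / q)"
        using a n by (simp add: powr_minus_divide powr_mult field_simps)
      then show "C * real n powr (- 1 / q) \<le> C * 2 powr (1 / q) * a powr (- 1 / q)" using C by simp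
    qed auto
    finally have "z \<le> ennreal (C * 2 powr (1 / q) * a powr (- 1 / q)) * ?N f / ?N f" unfolding z by (rule divide_right_mono_ennreal)
    also have "\<dots> = ennreal (C * 2 powr (1 / q) * a powr (- 1 / q))"
      using f(2) Nf by (intro mult_divide_eq_ennreal) (auto simp: less_top)
    finally show "z \<le> ennreal (C * 2 powr (1 / q) * a powr (- 1 / q))" .
  qed
  then show ?thesis unfolding boyd_upper_def using q by (intro Inf_lower) (auto intro!: exI[of _ "C * 2 powr (1 / q)"])
qed

text \<open>The rearrangement is at least \<open>\<sigma>\<close> at
  \<open>1 / F t = wt F G (1 / G t)\<close>, and the Chebyshev bound at \<open>1 / G t\<close> caps
  it by \<open>t\<close> times any admissible constant.\<close>

lemma OL_norm_ge_level:
  assumes F: "phi_function F" and G: "phi_function G" and t: "0 < t" and s: "0 \<le> \<sigma>"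
    and d: "ennreal (1 / F t) \<le> distr_fn f \<sigma>"
  shows "ennreal (\<sigma> / t) \<le> OL_norm F G f"
proof (rule ennreal_le_by_real_bounds, rule ennreal_leI)
  fix \<theta> :: real assume \<theta>: "0 < \<theta>" "OL_norm F G f < ennreal \<theta>"
  note m = OL_norm_lessD[OF F G \<theta>(2)]
  have Gt: "0 < G t" using phi_function_pos[OF G t] .
  have w: "wt F G (1 / G t) = 1 / F t" using wt_eq[OF F G, of "1 / G t"] Gt phi_inv_left[OF G, of t] t by simp
  have "rearr f (wt F G (1 / G t)) / \<theta> \<le> phi_inv G (1 / (1 / G t))"
  proof (rule antitone_le_of_modular[OF G _ _ m(2)])
    fix x y :: real assume "0 < x" "x \<le> y"
    then show "rearr f (wt F G y) / \<theta> \<le> rearr f (wt F G x) / \<theta>"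
      using \<theta> wt_pos[OF F G] wt_mono[OF F G] by (intro divide_right_mono rearr_antimono[OF m(1)]) auto
  qed (use \<theta> Gt rearr_nonneg in auto)
  then have "rearr f (1 / F t) \<le> t * \<theta>" using w phi_inv_left[OF G, of t] t \<theta> by (simp add: field_simps)
  moreover have "\<sigma> \<le> rearr f (1 / F t)"
    using le_fstar[OF d] ereal_rearr[OF m(1), of "1 / F t"] phi_function_pos[OF F t] by (simp flip: ereal_less_eq(3))
  ultimately show "\<sigma> / t \<le> \<theta>" using t by (simp add: field_simps)
qed

section \<open>Step functions on geometrically shrinking intervals\<close>

text \<open>Test dilation by 1/2 on the indicator of \<open>{0..1 / F r}\<close> with
  \<open>F r = 2 * F t\<close>. Its functional is at most \<open>1 / r\<close>, while stretching
  doubles the interval to length \<open>1 / F t\<close> and raises the functional to at least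
  \<open>1 / t\<close>. Boundedness then forces \<open>r \<le> K * t\<close>.\<close>

lemma boyd_lower_doubling:
  assumes F: "phi_function F" and G: "phi_function G" and low: "boyd_lower (OL_norm F G) > 0"
  obtains K where "1 \<le> K" "\<And>t. 0 \<le> t \<Longrightarrow> 2 * F t \<le> F (K * t)"
proof -
  let ?N = "OL_norm F G"
  obtain K where K: "0 < K" "dil_norm ?N (1/2) \<le> ennreal K" using boyd_lower_dil_half[OF low] by blast
  have main: "2 * F t \<le> F (K * t)" if t: "0 < t" for t
  proof -
    have Ft: "0 < F t" using phi_function_pos[OF F t] .
    define r where "r = phi_inv F (2 * F t)"
    have r: "0 < r" "F r = 2 * F t" using phi_inv_pos[OF F] phi_inv_right[OF F] Ft by (auto simp: r_def)
    define s where "s = 1 / F r"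
    have s: "0 < s" "2 * s = 1 / F t" using r Ft by (auto simp: s_def)
    define f where "f = (indicator {0..s} :: real \<Rightarrow> real)"
    have fm: "f \<in> borel_measurable borel" unfolding f_def by measurable
    have fst: "fstar f x \<le> ereal (if x \<le> s then 1 else 0)" if x: "0 < x" for x
    proof (rule fstar_le)
      fix t :: real assume t: "(if x \<le> s then 1 else 0) < t"
      have "{y \<in> {0..}. t \<le> \<bar>f y\<bar>} \<subseteq> (if x \<le> s then {} else {0..s})"
        using t by (auto simp: f_def indicator_def split: if_splits)
      then have "distr_fn f t \<le> emeasure lborel (if x \<le> s then {} else {0..s})"
        by (intro emeasure_mono) auto
      also have "\<dots> < ennreal x" using x s by (auto intro: ennreal_lessI)
      finally show "distr_fn f t < ennreal x" .
    qed
    then have fin: "fin_rearr f" unfolding fin_rearr_def using le_less_trans[OF fst] by fastforce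
    have rf: "rearr f x \<le> (if x \<le> s then 1 else 0)" if "0 < x" for x
      using fst[OF that] ereal_rearr[OF fin that] by (metis ereal_less_eq(3))
    have Nf: "?N f \<le> ennreal (1 / r)"
    proof (rule OL_norm_leI[OF F G _ fin])
      have "modular G (\<lambda>x. rearr f (wt F G x) / (1 / r)) \<le> (\<integral>\<^sup>+ x. ennreal (G r) * indicator {0<..1 / G r} x \<partial>lborel)"
        unfolding modular_def
      proof (intro nn_integral_mono)
        fix x :: real
        show "ennreal (G (rearr f (wt F G x) / (1 / r))) * indicator {0<..} x \<le> ennreal (G r) * indicator {0<..1 / G r} x"
        proof (cases "0 < x")
          case True
          note rw = rf[OF wt_pos[OF F G True]] rearr_nonneg[of f "wt F G x"]
          show ?thesis
          proof (cases "x \<le> 1 / G r")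
            case le: True
            have "rearr f (wt F G x) / (1 / r) \<le> r" using rw r by (auto simp: mult_left_le_one_le split: if_splits)
            then have "G (rearr f (wt F G x) / (1 / r)) \<le> G r" using rw r by (intro phi_function_mono[OF G]) auto
            then show ?thesis using True le by (auto intro: ennreal_leI)
          next
            case False
            then have "\<not> wt F G x \<le> s" using wt_le_iff[OF F G True r(1)] by (simp add: s_def)
            then have "rearr f (wt F G x) = 0" using rw by simp
            then show ?thesis using phi_function_zero[OF G] by simp
          qed
        qed auto
      qed
      also have "\<dots> = ennreal (G r) * ennreal (1 / G r)"
        using phi_function_pos[OF G r(1)] by (subst nn_integral_cmult_indicator) auto
      also have "\<dots> = 1" using phi_function_pos[OF G r(1)] by (simp flip: ennreal_mult)
      finally show "modular G (\<lambda>x. rearr f (wt F G x) / (1 / r)) \<le> 1" .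
    qed (use r in auto)
    then have insp: "in_space ?N f" using fm by (auto simp: in_space_def intro: le_less_trans)
    have set: "{y \<in> {0..}. 1 \<le> \<bar>dil (1/2) f y\<bar>} = {0..2 * s}" by (auto simp: dil_def f_def indicator_def)
    have "ennreal (1 / t) \<le> ?N (dil (1/2) f)"
    proof (rule OL_norm_ge_level[OF F G t])
      show "ennreal (1 / F t) \<le> distr_fn (dil (1/2) f) 1" unfolding set using s Ft by auto
    qed simp
    also have "\<dots> \<le> ennreal K * ?N f" by (rule OL_norm_dil_le[OF F G insp _ K(2)]) simp
    also have "\<dots> \<le> ennreal K * ennreal (1 / r)" using Nf by (intro mult_left_mono) auto
    also have "\<dots> = ennreal (K / r)" using K r by (simp flip: ennreal_mult)
    finally have "1 / t \<le> K / r" using K r by (subst (asm) ennreal_le_iff) auto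
    then have "r \<le> K * t" using t r by (simp add: field_simps)
    then have "F r \<le> F (K * t)" using r by (intro phi_function_mono[OF F]) auto
    then show ?thesis using r by simp
  qed
  show ?thesis
  proof (rule that[of "max 1 K"])
    fix t :: real assume t: "0 \<le> t"
    show "2 * F t \<le> F (max 1 K * t)"
    proof (cases "t = 0")
      case True then show ?thesis using phi_function_zero[OF F] by simp
    next
      case False
      then have "2 * F t \<le> F (K * t)" using main t by simp
      also have "\<dots> \<le> F (max 1 K * t)" using t K by (intro phi_function_mono[OF F] mult_right_mono) auto
      finally show ?thesis .
    qed
  qed auto
qed

text \<open>The value \<open>\<sigma> k\<close> is put on an interval inside
  \<open>{0..1 / F (b powr k)}\<close>, which \<open>wt\<close> turns into
  \<open>{0<..1 / G (b powr k)}\<close>. Hence the hypothesis bounds the modular of the whole step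
  function, while each single step, having length \<open>1 / F (b powr (k + 1))\<close>, has
  functional at least \<open>\<sigma> k / b powr (k + 1)\<close>. \<open>F\<close> has vanished from
  the outcome.\<close>

lemma q_concave_test_step:
  assumes F: "phi_function F" and G: "phi_function G" and q: "0 < q" and C: "0 < C"
    and conc: "\<forall>(n::nat) (f::nat \<Rightarrow> real \<Rightarrow> real). (\<forall>i<n. in_space (OL_norm F G) (f i)) \<longrightarrow>
      OL_norm F G (\<lambda>x. (\<Sum>i<n. \<bar>f i x\<bar> powr q) powr (1 / q))
        \<ge> ennreal ((1 / C) * (\<Sum>i<n. enn2real (OL_norm F G (f i)) powr q) powr (1 / q))"
    and b: "1 < b" "\<And>t. 0 \<le> t \<Longrightarrow> 2 * F t \<le> F (b * t)"
    and A: "finite (A :: int set)" and \<sigma>: "\<And>k. k \<in> A \<Longrightarrow> 0 \<le> \<sigma> k"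
    and sum1: "(\<Sum>k\<in>A. G (\<sigma> k) / G (b powr real_of_int k)) \<le> 1"
  shows "(\<Sum>k\<in>A. (\<sigma> k / b powr real_of_int k) powr q) \<le> (C * b) powr q"
proof -
  let ?N = "OL_norm F G"
  \<comment> \<open>Shifting the exponent by 1 leaves room, by the doubling of \<open>F\<close>, for
    the interval from \<open>l k\<close> to \<open>2 * l k\<close> below the one with number
    \<open>k - 1\<close>.\<close>
  define l where "l k = 1 / F (b powr (real_of_int k + 1))" for k :: int
  have bp: "0 < b powr x" for x using b by simp
  note Fp = phi_function_pos[OF F bp] and Gp = phi_function_pos[OF G bp]
  have l: "0 < l k" for k using Fp by (simp add: l_def)
  have lb: "2 * l k \<le> 1 / F (b powr real_of_int k)" for k
  proof -
    have "b powr (real_of_int k + 1) = b * b powr real_of_int k" using b by (simp add: powr_add)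
    then have "2 * F (b powr real_of_int k) \<le> F (b powr (real_of_int k + 1))"
      using b(2)[of "b powr real_of_int k"] by simp
    then show ?thesis using Fp[of "real_of_int k"] Fp[of "real_of_int k + 1"] by (simp add: l_def field_simps)
  qed
  have lmono: "l k \<le> l j" if "j \<le> k" for j k
    using that b Fp[of "real_of_int j + 1"] phi_function_mono[OF F, of "b powr (real_of_int j + 1)" "b powr (real_of_int k + 1)"]
    unfolding l_def by (intro divide_left_mono) (auto intro!: powr_mono simp: Fp)
  have lstep: "2 * l k \<le> l j" if "j < k" for j k
  proof -
    have "2 * l k \<le> 1 / F (b powr real_of_int k)" by (rule lb)
    also have "\<dots> = l (k - 1)" by (simp add: l_def)
    also have "\<dots> \<le> l j" using that by (intro lmono) auto
    finally show ?thesis .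
  qed
  define S where "S k = {l k<..2 * l k}" for k
  have Sdisj: "j = k" if "y \<in> S j" "y \<in> S k" for j k y
    using that lstep[of j k] lstep[of k j] by (cases j k rule: linorder_cases) (auto simp: S_def)
  define f where "f k y = \<sigma> k * indicator (S k) y" for k y
  have fm: "f k \<in> borel_measurable borel" for k unfolding f_def[abs_def] S_def by measurable
  define h where "h y = (\<Sum>k\<in>A. \<bar>f k y\<bar> powr q) powr (1 / q)" for y
  have hm: "h \<in> borel_measurable borel" unfolding h_def[abs_def] using fm by measurable
  have hS: "h y = \<sigma> k" if "k \<in> A" "y \<in> S k" for k y
  proof -
    have "y \<notin> S j" if "j \<noteq> k" for j using Sdisj[OF \<open>y \<in> S k\<close>, of j] that by auto
    then have "(\<Sum>j\<in>A. \<bar>f j y\<bar> powr q) = (\<Sum>j\<in>{k}. \<bar>f j y\<bar> powr q)"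
      using that A by (intro sum.mono_neutral_right) (auto simp: f_def)
    also have "\<dots> = \<sigma> k powr q" using that \<sigma>[OF that(1)] by (simp add: f_def)
    finally show ?thesis using \<sigma>[OF that(1)] q by (simp add: h_def powr_powr)
  qed
  have h0: "h y = 0" if "\<And>k. k \<in> A \<Longrightarrow> y \<notin> S k" for y
  proof -
    have "(\<Sum>j\<in>A. \<bar>f j y\<bar> powr q) = 0" using that by (intro sum.neutral) (auto simp: f_def)
    then show ?thesis by (simp add: h_def)
  qed
  \<comment> \<open>Replacing a maximum of the values by a sum under \<open>G\<close> keeps an upper
    bound for the rearrangement and makes the modular computable.\<close>
  define M where "M x = phi_inv G (\<Sum>k\<in>{k\<in>A. x \<le> 1 / G (b powr real_of_int k)}. G (\<sigma> k))" for x
  have M: "0 \<le> M x" "G (M x) = (\<Sum>k\<in>{k\<in>A. x \<le> 1 / G (b powr real_of_int k)}. G (\<sigma> k))" for x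
    unfolding M_def using phi_function_nonneg[OF G \<sigma>]
    by (auto intro!: phi_inv_nonneg[OF G] phi_inv_right[OF G] sum_nonneg)
  have fsM: "fstar h (wt F G x) \<le> ereal (M x)" if x: "0 < x" for x
  proof (rule fstar_le, rule ccontr)
    fix t assume t: "M x < t" and "\<not> distr_fn h t < ennreal (wt F G x)"
    then have le: "ennreal (wt F G x) \<le> distr_fn h t" by simp
    have t0: "0 < t" using t M(1)[of x] by simp
    define A' where "A' = {k\<in>A. t \<le> \<sigma> k}"
    have sub: "{y\<in>{0..}. t \<le> \<bar>h y\<bar>} \<subseteq> (\<Union>k\<in>A'. S k)"
    proof
      fix y assume y: "y \<in> {y\<in>{0..}. t \<le> \<bar>h y\<bar>}"
      then obtain k where k: "k \<in> A" "y \<in> S k" using h0 t0 by force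
      then show "y \<in> (\<Union>k\<in>A'. S k)" using y hS[OF k] \<sigma>[OF k(1)] by (auto simp: A'_def)
    qed
    have "A' \<noteq> {}"
    proof
      assume "A' = {}"
      then have "{y\<in>{0..}. t \<le> \<bar>h y\<bar>} = {}" using sub by auto
      then have "distr_fn h t = 0" by (simp only: emeasure_empty)
      then show False using le wt_pos[OF F G x] by simp
    qed
    \<comment> \<open>The smallest index has the longest interval, so the entire level set lies in
      \<open>{0..2 * l k}\<close>.\<close>
    define k where "k = Min A'"
    have finA': "finite A'" using A by (simp add: A'_def)
    have k: "k \<in> A'" "\<And>j. j \<in> A' \<Longrightarrow> k \<le> j" using \<open>A' \<noteq> {}\<close> finA' by (auto simp: k_def)
    have "(\<Union>k\<in>A'. S k) \<subseteq> {0..2 * l k}"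
    proof
      fix y assume "y \<in> (\<Union>k\<in>A'. S k)"
      then obtain j where "j \<in> A'" "l j < y" "y \<le> 2 * l j" by (auto simp: S_def)
      then show "y \<in> {0..2 * l k}" using lmono[OF k(2)] l[of j] by fastforce
    qed
    then have "distr_fn h t \<le> emeasure lborel {0..2 * l k}" using sub by (intro emeasure_mono) auto
    also have "\<dots> = ennreal (2 * l k)" using l[of k] by simp
    finally have "ennreal (wt F G x) \<le> ennreal (2 * l k)" using le by simp
    then have "wt F G x \<le> 1 / F (b powr real_of_int k)" using l[of k] lb[of k] by (subst (asm) ennreal_le_iff) auto
    then have "x \<le> 1 / G (b powr real_of_int k)" using wt_le_iff[OF F G x bp] by blast
    then have "G (\<sigma> k) \<le> G (M x)"
      unfolding M(2) using k(1) A phi_function_nonneg[OF G \<sigma>] by (intro member_le_sum) (auto simp: A'_def)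
    moreover have "G (M x) < G t" using t M(1)[of x] t0 by (subst phi_function_less_iff[OF G]) auto
    moreover have "G t \<le> G (\<sigma> k)" using k(1) t0 by (intro phi_function_mono[OF G]) (auto simp: A'_def)
    ultimately show False by simp
  qed
  have fin: "fin_rearr h"
    unfolding fin_rearr_def
  proof (intro allI impI)
    fix s :: real assume s: "0 < s"
    define x where "x = 1 / G (phi_inv F (1 / s))"
    have p: "0 < phi_inv F (1 / s)" using phi_inv_pos[OF F] s by simp
    have x: "0 < x" using phi_function_pos[OF G p] by (simp add: x_def)
    have "wt F G x = s"
      using wt_eq[OF F G x] phi_inv_left[OF G, of "phi_inv F (1/s)"] p phi_inv_right[OF F, of "1/s"] s by (simp add: x_def)
    then show "fstar h s < \<infinity>" using fsM[OF x] by (metis ereal_less_PInfty le_less_trans PInfty_neq_ereal(1) ereal_infty_less(1))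
  qed
  have "modular G (\<lambda>x. rearr h (wt F G x) / 1) \<le> (\<integral>\<^sup>+ x. (\<Sum>k\<in>A. ennreal (G (\<sigma> k)) * indicator {0<..1 / G (b powr real_of_int k)} x) \<partial>lborel)"
    unfolding modular_def
  proof (intro nn_integral_mono)
    fix x :: real
    show "ennreal (G (rearr h (wt F G x) / 1)) * indicator {0<..} x \<le> (\<Sum>k\<in>A. ennreal (G (\<sigma> k)) * indicator {0<..1 / G (b powr real_of_int k)} x)"
    proof (cases "0 < x")
      case True
      have "rearr h (wt F G x) \<le> M x" using fsM[OF True] ereal_rearr[OF fin wt_pos[OF F G True]] by (metis ereal_less_eq(3))
      then have "G (rearr h (wt F G x)) \<le> G (M x)" using rearr_nonneg by (intro phi_function_mono[OF G]) auto
      then have "ennreal (G (rearr h (wt F G x))) \<le> ennreal (\<Sum>k\<in>{k\<in>A. x \<le> 1 / G (b powr real_of_int k)}. G (\<sigma> k))"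
        unfolding M(2) by (rule ennreal_leI)
      also have "\<dots> = (\<Sum>k\<in>{k\<in>A. x \<le> 1 / G (b powr real_of_int k)}. ennreal (G (\<sigma> k)))"
        using phi_function_nonneg[OF G \<sigma>] by (intro sum_ennreal[symmetric]) auto
      also have "\<dots> = (\<Sum>k\<in>A. ennreal (G (\<sigma> k)) * indicator {0<..1 / G (b powr real_of_int k)} x)"
        using A True by (intro sum.mono_neutral_cong_left) (auto simp: indicator_def)
      finally show ?thesis using True by simp
    qed auto
  qed
  also have "\<dots> = (\<Sum>k\<in>A. \<integral>\<^sup>+ x. ennreal (G (\<sigma> k)) * indicator {0<..1 / G (b powr real_of_int k)} x \<partial>lborel)"
    by (intro nn_integral_sum) auto
  also have "\<dots> = (\<Sum>k\<in>A. ennreal (G (\<sigma> k) / G (b powr real_of_int k)))"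
  proof (intro sum.cong refl)
    fix k assume "k \<in> A"
    have "(\<integral>\<^sup>+ x. ennreal (G (\<sigma> k)) * indicator {0<..1 / G (b powr real_of_int k)} x \<partial>lborel) = ennreal (G (\<sigma> k)) * ennreal (1 / G (b powr real_of_int k))"
      using Gp[of "real_of_int k"] by (subst nn_integral_cmult_indicator) auto
    also have "\<dots> = ennreal (G (\<sigma> k) / G (b powr real_of_int k))"
      using Gp[of "real_of_int k"] phi_function_nonneg[OF G \<sigma>[OF \<open>k \<in> A\<close>]] by (simp flip: ennreal_mult)
    finally show "(\<integral>\<^sup>+ x. ennreal (G (\<sigma> k)) * indicator {0<..1 / G (b powr real_of_int k)} x \<partial>lborel) = ennreal (G (\<sigma> k) / G (b powr real_of_int k))" .
  qed
  also have "\<dots> = ennreal (\<Sum>k\<in>A. G (\<sigma> k) / G (b powr real_of_int k))"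
    using Gp phi_function_nonneg[OF G \<sigma>] by (intro sum_ennreal) (auto intro!: divide_nonneg_pos)
  also have "\<dots> \<le> ennreal 1" using sum1 by (rule ennreal_leI)
  finally have "modular G (\<lambda>x. rearr h (wt F G x) / 1) \<le> 1" by simp
  then have Nh: "?N h \<le> ennreal 1" by (intro OL_norm_leI[OF F G _ fin]) auto
  have Nfh: "?N (f k) \<le> ?N h" if "k \<in> A" for k
  proof (rule OL_norm_leI_compare[OF F G], rule fstar_mono_abs[OF hm])
    fix y :: real
    show "\<bar>f k y\<bar> \<le> \<bar>h y\<bar>"
      using hS[OF that, of y] by (cases "y \<in> S k") (auto simp: f_def)
  qed
  have Nf1: "?N (f k) \<le> 1" if "k \<in> A" for k using Nfh[OF that] Nh by simp
  have Nfge: "\<sigma> k / (b * b powr real_of_int k) \<le> enn2real (?N (f k))" if k: "k \<in> A" for k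
  proof -
    have "ennreal (\<sigma> k / (b powr (real_of_int k + 1))) \<le> ?N (f k)"
    proof (rule OL_norm_ge_level[OF F G bp \<sigma>[OF k]])
      have "S k \<subseteq> {y\<in>{0..}. \<sigma> k \<le> \<bar>f k y\<bar>}" using l[of k] \<sigma>[OF k] by (auto simp: S_def f_def)
      moreover have "{y\<in>{0..}. \<sigma> k \<le> \<bar>f k y\<bar>} \<in> sets lborel" using fm[of k] by measurable
      ultimately have "emeasure lborel (S k) \<le> distr_fn (f k) (\<sigma> k)" by (rule emeasure_mono)
      moreover have "emeasure lborel (S k) = ennreal (l k)" using l[of k] by (simp add: S_def)
      ultimately show "ennreal (1 / F (b powr (real_of_int k + 1))) \<le> distr_fn (f k) (\<sigma> k)" by (simp add: l_def)
    qed
    then have "enn2real (ennreal (\<sigma> k / (b powr (real_of_int k + 1)))) \<le> enn2real (?N (f k))"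
      using Nf1[OF k] by (intro enn2real_mono) (auto intro: le_less_trans)
    then show ?thesis using \<sigma>[OF k] b by (simp add: powr_add mult.commute)
  qed
  obtain e where e: "bij_betw e {..<card A} A" using A ex_bij_betw_nat_finite[OF A] by (metis atLeast0LessThan)
  have "\<forall>i<card A. in_space ?N (f (e i))"
  proof (intro allI impI)
    fix i assume "i < card A"
    then have "e i \<in> A" using bij_betwE[OF e] by simp
    then show "in_space ?N (f (e i))" using fm Nf1[of "e i"] by (auto simp: in_space_def intro: le_less_trans)
  qed
  then have "ennreal ((1 / C) * (\<Sum>i<card A. enn2real (?N (f (e i))) powr q) powr (1 / q))
     \<le> ?N (\<lambda>x. (\<Sum>i<card A. \<bar>f (e i) x\<bar> powr q) powr (1 / q))"
    using conc[rule_format, of "card A" "\<lambda>i. f (e i)"] by blast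
  also have "(\<lambda>x. (\<Sum>i<card A. \<bar>f (e i) x\<bar> powr q) powr (1 / q)) = h"
    unfolding h_def by (intro ext arg_cong[where f = "\<lambda>z. z powr (1/q)"] sum.reindex_bij_betw[OF e])
  also have "(\<Sum>i<card A. enn2real (?N (f (e i))) powr q) = (\<Sum>k\<in>A. enn2real (?N (f k)) powr q)"
    by (rule sum.reindex_bij_betw[OF e])
  also note Nh
  finally have "ennreal ((1 / C) * (\<Sum>k\<in>A. enn2real (?N (f k)) powr q) powr (1 / q)) \<le> ennreal 1" .
  then have "(1 / C) * (\<Sum>k\<in>A. enn2real (?N (f k)) powr q) powr (1 / q) \<le> 1" by (subst (asm) ennreal_le_iff) auto
  then have "(\<Sum>k\<in>A. enn2real (?N (f k)) powr q) powr (1 / q) \<le> C" using C by (simp add: field_simps)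
  then have "((\<Sum>k\<in>A. enn2real (?N (f k)) powr q) powr (1 / q)) powr q \<le> C powr q" using q by (intro powr_mono2) auto
  then have "(\<Sum>k\<in>A. enn2real (?N (f k)) powr q) \<le> C powr q" using q by (simp add: powr_powr sum_nonneg)
  moreover have "(\<Sum>k\<in>A. (\<sigma> k / (b * b powr real_of_int k)) powr q) \<le> (\<Sum>k\<in>A. enn2real (?N (f k)) powr q)"
    using Nfge \<sigma> q b by (intro sum_mono powr_mono2) auto
  moreover have "(\<Sum>k\<in>A. (\<sigma> k / b powr real_of_int k) powr q) = b powr q * (\<Sum>k\<in>A. (\<sigma> k / (b * b powr real_of_int k)) powr q)"
    unfolding sum_distrib_left using b by (intro sum.cong refl) (simp add: powr_divide powr_mult)
  ultimately show ?thesis using b by (simp add: powr_mult mult.commute mult_left_mono order_trans)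
qed

section \<open>Almost concavity with summable thresholds\<close>

text \<open>Terms of size at most 1/2, added one at a time, cannot jump across the range from 1/2 to
  1.\<close>

lemma exists_subsum_near_one:
  fixes a :: "'a \<Rightarrow> real"
  assumes "finite A" "\<And>k. k \<in> A \<Longrightarrow> 0 \<le> a k \<and> a k \<le> 1 / 2" "1 < sum a A"
  shows "\<exists>A'\<subseteq>A. 1 / 2 < sum a A' \<and> sum a A' \<le> 1"
  using assms
proof (induction A rule: finite_induct)
  case (insert x A)
  show ?case
  proof (cases "1 < sum a A")
    case True
    then obtain A' where "A' \<subseteq> A" "1 / 2 < sum a A' \<and> sum a A' \<le> 1" using insert by auto
    then show ?thesis by blast
  next
    case False
    have "1 < a x + sum a A" using insert by simp
    moreover have "a x \<le> 1 / 2" using insert by simp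
    ultimately show ?thesis using False by (intro exI[of _ A]) auto
  qed
qed auto

text \<open>The set where \<open>G\<close> lies far below the chord from 0 to \<open>(\<beta>^k, G (\<beta>^k))\<close> has right end point
  \<open>e k\<close>; a large sum would contradict the hypothesis on a subsum of size about one.\<close>

lemma almost_concave_thresholds:
  assumes G: "phi_function G" and \<beta>: "1 < \<beta>" "\<And>t. 0 \<le> t \<Longrightarrow> 2 * G t \<le> G (\<beta> * t)" and C0: "0 \<le> C0"
    and test: "\<And>(A::int set) s. finite A \<Longrightarrow> (\<And>k. k \<in> A \<Longrightarrow> 0 \<le> s k) \<Longrightarrow>
       (\<Sum>k\<in>A. G (s k) / G (\<beta> powr real_of_int k)) \<le> 1 \<Longrightarrow> (\<Sum>k\<in>A. s k / \<beta> powr real_of_int k) \<le> C0"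
  obtains e :: "int \<Rightarrow> real" and C where "1 \<le> C" "\<And>k. 0 \<le> e k" "\<And>k. e k \<le> \<beta> powr (real_of_int k - 1)"
    "\<And>A. finite A \<Longrightarrow> (\<Sum>k\<in>A. G (e k) / G (\<beta> powr real_of_int k)) \<le> 1"
    "\<And>A. finite A \<Longrightarrow> (\<Sum>k\<in>A. e k / \<beta> powr real_of_int k) \<le> C0"
    "\<And>k s. e k < s \<Longrightarrow> s \<le> \<beta> powr (real_of_int k - 1) \<Longrightarrow>
       G (\<beta> powr real_of_int k) / \<beta> powr real_of_int k \<le> C * (G s / s)"
proof -
  define b where "b k = \<beta> powr real_of_int k" for k :: int
  define b' where "b' k = \<beta> powr (real_of_int k - 1)" for k :: int
  have bpos: "0 < b k" "0 < b' k" for k using \<beta> by (auto simp: b_def b'_def)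
  have bb: "b k = \<beta> * b' k" for k using \<beta> by (simp add: b_def b'_def powr_diff)
  have Gb: "0 < G (b k)" for k using phi_function_pos[OF G bpos(1)] .
  \<comment> \<open>\<open>C / 2\<close> must exceed \<open>C0\<close>: a subsum above 1/2,
    multiplied by \<open>C\<close>, then contradicts the test inequality.\<close>
  define C where "C = 2 * C0 + 1"
  \<comment> \<open>Stopping at \<open>b' k\<close>, one grid step below \<open>b k\<close>, keeps
    each ratio \<open>G (e k) / G (b k)\<close> at most 1/2, as the choice of a subsum requires.
    Compactness puts the right end point into the set, so both the chord estimate at
    \<open>e k\<close> and its reverse beyond \<open>e k\<close> are available.\<close>
  define S where "S k = {s \<in> {0..b' k}. C * G s * b k \<le> s * G (b k)}" for k
  have S0: "0 \<in> S k" for k using bpos[of k] phi_function_zero[OF G] by (auto simp: S_def)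
  have Sc: "compact (S k)" for k
  proof -
    have "closed (S k)"
    proof -
      have "continuous_on {0..b' k} (\<lambda>s. s * G (b k) - C * G s * b k)"
        by (intro continuous_intros continuous_on_subset[OF phi_function_cont[OF G]]) auto
      then have "closed ({0..b' k} \<inter> (\<lambda>s. s * G (b k) - C * G s * b k) -` {0..})"
        by (intro continuous_closed_preimage) auto
      also have "{0..b' k} \<inter> (\<lambda>s. s * G (b k) - C * G s * b k) -` {0..} = S k" by (auto simp: S_def)
      finally show ?thesis .
    qed
    moreover have "bounded (S k)" by (rule bounded_subset[of "{0..b' k}"]) (auto simp: S_def)
    ultimately show ?thesis by (simp add: compact_eq_bounded_closed)
  qed
  have "\<exists>s\<in>S k. \<forall>t\<in>S k. t \<le> s" for k using compact_attains_sup[OF Sc] S0 by (metis empty_iff)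
  then obtain e where e: "\<And>k. e k \<in> S k" "\<And>k t. t \<in> S k \<Longrightarrow> t \<le> e k" by metis
  have e0: "0 \<le> e k" "e k \<le> b' k" "C * G (e k) * b k \<le> e k * G (b k)" for k
    using e(1)[of k] by (auto simp: S_def)
  have eC: "C * (G (e k) / G (b k)) \<le> e k / b k" for k
    using e0(3)[of k] Gb[of k] bpos[of k] by (simp add: field_simps)
  have ehalf: "0 \<le> G (e k) / G (b k)" "G (e k) / G (b k) \<le> 1 / 2" for k
  proof -
    have "2 * G (e k) \<le> 2 * G (b' k)" using e0[of k] by (intro mult_left_mono phi_function_mono[OF G]) auto
    also have "\<dots> \<le> G (b k)" using \<beta>(2)[of "b' k"] bpos[of k] bb[of k] by simp
    finally show "G (e k) / G (b k) \<le> 1 / 2" using Gb[of k] by (simp add: field_simps)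
    show "0 \<le> G (e k) / G (b k)" using phi_function_nonneg[OF G e0(1)] Gb[of k] by simp
  qed
  have sum1: "(\<Sum>k\<in>A. G (e k) / G (b k)) \<le> 1" if A: "finite A" for A
  proof (rule ccontr)
    assume "\<not> ?thesis"
    then obtain A' where A': "A' \<subseteq> A" "1 / 2 < (\<Sum>k\<in>A'. G (e k) / G (b k))" "(\<Sum>k\<in>A'. G (e k) / G (b k)) \<le> 1"
      using exists_subsum_near_one[OF A, of "\<lambda>k. G (e k) / G (b k)"] ehalf by auto
    have "C / 2 \<le> C * (\<Sum>k\<in>A'. G (e k) / G (b k))" using A'(2) C0 by (simp add: C_def)
    also have "\<dots> \<le> (\<Sum>k\<in>A'. e k / b k)" unfolding sum_distrib_left by (intro sum_mono eC)
    also have "\<dots> \<le> C0" using test[of A' e] finite_subset[OF A'(1) A] e0 A'(3) by (simp add: b_def)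
    finally show False by (simp add: C_def)
  qed
  show ?thesis
  proof (rule that[of C e, folded b_def b'_def])
    show "1 \<le> C" using C0 by (simp add: C_def)
    show "0 \<le> e k" "e k \<le> b' k" for k using e0 by auto
    show "(\<Sum>k\<in>A. G (e k) / G (b k)) \<le> 1" if "finite A" for A by (rule sum1[OF that])
    show "(\<Sum>k\<in>A. e k / b k) \<le> C0" if "finite A" for A
      using test[of A e] that sum1[OF that] e0 by (simp add: b_def)
    fix k s assume s: "e k < s" "s \<le> b' k"
    then have "s \<notin> S k" using e(2)[of s k] by auto
    moreover have s0: "0 < s" using s e0(1)[of k] by simp
    ultimately have "s * G (b k) < C * G s * b k" using s by (auto simp: S_def)
    then show "G (b k) / b k \<le> C * (G s / s)" using s0 bpos[of k] by (simp add: field_simps)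
  qed
qed

text \<open>Each block is extended as far as it is good, but at most to twice its left end, so that blocks
  exist also when everything is good. Maximality only controls \<open>d (p i) (p (Suc i) + 1)\<close>, and the
  function behind \<open>d\<close> need not be doubling; therefore the sum spans two blocks at a time.\<close>

lemma greedy_blocks:
  fixes good :: "int \<Rightarrow> int \<Rightarrow> bool" and d :: "int \<Rightarrow> int \<Rightarrow> real" and E :: "int \<Rightarrow> real"
  assumes d_anti: "\<And>j k k'. j \<le> k \<Longrightarrow> k \<le> k' \<Longrightarrow> d j k' \<le> d j k"
    and d_half: "\<And>j k. j \<le> k \<Longrightarrow> d j k \<le> (1 / 2) ^ nat (k - j)"
    and bad: "\<And>j k. j \<le> k \<Longrightarrow> \<not> good j k \<Longrightarrow> \<exists>l\<in>{j..k}. d j k \<le> E l"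
    and E: "\<And>l. 0 \<le> E l" "\<And>A. finite A \<Longrightarrow> sum E A \<le> 1"
    and good: "\<And>k. k0 \<le> k \<Longrightarrow> good k (k + g)" and g: "2 \<le> g" "g \<le> k0"
  shows "\<exists>p :: nat \<Rightarrow> int. p 0 = k0 \<and> (\<forall>i. p i + g \<le> p (Suc i) \<and> good (p i) (p (Suc i))) \<and>
    (\<forall>n. (\<Sum>i<n. d (p i) (p (Suc (Suc i)))) \<le> 4)"
proof -
  define S where "S p = {k \<in> {p + g..2 * p}. good p k}" for p
  define nxt where "nxt p = Max (S p)" for p
  define p where "p i = (nxt ^^ i) k0" for i
  \<comment> \<open>\<open>g \<le> k0\<close> makes the minimal step \<open>p + g\<close> respect
    the cap \<open>2 * p\<close>, so there is always a candidate.\<close>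
  have S: "finite (S p)" "p + g \<in> S p" if "k0 \<le> p" for p
  proof -
    show "finite (S p)" unfolding S_def by (rule finite_subset[of _ "{p + g..2 * p}"]) auto
    show "p + g \<in> S p" using that g good[OF that] by (auto simp: S_def)
  qed
  have nxt: "nxt p \<in> S p" "\<And>k. k \<in> S p \<Longrightarrow> k \<le> nxt p" if "k0 \<le> p" for p
    using S[OF that] Max_in[OF S(1)[OF that]] Max_ge[OF S(1)[OF that]] unfolding nxt_def by blast+
  have pS: "p (Suc i) = nxt (p i)" for i by (simp add: p_def)
  have pk: "k0 + int i \<le> p i" for i
  proof (induction i)
    case (Suc i)
    then have "p i + g \<le> p (Suc i)" using nxt(1)[of "p i"] by (auto simp: pS S_def)
    then show ?case using Suc g by simp
  qed (simp add: p_def)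
  then have pk0: "k0 \<le> p i" for i by (metis add_increasing2 le_add_same_cancel1 of_nat_0_le_iff order_trans)
  have step: "p i + g \<le> p (Suc i)" "good (p i) (p (Suc i))" "p (Suc i) \<le> 2 * p i" for i
    using nxt(1)[OF pk0[of i]] by (auto simp: pS S_def)
  \<comment> \<open>If one more step would have been bad, the charged index is at most
    \<open>p (Suc i) + 1\<close>, which lies before \<open>p (Suc (Suc i))\<close> because
    \<open>g \<ge> 2\<close>. If the cap stopped the block, its length alone gives a power of
    1/2.\<close>
  have term_le: "d (p i) (p (Suc (Suc i))) \<le> (1/2) ^ i + (sum E {p i..<p (Suc i)} + sum E {p (Suc i)..<p (Suc (Suc i))})" for i
  proof -
    have E2: "sum E {p i..<p (Suc i)} + sum E {p (Suc i)..<p (Suc (Suc i))} = sum E {p i..<p (Suc (Suc i))}"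
      using step(1)[of i] step(1)[of "Suc i"] g
      by (subst sum.union_disjoint[symmetric]) (auto intro!: sum.cong)
    have le: "d (p i) (p (Suc (Suc i))) \<le> d (p i) (p (Suc i) + 1)"
      using step(1)[of i] step(1)[of "Suc i"] g by (intro d_anti) auto
    show ?thesis
    proof (cases "p (Suc i) + 1 \<le> 2 * p i")
      case True
      then have "\<not> good (p i) (p (Suc i) + 1)"
        using nxt(2)[OF pk0[of i], of "p (Suc i) + 1"] step(1)[of i] by (auto simp: pS S_def)
      then obtain l where l: "l \<in> {p i..p (Suc i) + 1}" "d (p i) (p (Suc i) + 1) \<le> E l"
        using bad[of "p i" "p (Suc i) + 1"] step(1)[of i] g by auto
      have "E l \<le> sum E {p i..<p (Suc (Suc i))}"
        using l(1) step(1)[of "Suc i"] g E(1) by (intro member_le_sum) auto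
      moreover have "0 \<le> (1/2::real) ^ i" by simp
      ultimately show ?thesis using le l(2) unfolding E2 by linarith
    next
      case False
      then have "p (Suc i) = 2 * p i" using step(3)[of i] by simp
      then have "d (p i) (p (Suc i) + 1) \<le> (1/2) ^ nat (p i + 1)"
        using d_half[of "p i" "p (Suc i) + 1"] step(1)[of i] g by simp
      also have "\<dots> \<le> (1/2) ^ i" using pk[of i] g by (intro power_decreasing) auto
      finally show ?thesis using le sum_nonneg[of "{p i..<p (Suc (Suc i))}" E] E(1) unfolding E2 by fastforce
    qed
  qed
  \<comment> \<open>Index ranges of consecutive blocks are disjoint. With \<open>a = 0\<close> and
    \<open>a = 1\<close> this covers the two halves of each window and gives 1 + 1 beside the 2 of
    the geometric series.\<close>
  have tel: "(\<Sum>i<n. sum E {p (a + i)..<p (Suc (a + i))}) \<le> 1" for n a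
  proof -
    have "p a \<le> p (a + n) \<and> (\<Sum>i<n. sum E {p (a + i)..<p (Suc (a + i))}) = sum E {p a..<p (a + n)}"
    proof (induction n)
      case (Suc n)
      have "sum E {p a..<p (a + n)} + sum E {p (a + n)..<p (Suc (a + n))} = sum E {p a..<p (Suc (a + n))}"
        using Suc step(1)[of "a + n"] g
        by (subst sum.union_disjoint[symmetric]) (auto intro!: sum.cong)
      then show ?case using Suc step(1)[of "a + n"] g by simp
    qed simp
    then show ?thesis using E(2) by simp
  qed
  have "(\<Sum>i<n. d (p i) (p (Suc (Suc i)))) \<le> 4" for n
  proof -
    have "(\<Sum>i<n. d (p i) (p (Suc (Suc i)))) \<le> (\<Sum>i<n. (1/2) ^ i + (sum E {p i..<p (Suc i)} + sum E {p (Suc i)..<p (Suc (Suc i))}))"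
      by (intro sum_mono term_le)
    also have "\<dots> = (\<Sum>i<n. (1/2::real) ^ i) + ((\<Sum>i<n. sum E {p (0 + i)..<p (Suc (0 + i))}) + (\<Sum>i<n. sum E {p (1 + i)..<p (Suc (1 + i))}))"
      by (simp add: sum.distrib)
    also have "\<dots> \<le> 2 + (1 + 1)"
    proof (intro add_mono tel)
      have "(\<Sum>i<n. (1/2::real) ^ i) \<le> (\<Sum>i. (1/2) ^ i)" by (intro sum_le_suminf summable_geometric) auto
      also have "\<dots> = 2" by (subst suminf_geometric) auto
      finally show "(\<Sum>i<n. (1/2::real) ^ i) \<le> 2" .
    qed
    finally show ?thesis by simp
  qed
  then show ?thesis using step by (intro exI[of _ p]) (auto simp: p_def)
qed

lemma finite_int_bounded: "finite (A :: int set) \<Longrightarrow> \<exists>N. \<forall>i\<in>A. \<bar>i\<bar> < int N"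
proof -
  assume A: "finite A"
  define N where "N = nat (Max (insert 0 (abs ` A))) + 1"
  have "\<bar>i\<bar> < int N" if "i \<in> A" for i
  proof -
    have "\<bar>i\<bar> \<le> Max (insert 0 (abs ` A))" using that A by (intro Max_ge) auto
    then show ?thesis unfolding N_def by linarith
  qed
  then show ?thesis by blast
qed

text \<open>The greedy choice runs outwards in both directions from a central block around 0, where
  nothing but a crude constant \<open>A0\<close> is claimed. Far out, windows of \<open>g\<close>
  grid steps are good because the thresholds are small relative to the grid there.\<close>

lemma block_sequence:
  assumes G: "phi_function G" and \<beta>: "1 < \<beta>" "\<And>t. 0 \<le> t \<Longrightarrow> 2 * G t \<le> G (\<beta> * t)"
    and C: "1 \<le> C" and e: "\<And>k. 0 \<le> e k" "\<And>k. e k \<le> \<beta> powr (real_of_int k - 1)"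
    and sumG: "\<And>A. finite A \<Longrightarrow> (\<Sum>k\<in>A. G (e k) / G (\<beta> powr real_of_int k)) \<le> 1"
    and sume: "\<And>A. finite A \<Longrightarrow> (\<Sum>k\<in>A. e k / \<beta> powr real_of_int k) \<le> C0"
    and thr: "\<And>k s. e k < s \<Longrightarrow> s \<le> \<beta> powr (real_of_int k - 1) \<Longrightarrow>
       G (\<beta> powr real_of_int k) / \<beta> powr real_of_int k \<le> C * (G s / s)"
  obtains B A0 and P :: "int \<Rightarrow> int" where "2 \<le> B" "1 \<le> A0"
    "\<And>i. 2 * B * G (\<beta> powr real_of_int (P i)) \<le> G (\<beta> powr real_of_int (P (i + 1)))"
    "\<And>i s t. \<beta> powr real_of_int (P i) \<le> s \<Longrightarrow> s \<le> t \<Longrightarrow> t \<le> \<beta> powr real_of_int (P (i + 1)) \<Longrightarrow>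
       G t / t \<le> (if i = 0 then A0 else B) * (G s / s)"
    "\<And>A. finite A \<Longrightarrow> (\<Sum>i\<in>A. G (\<beta> powr real_of_int (P i)) / G (\<beta> powr real_of_int (P (i + 2)))) \<le> 10"
proof -
  define b where "b k = \<beta> powr real_of_int k" for k :: int
  have bpos: "0 < b k" for k using \<beta> by (simp add: b_def)
  have bmono: "b j \<le> b k" if "j \<le> k" for j k using that \<beta> by (simp add: b_def)
  have bsuc: "b (k + 1) = \<beta> * b k" for k using \<beta> by (simp add: b_def powr_add)
  have b1: "\<beta> powr (real_of_int k - 1) = b (k - 1)" for k by (simp add: b_def)
  have Gb: "0 < G (b k)" for k using phi_function_pos[OF G bpos] .
  have Gbmono: "G (b j) \<le> G (b k)" if "j \<le> k" for j k
    using bmono[OF that] bpos[of j] by (intro phi_function_mono[OF G]) auto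
  have Gpow: "2 ^ n * G (b k) \<le> G (b (k + int n))" for n k
  proof (induction n)
    case (Suc n)
    have "2 ^ Suc n * G (b k) \<le> 2 * G (b (k + int n))" using Suc by simp
    also have "\<dots> \<le> G (b (k + int (Suc n)))" using \<beta>(2)[of "b (k + int n)"] bpos[of "k + int n"] bsuc[of "k + int n"]
      by (simp add: add_ac)
    finally show ?case .
  qed simp
  \<comment> \<open>One \<open>\<beta>\<close> is lost in rounding \<open>t\<close> up to the grid,
    the other when \<open>s\<close> lies in the same grid cell as \<open>t\<close> and has to be
    rounded down.\<close>
  define B where "B = max 2 (C * \<beta>\<^sup>2)"
  have B: "2 \<le> B" "C * \<beta>\<^sup>2 \<le> B" by (auto simp: B_def)
  define good where "good j k \<longleftrightarrow> (\<forall>s t. b j \<le> s \<longrightarrow> s \<le> t \<longrightarrow> t \<le> b k \<longrightarrow> G t / t \<le> B * (G s / s))" for j k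
  \<comment> \<open>A failure is charged to the grid cell of \<open>t\<close>, with right end
    \<open>b l\<close>. Were \<open>e l\<close> below \<open>b j\<close>, the threshold property at
    \<open>l\<close> would compare \<open>t\<close> with \<open>s\<close> after all.\<close>
  have bad: "\<exists>l. j < l \<and> l \<le> k \<and> b j \<le> e l" if ng: "\<not> good j k" for j k
  proof -
    obtain s t where st: "b j \<le> s" "s \<le> t" "t \<le> b k" and gt: "B * (G s / s) < G t / t"
      using ng unfolding good_def by (meson not_le)
    have s0: "0 < s" using st(1) bpos[of j] by simp
    have t0: "0 < t" using s0 st by simp
    have rs: "0 < G s / s" using phi_function_pos[OF G s0] s0 by simp
    have "s \<noteq> t" using gt B rs mult_right_mono[of 1 B "G s / s"] by auto
    then have lt: "s < t" using st by simp
    define l where "l = \<lceil>log \<beta> t\<rceil>"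
    have tl: "t \<le> b l"
    proof -
      have "t = \<beta> powr (log \<beta> t)" using \<beta> t0 by simp
      also have "\<dots> \<le> b l" unfolding b_def using \<beta> by (intro powr_mono) (auto simp: l_def)
      finally show ?thesis .
    qed
    have tl': "b (l - 1) < t"
    proof -
      have "b (l - 1) < \<beta> powr (log \<beta> t)" unfolding b_def using \<beta> by (intro powr_less_mono) (auto simp: l_def, linarith)
      then show ?thesis using \<beta> t0 by simp
    qed
    have jl: "j < l" using st(1) lt tl bmono[of l j] by (meson le_less_trans less_le_trans not_le order_less_irrefl)
    have lk: "l \<le> k" using tl' st(3) bmono[of k "l - 1"] by (meson le_less_trans linorder_not_le not_less_iff_gr_or_eq order_less_irrefl zle_diff1_eq order_less_le_trans)
    have bl: "b l = \<beta> * b (l - 1)" using bsuc[of "l - 1"] by simp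
    have rt: "G t / t \<le> \<beta> * (G (b l) / b l)"
    proof -
      have "G t / t \<le> G (b l) / b (l - 1)"
        using tl tl' t0 bpos[of "l-1"] Gb[of l] by (intro frac_le phi_function_mono[OF G]) auto
      also have "\<dots> = \<beta> * (G (b l) / b l)" using bl \<beta> bpos[of "l-1"] by simp
      finally show ?thesis .
    qed
    have "b j \<le> e l"
    proof (rule ccontr)
      assume "\<not> b j \<le> e l"
      then have ej: "e l < b j" by simp
      have "G (b l) / b l \<le> C * \<beta> * (G s / s)"
      proof (cases "s \<le> b (l - 1)")
        case True
        have "G (b l) / b l \<le> C * (G s / s)" using thr[of l s] ej st(1) True by (simp add: b_def)
        also have "\<dots> \<le> C * \<beta> * (G s / s)" using C \<beta> rs by (intro mult_right_mono) auto
        finally show ?thesis .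
      next
        case False
        have "G (b l) / b l \<le> C * (G (b (l - 1)) / b (l - 1))"
          using thr[of l "b (l - 1)"] ej jl bmono[of j "l - 1"] by (simp add: b_def)
        also have "G (b (l - 1)) / b (l - 1) = \<beta> * (G (b (l - 1)) / b l)" using bl \<beta> bpos[of "l-1"] by simp
        also have "\<dots> \<le> \<beta> * (G s / s)"
          using False st tl s0 \<beta> bpos[of "l-1"] phi_function_mono[OF G, of "b (l-1)" s] phi_function_nonneg[OF G, of s]
          by (intro mult_left_mono frac_le) auto
        finally show ?thesis using C by (simp add: mult.assoc)
      qed
      then have "G t / t \<le> \<beta> * (C * \<beta> * (G s / s))" using rt \<beta> by (meson less_imp_le mult_left_mono order_trans zero_less_one)
      also have "\<dots> = C * \<beta>\<^sup>2 * (G s / s)" by (simp add: power2_eq_square)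
      also have "\<dots> \<le> B * (G s / s)" using B rs by (intro mult_right_mono) auto
      finally show False using gt by simp
    qed
    then show ?thesis using jl lk by blast
  qed
  define E where "E l = G (e l) / G (b l)" for l
  define d where "d j k = G (b j) / G (b k)" for j k
  have E0: "0 \<le> E l" for l using phi_function_nonneg[OF G e(1)] Gb[of l] by (simp add: E_def)
  have E1: "sum E A \<le> 1" if "finite A" for A using sumG[OF that] by (simp add: E_def b_def)
  have bad': "\<exists>l\<in>{j..k}. d j k \<le> E l" if ng: "\<not> good j k" for j k
  proof -
    obtain l where l: "j < l" "l \<le> k" "b j \<le> e l" using bad[OF ng] by blast
    have "G (b j) \<le> G (e l)" using l bpos[of j] by (intro phi_function_mono[OF G]) auto
    then have "d j k \<le> E l" unfolding d_def E_def using Gb[of l] Gb[of j] Gbmono[OF l(2)] by (intro frac_le) auto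
    then show ?thesis using l by (intro bexI[of _ l]) auto
  qed
  have d_half: "d j k \<le> (1 / 2) ^ nat (k - j)" if "j \<le> k" for j k
    using Gpow[of "nat (k - j)" j] that Gb[of k] by (simp add: d_def field_simps power_one_over)
  have d0: "0 \<le> d j k" for j k using Gb[of j] Gb[of k] by (simp add: d_def)
  \<comment> \<open>Blocks have at least \<open>gn\<close> grid steps, so the doubling of
    \<open>G\<close> yields the growth factor \<open>2 * B\<close> per block.\<close>
  obtain n1 where n1: "2 * B < 2 ^ n1" using real_arch_pow[of 2 "2 * B"] by auto
  define gn where "gn = max 2 n1"
  define g where "g = int gn"
  have gB: "2 * B \<le> 2 ^ gn" 
  proof -
    have "(2::real) ^ n1 \<le> 2 ^ gn" by (intro power_increasing) (auto simp: gn_def)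
    then show ?thesis using n1 by linarith
  qed
  have g2: "2 \<le> g" by (simp add: g_def gn_def)
  \<comment> \<open>Each index in \<open>T\<close> contributes at least
    \<open>\<beta> powr (- gn)\<close> to a sum bounded by \<open>C0\<close>, so \<open>T\<close> is
    finite. A window that fails to be good would have to meet \<open>T\<close>, hence all windows
    beyond \<open>k0\<close> are good.\<close>
  define T where "T = {l. b (l - g) \<le> e l}"
  have "finite T"
  proof (rule ccontr)
    assume inf: "infinite T"
    define r where "r = \<beta> powr (- real gn)"
    have r: "0 < r" using \<beta> by (simp add: r_def)
    obtain A where A: "A \<subseteq> T" "finite A" "card A = nat \<lceil>C0 / r\<rceil> + 1" using infinite_arbitrarily_large[OF inf] by metis
    have "C0 / r < real (card A)" unfolding A(3) by linarith
    then have "C0 < real (card A) * r" using r by (simp add: field_simps)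
    also have "\<dots> = (\<Sum>k\<in>A. r)" by simp
    also have "\<dots> \<le> (\<Sum>k\<in>A. e k / b k)"
    proof (rule sum_mono)
      fix k assume "k \<in> A"
      then have "b (k - g) \<le> e k" using A by (auto simp: T_def)
      moreover have "b (k - g) = r * b k" using \<beta> by (simp add: b_def r_def g_def powr_diff powr_minus_divide)
      ultimately show "r \<le> e k / b k" using bpos[of k] by (simp add: field_simps)
    qed
    also have "\<dots> \<le> C0" using sume[OF A(2)] by (simp add: b_def)
    finally show False by simp
  qed
  then obtain N where N: "\<And>i. i \<in> T \<Longrightarrow> \<bar>i\<bar> < int N" using finite_int_bounded by blast
  define k0 where "k0 = max (int N) g"
  have k0: "g \<le> k0" "int N \<le> k0" by (auto simp: k0_def)
  have good_far: "good j (j + g)" if "\<And>l. j < l \<Longrightarrow> l \<le> j + g \<Longrightarrow> k0 \<le> \<bar>l\<bar>" for j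
  proof (rule ccontr)
    assume "\<not> good j (j + g)"
    then obtain l where l: "j < l" "l \<le> j + g" "b j \<le> e l" using bad by blast
    then have "l \<in> T" using bmono[of "l - g" j] by (auto simp: T_def)
    then show False using N[of l] that[OF l(1,2)] k0 by simp
  qed
  have "\<exists>p :: nat \<Rightarrow> int. p 0 = k0 \<and> (\<forall>i. p i + g \<le> p (Suc i) \<and> good (p i) (p (Suc i))) \<and>
    (\<forall>n. (\<Sum>i<n. d (p i) (p (Suc (Suc i)))) \<le> 4)"
  proof (rule greedy_blocks[where E = E])
    show "d j k' \<le> d j k" if "j \<le> k" "k \<le> k'" for j k k'
      unfolding d_def using Gbmono[OF that(2)] Gb[of k] Gb[of j] by (intro frac_le) auto
    show "good k (k + g)" if "k0 \<le> k" for k using that g2 k0 by (intro good_far) auto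
  qed (use d_half bad' E0 E1 g2 k0 in auto)
  then obtain p :: "nat \<Rightarrow> int" where p: "p 0 = k0" "\<And>i. p i + g \<le> p (Suc i)" "\<And>i. good (p i) (p (Suc i))"
    "\<And>n. (\<Sum>i<n. d (p i) (p (Suc (Suc i)))) \<le> 4" by blast
  \<comment> \<open>The negative side is the same selection after the reflection of indices, with
    the two arguments of \<open>good\<close> and \<open>d\<close> exchanged.\<close>
  have "\<exists>p :: nat \<Rightarrow> int. p 0 = k0 \<and> (\<forall>i. p i + g \<le> p (Suc i) \<and> good (- p (Suc i)) (- p i)) \<and>
    (\<forall>n. (\<Sum>i<n. d (- p (Suc (Suc i))) (- p i)) \<le> 4)"
  proof (rule greedy_blocks[where E = "\<lambda>l. E (- l)" and good = "\<lambda>j k. good (- k) (- j)" and d = "\<lambda>j k. d (- k) (- j)"])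
    show "d (- k') (- j) \<le> d (- k) (- j)" if "j \<le> k" "k \<le> k'" for j k k'
      unfolding d_def using Gbmono[of "- k'" "- k"] that Gb[of "- j"] Gb[of "- k'"] by (intro frac_le) auto
    show "d (- k) (- j) \<le> (1 / 2) ^ nat (k - j)" if "j \<le> k" for j k using d_half[of "- k" "- j"] that by (simp add: nat_diff_distrib algebra_simps)
    show "good (- (k + g)) (- k)" if "k0 \<le> k" for k
    proof -
      have "good (- (k + g)) (- (k + g) + g)" using that g2 k0 by (intro good_far) auto
      then show ?thesis by simp
    qed
    show "\<exists>l\<in>{j..k}. d (- k) (- j) \<le> E (- l)" if ng: "\<not> good (- k) (- j)" for j k
    proof -
      obtain l where "l \<in> {- k..- j}" "d (- k) (- j) \<le> E l" using bad'[OF ng] by blast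
      then show ?thesis by (intro bexI[of _ "- l"]) auto
    qed
    show "(\<Sum>l\<in>A. E (- l)) \<le> 1" if "finite A" for A
    proof -
      have "(\<Sum>l\<in>A. E (- l)) = sum E (uminus ` A)" by (subst sum.reindex) (auto simp: inj_on_def)
      then show ?thesis using E1[of "uminus ` A"] that by simp
    qed
  qed (use E0 g2 k0 in auto)
  then obtain p' :: "nat \<Rightarrow> int" where p': "p' 0 = k0" "\<And>i. p' i + g \<le> p' (Suc i)" "\<And>i. good (- p' (Suc i)) (- p' i)"
    "\<And>n. (\<Sum>i<n. d (- p' (Suc (Suc i))) (- p' i)) \<le> 4" by blast
  define P where "P i = (if 1 \<le> i then p (nat (i - 1)) else - p' (nat (- i)))" for i
  have Ppos: "P (int n + 1) = p n" for n by (simp add: P_def)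
  have Pneg: "P (- int n) = - p' n" for n by (simp add: P_def)
  have cases_int: "(\<exists>n. i = int n + 1) \<or> i = 0 \<or> (\<exists>n. i = - int (Suc n))" for i :: int
  proof -
    consider "1 \<le> i" | "i = 0" | "i \<le> -1" by linarith
    then show ?thesis
    proof cases
      case 1
      then have "i = int (nat (i - 1)) + 1" by simp
      then show ?thesis by blast
    next
      case 3
      then have "i = - int (Suc (nat (- i - 1)))" by simp
      then show ?thesis by blast
    qed simp
  qed
  have Pgap: "P i + g \<le> P (i + 1)" for i
  proof -
    consider n where "i = int n + 1" | "i = 0" | n where "i = - int (Suc n)" using cases_int[of i] by blast
    then show ?thesis
    proof cases
      case 1
      then show ?thesis using p(2)[of n] Ppos[of n] Ppos[of "Suc n"] by (simp add: add_ac)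
    next
      case 2
      then show ?thesis using Ppos[of 0] Pneg[of 0] p(1) p'(1) k0 g2 by simp
    next
      case 3
      then have "i + 1 = - int n" by simp
      then show ?thesis using 3 p'(2)[of n] Pneg[of n] Pneg[of "Suc n"] by simp
    qed
  qed
  \<comment> \<open>The central block from \<open>- k0\<close> to \<open>k0\<close> may fail to be
    good; the extreme values at its ends give this bound for its ratio.\<close>
  define A0 where "A0 = max 1 (G (b k0) / b (- k0) / (G (b (- k0)) / b k0))"
  show ?thesis
  proof (rule that[of B A0 P, folded b_def])
    show "2 \<le> B" by (rule B)
    show "1 \<le> A0" by (simp add: A0_def)
    fix i
    have "2 * B * G (b (P i)) \<le> 2 ^ gn * G (b (P i))" using gB Gb[of "P i"] by (intro mult_right_mono) auto
    also have "\<dots> \<le> G (b (P i + g))" unfolding g_def by (rule Gpow)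
    also have "\<dots> \<le> G (b (P (i + 1)))" by (intro Gbmono Pgap)
    finally show "2 * B * G (b (P i)) \<le> G (b (P (i + 1)))" .
  next
    fix i s t assume st: "b (P i) \<le> s" "s \<le> t" "t \<le> b (P (i + 1))"
    have s0: "0 < s" using st(1) bpos[of "P i"] by simp
    consider n where "i = int n + 1" | "i = 0" | n where "i = - int (Suc n)" using cases_int[of i] by blast
    then show "G t / t \<le> (if i = 0 then A0 else B) * (G s / s)"
    proof cases
      case 1
      then have "good (P i) (P (i + 1))" using p(3)[of n] Ppos[of n] Ppos[of "Suc n"] by (simp add: add_ac)
      then show ?thesis using st 1 unfolding good_def by auto
    next
      case 2
      have P: "P i = - k0" "P (i + 1) = k0" using 2 Ppos[of 0] Pneg[of 0] p(1) p'(1) by auto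
      have x: "G t / t \<le> G (b k0) / b (- k0)"
        using st s0 P bpos[of "-k0"] Gb[of k0] by (intro frac_le phi_function_mono[OF G]) auto
      have y: "G (b (- k0)) / b k0 \<le> G s / s"
        using st s0 P bpos[of "-k0"] phi_function_nonneg[OF G, of s] by (intro frac_le phi_function_mono[OF G]) auto
      have y0: "0 < G (b (- k0)) / b k0" using Gb bpos by simp
      have "u / v * v = u" if "0 < v" for u v :: real using that by simp
      then have "G t / t \<le> (G (b k0) / b (- k0) / (G (b (- k0)) / b k0)) * (G (b (- k0)) / b k0)"
        using x y0 by presburger
      also have "\<dots> \<le> A0 * (G s / s)"
        using y y0 Gb[of k0] bpos[of "-k0"] by (intro mult_mono) (auto simp: A0_def)
      finally show ?thesis using 2 by simp
    next
      case 3
      then have "i + 1 = - int n" by simp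
      then have "good (P i) (P (i + 1))" using 3 p'(3)[of n] Pneg[of n] Pneg[of "Suc n"] by simp
      then show ?thesis using st 3 unfolding good_def by auto
    qed
  next
    fix A :: "int set" assume A: "finite A"
    define D where "D i = G (b (P i)) / G (b (P (i + 2)))" for i
    have D: "D i = d (P i) (P (i + 2))" for i by (simp add: D_def d_def)
    have D0: "0 \<le> D i" for i using d0 by (simp add: D)
    have D1: "D i \<le> 1" for i
    proof -
      have "P i \<le> P (i + 2)" using Pgap[of i] Pgap[of "i + 1"] g2 by (simp add: add_ac)
      then show ?thesis unfolding D_def using Gbmono Gb by (simp add: divide_le_eq)
    qed
    have sum_Un_le: "sum D (X \<union> Y) \<le> sum D X + sum D Y" if "finite X" "finite Y" for X Y
      using sum.union_inter[OF that, of D] sum_nonneg[of "X \<inter> Y" D] D0 by simp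
    obtain N where N: "\<And>i. i \<in> A \<Longrightarrow> \<bar>i\<bar> < int N" using finite_int_bounded[OF A] by blast
    \<comment> \<open>\<open>P i\<close> and \<open>P (i + 2)\<close> lie on the same side of the
      centre except for \<open>i = -1\<close> and \<open>i = 0\<close>; these two terms are at most
      1 each, so the total is \<open>4 + 4 + 2\<close>.\<close>
    let ?S1 = "(\<lambda>n. int n + 1) ` {..<N}" and ?S2 = "(\<lambda>n. - int n - 2) ` {..<N}"
    have "A \<subseteq> (?S1 \<union> ?S2) \<union> {-1, 0}"
    proof
      fix i assume i: "i \<in> A"
      consider "1 \<le> i" | "i \<le> -2" | "i = -1 \<or> i = 0" by linarith
      then show "i \<in> (?S1 \<union> ?S2) \<union> {-1, 0}"
      proof cases
        case 1
        then have "i = int (nat (i - 1)) + 1" "nat (i - 1) < N" using N[OF i] by auto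
        then show ?thesis by blast
      next
        case 2
        then have "i = - int (nat (- i - 2)) - 2" "nat (- i - 2) < N" using N[OF i] by auto
        then show ?thesis by blast
      qed auto
    qed
    then have "sum D A \<le> sum D ((?S1 \<union> ?S2) \<union> {-1, 0})" using D0 by (intro sum_mono2) auto
    also have "\<dots> \<le> sum D (?S1 \<union> ?S2) + sum D {-1, 0}" using D0 by (intro sum_Un_le) auto
    also have "\<dots> \<le> (sum D ?S1 + sum D ?S2) + sum D {-1, 0}" using D0 by (intro add_right_mono sum_Un_le) auto
    also have "\<dots> \<le> (4 + 4) + 2"
    proof (intro add_mono)
      have "sum D ?S1 = (\<Sum>n<N. D (int n + 1))" by (subst sum.reindex) (auto simp: inj_on_def)
      also have "\<dots> = (\<Sum>n<N. d (p n) (p (Suc (Suc n))))"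
      proof (intro sum.cong refl)
        fix n
        have "int n + 1 + 2 = int (Suc (Suc n)) + 1" by simp
        then show "D (int n + 1) = d (p n) (p (Suc (Suc n)))" unfolding D using Ppos[of n] Ppos[of "Suc (Suc n)"] by presburger
      qed
      also have "\<dots> \<le> 4" by (rule p(4))
      finally show "sum D ?S1 \<le> 4" .
      have "sum D ?S2 = (\<Sum>n<N. D (- int n - 2))" by (subst sum.reindex) (auto simp: inj_on_def)
      also have "\<dots> = (\<Sum>n<N. d (- p' (Suc (Suc n))) (- p' n))"
      proof (intro sum.cong refl)
        fix n
        have "- int n - 2 = - int (Suc (Suc n))" "- int n - 2 + 2 = - int n" by simp_all
        then show "D (- int n - 2) = d (- p' (Suc (Suc n))) (- p' n)" unfolding D using Pneg[of n] Pneg[of "Suc (Suc n)"] by presburger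
      qed
      also have "\<dots> \<le> 4" by (rule p'(4))
      finally show "sum D ?S2 \<le> 4" .
      show "sum D {-1, 0} \<le> 2" using D1[of "-1"] D1[of 0] by simp
    qed
    finally show "(\<Sum>i\<in>A. G (b (P i)) / G (b (P (i + 2)))) \<le> 10" by (simp add: D_def)
  qed
qed

section \<open>Construction of the N-function\<close>

text \<open>Monotonicity of \<open>f\<close> and of \<open>f x / x\<close> in opposite directions
  squeezes \<open>f y\<close> between \<open>f x * min 1 (y / x)\<close> and
  \<open>f x * max 1 (y / x)\<close>, which gives continuity; small and large values then give
  surjectivity.\<close>

lemma phi_functionI_quasiconcave:
  fixes f :: "real \<Rightarrow> real"
  assumes f0: "f 0 = 0" and pos: "\<And>x. 0 < x \<Longrightarrow> 0 < f x"
    and mono: "\<And>x y. 0 < x \<Longrightarrow> x < y \<Longrightarrow> f x < f y"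
    and ratio: "\<And>x y. 0 < x \<Longrightarrow> x < y \<Longrightarrow> f y / y \<le> f x / x"
    and small: "\<And>u. 0 < u \<Longrightarrow> \<exists>x>0. f x < u" and large: "\<And>u. \<exists>x>0. u < f x"
  shows "phi_function f"
proof (rule phi_functionI_surj)
  show "strict_mono_on {0..} f"
  proof (rule strict_mono_onI)
    fix r s :: real assume "r \<in> {0..}" "s \<in> {0..}" "r < s"
    then show "f r < f s" using mono[of r s] pos[of s] f0 by (cases "r = 0") auto
  qed
  have cont: "isCont f x" if x: "0 < x" for x
    unfolding isCont_def
  proof (rule tendsto_sandwich)
    have lim1: "((\<lambda>y. f x * min 1 (y / x)) \<longlongrightarrow> f x * min 1 (x / x)) (at x)"
      using x by (intro tendsto_intros) auto
    have lim2: "((\<lambda>y. f x * max 1 (y / x)) \<longlongrightarrow> f x * max 1 (x / x)) (at x)"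
      using x by (intro tendsto_intros) auto
    show "((\<lambda>y. f x * min 1 (y / x)) \<longlongrightarrow> f x) (at x)" "((\<lambda>y. f x * max 1 (y / x)) \<longlongrightarrow> f x) (at x)"
      using lim1 lim2 x by simp_all
    have ev: "\<forall>\<^sub>F y in at x. 0 < y" using x eventually_at_in_open'[of "{0<..}" x] by simp
    have b: "f x * min 1 (y / x) \<le> f y \<and> f y \<le> f x * max 1 (y / x)" if y: "0 < y" for y
    proof (cases x y rule: linorder_cases)
      case less
      then have "f y \<le> f x * (y / x)" using ratio[OF x less] x y by (simp add: field_simps)
      moreover have "1 \<le> y / x" using less x by simp
      ultimately show ?thesis using mono[OF x less] by (simp add: min_absorb1 max_absorb2)
    next
      case equal
      then show ?thesis using x by simp
    next
      case greater
      then have "f x * (y / x) \<le> f y" using ratio[OF y greater] x y by (simp add: field_simps)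
      moreover have "y / x \<le> 1" using greater x by simp
      ultimately show ?thesis using mono[OF y greater] by (simp add: min_absorb2 max_absorb1)
    qed
    show "\<forall>\<^sub>F y in at x. f x * min 1 (y / x) \<le> f y" "\<forall>\<^sub>F y in at x. f y \<le> f x * max 1 (y / x)"
      using ev by (auto elim!: eventually_mono simp: b)
  qed
  show "f ` {0..} = {0..}"
  proof
    show "f ` {0..} \<subseteq> {0..}" using pos f0 by (force simp: less_le)
    show "{0..} \<subseteq> f ` {0..}"
    proof
      fix u :: real assume "u \<in> {0..}"
      show "u \<in> f ` {0..}"
      proof (cases "u = 0")
        case True then show ?thesis using f0 by (metis atLeast_iff imageI order_refl)
      next
        case False
        then have u: "0 < u" using \<open>u \<in> _\<close> by simp
        obtain x where x: "0 < x" "f x < u" using small[OF u] by blast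
        obtain z where z: "0 < z" "u < f z" using large by blast
        have "x < z"
        proof (rule ccontr)
          assume "\<not> x < z"
          then have "f z \<le> f x" using mono[OF z(1), of x] by (cases "x = z") auto
          then show False using x z by simp
        qed
        then have "\<exists>t\<ge>x. t \<le> z \<and> f t = u"
          using x z cont by (intro IVT) auto
        then show ?thesis using x by force
      qed
    qed
  qed
qed

text \<open>The inverse of \<open>H\<close> is \<open>\<kappa>(x) = inf\<^sub>j (x + y\<^sub>j) / B\<^sup>j\<close>. On \<open>[y\<^sub>i, y\<^sub>i\<^sub>+\<^sub>1]\<close> only the indices \<open>i\<close> and
  \<open>i + 1\<close> compete, so the infimum is attained and \<open>m(x) = x / \<kappa>(x)\<close> is about \<open>B\<^sup>i\<close>.\<close>

lemma N_function_of_blocks: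
  fixes y :: "int \<Rightarrow> real" and B :: real
  assumes B: "2 \<le> B" and y: "\<And>i. 0 < y i" "\<And>i. 2 * B * y i \<le> y (i + 1)"
    and sumy: "\<And>A. finite A \<Longrightarrow> (\<Sum>i\<in>A. y i / y (i + 2)) \<le> S"
  obtains H m where "phi_function H" "N_function H" "condition_J H"
    "\<And>x. 0 < x \<Longrightarrow> 0 < m x \<and> phi_inv H x = x / m x"
    "\<And>i x. y i \<le> x \<Longrightarrow> x \<le> y (i + 1) \<Longrightarrow> B powr real_of_int i / 2 \<le> m x"
    "\<And>i x. y i \<le> x \<Longrightarrow> x \<le> y (i + 1) \<Longrightarrow> m x \<le> B powr (real_of_int i + 1)"
    "\<And>x. 0 < x \<Longrightarrow> \<exists>i. y i \<le> x \<and> x < y (i + 1)"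
proof -
  define c where "c i = B powr real_of_int i" for i :: int
  have cpos: "0 < c i" for i using B by (simp add: c_def)
  have csuc: "c (i + 1) = B * c i" for i using B by (simp add: c_def powr_add)
  have cmono: "c i \<le> c j" if "i \<le> j" for i j using that B by (simp add: c_def)
  \<comment> \<open>\<open>y\<close> grows by \<open>2 * B\<close> per index and \<open>c\<close>
    only by \<open>B\<close>, so the quotient at least doubles.\<close>
  have ystep: "2 ^ n * (y i / c i) \<le> y (i + int n) / c (i + int n)" for n i
  proof (induction n)
    case (Suc n)
    have "2 ^ Suc n * (y i / c i) \<le> 2 * (y (i + int n) / c (i + int n))" using Suc by simp
    also have "\<dots> = 2 * B * y (i + int n) / (B * c (i + int n))" using B by simp
    also have "\<dots> \<le> y (i + int n + 1) / c (i + int n + 1)"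
      unfolding csuc using y(2)[of "i + int n"] B cpos[of "i + int n"] by (intro divide_right_mono) auto
    finally show ?case by (simp add: add_ac)
  qed simp
  have ycmono: "y i / c i \<le> y j / c j" if "i \<le> j" for i j
  proof -
    have "1 * (y i / c i) \<le> 2 ^ nat (j - i) * (y i / c i)" using y(1)[of i] cpos[of i] by (intro mult_right_mono) auto
    also have "\<dots> \<le> y j / c j" using ystep[of "nat (j - i)" i] that by simp
    finally show ?thesis by simp
  qed
  have ymono: "y i \<le> y j" if "i \<le> j" for i j
  proof -
    have "y i = y i / c i * c i" using cpos[of i] by simp
    also have "\<dots> \<le> y j / c j * c j" using ycmono[OF that] cmono[OF that] y(1)[of j] cpos[of i] cpos[of j] by (intro mult_mono) auto
    finally show ?thesis using cpos[of j] by simp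
  qed
  have ybig: "\<exists>i. u < y i / c i \<and> u < c i" for u
  proof -
    obtain n where n: "max u (u / (y 0 / c 0)) < 2 ^ n"
      using real_arch_pow[of 2 "max u (u / (y 0 / c 0))"] by (auto simp del: max_less_iff_conj)
    have "u < 2 ^ n * (y 0 / c 0)" using n y(1)[of 0] cpos[of 0] by (simp add: field_simps)
    also have "\<dots> \<le> y (int n) / c (int n)" using ystep[of n 0] by simp
    finally have "u < y (int n) / c (int n)" .
    moreover have "u < c (int n)"
    proof -
      have "u < 2 ^ n" using n by simp
      also have "\<dots> \<le> B ^ n" using B by (intro power_mono) auto
      also have "\<dots> = c (int n)" using B by (simp add: c_def powr_realpow)
      finally show ?thesis .
    qed
    ultimately show ?thesis by blast
  qed
  have ysmall: "\<exists>i. y i / c i < u \<and> c i < u" if u: "0 < u" for u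
  proof -
    obtain n where "max (1 / u) ((y 0 / c 0) / u) < 2 ^ n"
      using real_arch_pow[of 2 "max (1 / u) ((y 0 / c 0) / u)"] by (auto simp del: max_less_iff_conj)
    then have n: "1 / u < 2 ^ n" "(y 0 / c 0) / u < 2 ^ n" unfolding max_less_iff_conj by blast+
    have "2 ^ n * (y (- int n) / c (- int n)) \<le> y 0 / c 0" using ystep[of n "- int n"] by simp
    also have "\<dots> < 2 ^ n * u" using n(2) unfolding pos_divide_less_eq[OF u] .
    finally have "y (- int n) / c (- int n) < u" by (rule mult_left_less_imp_less) simp
    moreover have "c (- int n) < u"
    proof -
      have "1 / u < 2 ^ n" by (rule n(1))
      also have "\<dots> \<le> B ^ n" using B by (intro power_mono) auto
      finally have "1 < u * B ^ n" using u by (simp add: field_simps)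
      then have "1 / B ^ n < u" using B by (simp add: pos_divide_less_eq)
      moreover have "c (- int n) = 1 / B ^ n" using B by (simp add: c_def powr_realpow powr_minus_divide)
      ultimately show ?thesis by simp
    qed
    ultimately show ?thesis by blast
  qed
  have block: "\<exists>i. y i \<le> x \<and> x < y (i + 1)" if x: "0 < x" for x
  proof -
    obtain i0 where "y i0 / c i0 < min 1 x \<and> c i0 < min 1 x" using ysmall[of "min 1 x"] x by auto
    then have i0: "y i0 \<le> x"
    proof -
      assume *: "y i0 / c i0 < min 1 x \<and> c i0 < min 1 x"
      have "y i0 = y i0 / c i0 * c i0" using cpos[of i0] by simp
      also have "\<dots> \<le> x * 1" using * y(1)[of i0] cpos[of i0] by (intro mult_mono) auto
      finally show ?thesis by simp
    qed
    obtain i1 where "max 1 x < y i1 / c i1 \<and> max 1 x < c i1" using ybig[of "max 1 x"] by auto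
    then have i1: "x < y i1"
    proof -
      assume *: "max 1 x < y i1 / c i1 \<and> max 1 x < c i1"
      have "x * 1 < y i1 / c i1 * c i1" using * x by (intro mult_strict_mono) auto
      then show ?thesis using cpos[of i1] by simp
    qed
    define n where "n = (LEAST n. x < y (i0 + int n))"
    have lt: "i0 < i1" using i0 i1 ymono[of i1 i0] by (meson leI le_less_trans not_less order_trans)
    then have "x < y (i0 + int (nat (i1 - i0)))" using i1 by simp
    then have n: "x < y (i0 + int n)" "\<And>k. k < n \<Longrightarrow> \<not> x < y (i0 + int k)"
      unfolding n_def using LeastI[of "\<lambda>n. x < y (i0 + int n)"] not_less_Least[of _ "\<lambda>n. x < y (i0 + int n)"] by blast+
    have "n \<noteq> 0" using n(1) i0 by (cases n) auto
    then obtain k where k: "n = Suc k" using not0_implies_Suc by blast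
    show ?thesis using n(1) n(2)[of k] k by (intro exI[of _ "i0 + int k"]) (auto simp: add_ac not_less)
  qed
  define v where "v j x = (x + y j) / c j" for j x
  define \<kappa> where "\<kappa> x = (if x \<le> 0 then 0 else INF j. v j x)" for x
  have vpos: "0 < v j x" if "0 < x" for j x using that y(1)[of j] cpos[of j] by (simp add: v_def)
  have bdd: "bdd_below (range (\<lambda>j. v j x))" if "0 < x" for x
    using vpos[OF that] by (intro bdd_belowI[of _ 0]) (auto intro: less_imp_le)
  have kv: "\<kappa> x \<le> v j x" if "0 < x" for j x using that bdd by (auto simp: \<kappa>_def intro!: cINF_lower)
  \<comment> \<open>For smaller \<open>j\<close>, \<open>y i \<le> x\<close> gives
    \<open>v i x \<le> 2 * x / c i\<close>, and \<open>B \<ge> 2\<close> finishes. For larger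
    \<open>j\<close>, \<open>x \<le> y (i + 1)\<close> and the doubling of \<open>y / c\<close>
    do.\<close>
  have vmin: "min (v i x) (v (i + 1) x) \<le> v j x" if x: "0 < x" and xi: "y i \<le> x" "x \<le> y (i + 1)" for i j x
  proof -
    consider "j = i" | "j = i + 1" | "j < i" | "i + 1 < j" by linarith
    then show ?thesis
    proof cases
      case 3
      have "v i x \<le> 2 * x / c i" using xi cpos[of i] by (auto simp: v_def intro!: divide_right_mono)
      also have "\<dots> \<le> B * x / c i" using B x cpos[of i] by (intro divide_right_mono mult_right_mono) auto
      also have "\<dots> = x / c (i - 1)" using csuc[of "i - 1"] B by simp
      also have "\<dots> \<le> x / c j" using 3 x cmono[of j "i - 1"] cpos[of j] cpos[of "i-1"] by (intro divide_left_mono) auto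
      also have "\<dots> \<le> v j x" unfolding v_def using y(1)[of j] cpos[of j] by (intro divide_right_mono) auto
      finally show ?thesis by simp
    next
      case 4
      have "v (i + 1) x \<le> 2 * (y (i + 1) / c (i + 1))" using xi cpos[of "i + 1"] by (auto simp: v_def field_simps)
      also have "\<dots> \<le> y (i + 1 + 1) / c (i + 1 + 1)" using ystep[of 1 "i + 1"] by simp
      also have "\<dots> \<le> y j / c j" using 4 by (intro ycmono) auto
      also have "\<dots> \<le> v j x" using x cpos[of j] by (auto simp: v_def intro!: divide_right_mono)
      finally show ?thesis by simp
    qed auto
  qed
  have katt: "\<exists>j. \<kappa> x = v j x" if x: "0 < x" for x
  proof -
    obtain i where i: "y i \<le> x" "x < y (i + 1)" using block[OF x] by blast
    have "min (v i x) (v (i + 1) x) \<le> \<kappa> x"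
      using x vmin[OF x i(1) less_imp_le[OF i(2)]] by (auto simp: \<kappa>_def simp del: min_le_iff_disj intro!: cINF_greatest)
    then have "\<kappa> x = v i x \<or> \<kappa> x = v (i + 1) x" using kv[OF x, of i] kv[OF x, of "i + 1"] by (auto simp: min_def split: if_splits)
    then show ?thesis by blast
  qed
  have kpos: "0 < \<kappa> x" if "0 < x" for x using katt[OF that] vpos[OF that] by metis
  have kmono: "\<kappa> x < \<kappa> x'" if x: "0 < x" "x < x'" for x x'
  proof -
    obtain j where j: "\<kappa> x' = v j x'" using katt[of x'] x by auto
    have "\<kappa> x \<le> v j x" by (rule kv[OF x(1)])
    also have "\<dots> < v j x'" using x cpos[of j] by (auto simp: v_def intro!: divide_strict_right_mono)
    finally show ?thesis using j by simp
  qed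
  have kratio: "\<kappa> x' / x' < \<kappa> x / x" if x: "0 < x" "x < x'" for x x'
  proof -
    obtain j where j: "\<kappa> x = v j x" using katt[of x] x by auto
    have e: "v j z / z = (1 + y j / z) / c j" if "0 < z" for z using that cpos[of j] by (simp add: v_def field_simps)
    have "\<kappa> x' / x' \<le> v j x' / x'" using x kv[of x' j] by (intro divide_right_mono) auto
    also have "\<dots> < v j x / x"
      using x e[of x] e[of x'] y(1)[of j] cpos[of j] by (auto intro!: divide_strict_right_mono divide_strict_left_mono)
    finally show ?thesis using j by simp
  qed
  have ky: "y i / c i \<le> \<kappa> (y i)" "\<kappa> (y i) \<le> 2 * (y i / c i)" for i
  proof -
    have "v i (y i) = 2 * (y i / c i)" by (simp add: v_def)
    then show "\<kappa> (y i) \<le> 2 * (y i / c i)" using kv[OF y(1), of i i] by simp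
    have "y i / c i \<le> v i (y i)" using y(1)[of i] cpos[of i] by (auto simp: v_def intro!: divide_right_mono)
    moreover have "y i / c i \<le> v (i + 1) (y i)"
    proof -
      have "y i / c i \<le> y (i + 1) / c (i + 1)" by (rule ycmono) simp
      also have "\<dots> \<le> v (i + 1) (y i)" using y(1)[of i] cpos[of "i+1"] by (auto simp: v_def intro!: divide_right_mono)
      finally show ?thesis .
    qed
    ultimately have "y i / c i \<le> v j (y i)" for j
      using vmin[OF y(1), of i i j] ymono[of i "i + 1"] by auto
    then show "y i / c i \<le> \<kappa> (y i)" using katt[OF y(1)] by metis
  qed
  define m where "m x = x / \<kappa> x" for x
  have mpos: "0 < m x" if "0 < x" for x using that kpos[OF that] by (simp add: m_def)
  have mmono: "m x < m x'" if "0 < x" "x < x'" for x x'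
    using kratio[OF that] kpos[of x] kpos[of x'] that by (simp add: m_def field_simps)
  have my: "c i / 2 \<le> m (y i)" "m (y i) \<le> c i" for i
    using ky[of i] kpos[OF y(1)[of i]] y(1)[of i] cpos[of i] by (auto simp: m_def field_simps)
  have m_low: "c i / 2 \<le> m x" if "y i \<le> x" for i x
    using my(1)[of i] mmono[of "y i" x] y(1)[of i] that by (cases "x = y i") auto
  have m_upp: "m x \<le> c (i + 1)" if "0 < x" "x \<le> y (i + 1)" for i x
    using my(2)[of "i + 1"] mmono[of x "y (i + 1)"] that by (cases "x = y (i + 1)") auto
  have k0: "\<kappa> 0 = 0" and m0: "m 0 = 0" by (simp_all add: \<kappa>_def m_def)
  have phik: "phi_function \<kappa>"
  proof (rule phi_functionI_quasiconcave)
    show "\<kappa> y / y \<le> \<kappa> x / x" if "0 < x" "x < y" for x y using kratio[OF that] by simp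
    fix u :: real
    show "\<exists>x>0. \<kappa> x < u" if u: "0 < u"
    proof -
      obtain i where "y i / c i < u / 2" using ysmall[of "u / 2"] u by auto
      then have "\<kappa> (y i) < u" using ky(2)[of i] by linarith
      then show ?thesis using y(1)[of i] by blast
    qed
    obtain i where "u < y i / c i" using ybig[of u] by auto
    then show "\<exists>x>0. u < \<kappa> x" using ky(1)[of i] y(1)[of i] by (intro exI[of _ "y i"]) auto
  qed (use k0 kpos kmono in auto)
  have phim: "phi_function m"
  proof (rule phi_functionI_quasiconcave)
    show "m y / y \<le> m x / x" if "0 < x" "x < y" for x y
      using kmono[OF that] kpos[of x] kpos[of y] that by (auto simp: m_def intro!: divide_left_mono)
    fix u :: real
    show "\<exists>x>0. m x < u" if u: "0 < u"
    proof -
      obtain i where "c i < u" using ysmall[of u] u by auto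
      then show ?thesis using my(2)[of i] y(1)[of i] by (intro exI[of _ "y i"]) auto
    qed
    obtain i where "2 * u < c i" using ybig[of "2 * u"] by auto
    then show "\<exists>x>0. u < m x" using my(1)[of i] y(1)[of i] by (intro exI[of _ "y i"]) auto
  qed (use m0 mpos mmono in auto)
  define H where "H = phi_inv \<kappa>"
  define Hs where "Hs = phi_inv m"
  have H: "phi_function H" unfolding H_def by (rule phi_function_phi_inv[OF phik])
  have Hs: "phi_function Hs" unfolding Hs_def by (rule phi_function_phi_inv[OF phim])
  have Hinv: "phi_inv H x = \<kappa> x" if "0 \<le> x" for x unfolding H_def by (rule phi_inv_phi_inv[OF phik that])
  have Hsinv: "phi_inv Hs x = m x" if "0 \<le> x" for x unfolding Hs_def by (rule phi_inv_phi_inv[OF phim that])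
  have comp: "complementary H Hs"
    unfolding complementary_def
  proof (intro conjI exI[of _ 1] allI impI Hs)
    fix t :: real assume t: "0 \<le> t"
    have "phi_inv H t * phi_inv Hs t = t"
      using t kpos[of t] k0 by (cases "t = 0") (auto simp: Hinv Hsinv m_def)
    then show "t / 1 \<le> phi_inv H t * phi_inv Hs t" "phi_inv H t * phi_inv Hs t \<le> 1 * t" by auto
  qed simp
  \<comment> \<open>So \<open>H t / t\<close> is strictly increasing from 0 to infinity, and
    \<open>H\<close> can serve as its own comparison function in \<open>N_function\<close>.\<close>
  have Hratio: "H t / t = m (H t)" if t: "0 < t" for t
    using phi_inv_right[OF phik, of t] t by (simp add: m_def H_def)
  have N: "N_function H"
    unfolding N_function_def
  proof (intro conjI exI[of _ H] H)
    show "phi_equiv H H" unfolding phi_equiv_def by (intro exI[of _ 1]) auto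
    show "strict_mono_on {0<..} (\<lambda>t. H t / t)"
    proof (rule strict_mono_onI)
      fix r s :: real assume rs: "r \<in> {0<..}" "s \<in> {0<..}" "r < s"
      then have "H r < H s" "0 < H r" using phi_function_less_iff[OF H, of r s] phi_function_pos[OF H, of r] by auto
      then show "H r / r < H s / s" using rs mmono by (simp add: Hratio)
    qed
    have "filterlim (\<lambda>t. m (H t)) at_top at_top"
      by (rule filterlim_compose[OF phi_function_top[OF phim] phi_function_top[OF H]])
    moreover have "\<forall>\<^sub>F t in at_top. m (H t) = H t / t"
      using eventually_gt_at_top[of 0] by (rule eventually_mono) (simp add: Hratio)
    ultimately show "filterlim (\<lambda>t. H t / t) at_top at_top" using filterlim_cong[OF refl refl] by fast
    have "continuous_on {0..} (\<lambda>t. m (H t))"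
      using phi_function_cont[OF H] phi_function_image[OF H]
      by (intro continuous_on_compose2[OF phi_function_cont[OF phim]]) auto
    then have "((\<lambda>t. m (H t)) \<longlongrightarrow> m (H 0)) (at 0 within {0..})" by (auto simp: continuous_on)
    then have "((\<lambda>t. m (H t)) \<longlongrightarrow> m (H 0)) (at_right 0)" by (rule tendsto_within_subset) auto
    then have "((\<lambda>t. m (H t)) \<longlongrightarrow> 0) (at_right 0)" by (simp only: phi_function_zero[OF H] m0)
    moreover have "\<forall>\<^sub>F t in at_right 0. m (H t) = H t / t"
      using eventually_at_right_less[of 0] by (rule eventually_mono) (simp add: Hratio)
    ultimately show "((\<lambda>t. H t / t) \<longlongrightarrow> 0) (at_right 0)" using tendsto_cong by fast
  qed
  obtain r where r: "max 1 S < 2 ^ r" 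
    using real_arch_pow[of 2 "max 1 S"] by (auto simp del: max_less_iff_conj)
  \<comment> \<open>The 2 meets the loss in \<open>c i / 2 \<le> m (y i)\<close>. Three powers of
    \<open>B\<close> move the index from \<open>i + 1\<close> to \<open>i - 2\<close>, where the
    two-block sum applies, and \<open>r\<close> more gain a factor \<open>2 ^ r\<close> that beats
    \<open>S\<close>.\<close>
  define cJ where "cJ = 2 * B ^ (3 + r)"
  have cJ: "0 < cJ" using B by (simp add: cJ_def)
  have ydec: "(2 * B) ^ n * y (i - int n) \<le> y i" for n i
  proof (induction n)
    case (Suc n)
    have "(2 * B) ^ Suc n * y (i - int (Suc n)) = (2 * B) ^ n * (2 * B * y (i - int (Suc n)))" by simp
    also have "\<dots> \<le> (2 * B) ^ n * y (i - int n)" using y(2)[of "i - int (Suc n)"] B by (intro mult_left_mono) (auto simp: add_ac)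
    also have "\<dots> \<le> y i" by (rule Suc)
    finally show ?case .
  qed simp
  have Hbound: "Hs (m (1 / x) / cJ) \<le> y (i - 2) / 2 ^ r" if x: "0 < x" and xi: "y i \<le> 1 / x" "1 / x < y (i + 1)" for x i
  proof -
    have e: "c (i + 1) = B ^ (3 + r) * c (i - 2 - int r)"
    proof -
      have "B ^ (3 + r) = B powr real (3 + r)" using B by (intro powr_realpow[symmetric]) auto
      then show ?thesis using B by (simp add: c_def add_ac flip: powr_add)
    qed
    have "m (1 / x) \<le> c (i + 1)" using x xi by (intro m_upp) auto
    then have "m (1 / x) / cJ \<le> c (i + 1) / cJ" using cJ by (intro divide_right_mono) auto
    also have "\<dots> = c (i - 2 - int r) / 2" unfolding e cJ_def using B by simp
    also have "\<dots> \<le> m (y (i - 2 - int r))" by (rule my)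
    finally have "Hs (m (1 / x) / cJ) \<le> y (i - 2 - int r)"
      unfolding Hs_def using mpos[of "1/x"] x cJ y(1) by (subst phi_inv_le_iff[OF phim]) (auto intro: less_imp_le)
    also have "\<dots> \<le> y (i - 2) / 2 ^ r"
    proof -
      have "2 ^ r * y (i - 2 - int r) \<le> (2 * B) ^ r * y (i - 2 - int r)"
        using B y(1)[of "i - 2 - int r"] by (intro mult_right_mono power_mono) auto
      also have "\<dots> \<le> y (i - 2)" by (rule ydec)
      finally show ?thesis by (simp add: field_simps)
    qed
    finally show ?thesis .
  qed
  \<comment> \<open>If \<open>1 / x\<close> lies in block \<open>i\<close>, then
    \<open>x \<le> 1 / y i\<close>. Summing rectangles over all integers, enumerated by
    \<open>int_decode\<close>, bounds the integral by the sum of \<open>y (i - 2) / y i\<close>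
    divided by \<open>2 ^ r\<close>.\<close>
  have "(\<integral>\<^sup>+ x\<in>{0..}. ennreal (Hs (\<bar>1 / phi_inv (tilde Hs) x\<bar> / cJ)) \<partial>lborel) \<le>
      (\<integral>\<^sup>+ x. (\<Sum>n. ennreal (y (int_decode n - 2) / 2 ^ r) * indicator {0..1 / y (int_decode n)} x) \<partial>lborel)"
    unfolding nn_integral_nonneg_pos
  proof (intro nn_integral_mono)
    fix x :: real
    show "ennreal (Hs (\<bar>1 / phi_inv (tilde Hs) x\<bar> / cJ)) * indicator {0<..} x \<le>
      (\<Sum>n. ennreal (y (int_decode n - 2) / 2 ^ r) * indicator {0..1 / y (int_decode n)} x)"
    proof (cases "0 < x")
      case True
      obtain i where i: "y i \<le> 1 / x" "1 / x < y (i + 1)" using block[of "1 / x"] True by auto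
      have xi: "x \<le> 1 / y i" using i(1) True y(1)[of i] by (simp add: field_simps)
      have "\<bar>1 / phi_inv (tilde Hs) x\<bar> = m (1 / x)"
        using True mpos[of "1 / x"] by (simp add: phi_inv_tilde[OF Hs True] Hsinv)
      then have "ennreal (Hs (\<bar>1 / phi_inv (tilde Hs) x\<bar> / cJ)) \<le> ennreal (y (i - 2) / 2 ^ r)"
        using Hbound[OF True i] by (simp add: ennreal_leI)
      also have "\<dots> = (\<Sum>n\<in>{int_encode i}. ennreal (y (int_decode n - 2) / 2 ^ r) * indicator {0..1 / y (int_decode n)} x)"
        using True xi by simp
      also have "\<dots> \<le> (\<Sum>n. ennreal (y (int_decode n - 2) / 2 ^ r) * indicator {0..1 / y (int_decode n)} x)"
        by (intro sum_le_suminf) auto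
      finally show ?thesis using True by simp
    qed auto
  qed
  also have "\<dots> = (\<Sum>n. \<integral>\<^sup>+ x. ennreal (y (int_decode n - 2) / 2 ^ r) * indicator {0..1 / y (int_decode n)} x \<partial>lborel)"
    by (intro nn_integral_suminf) auto
  also have "\<dots> = (\<Sum>n. ennreal (y (int_decode n - 2) / y (int_decode n) / 2 ^ r))"
  proof (intro suminf_cong)
    fix n
    have "(\<integral>\<^sup>+ x. ennreal (y (int_decode n - 2) / 2 ^ r) * indicator {0..1 / y (int_decode n)} x \<partial>lborel) =
      ennreal (y (int_decode n - 2) / 2 ^ r) * ennreal (1 / y (int_decode n))"
      using y(1)[of "int_decode n"] by (subst nn_integral_cmult_indicator) auto
    also have "\<dots> = ennreal (y (int_decode n - 2) / y (int_decode n) / 2 ^ r)"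
      using y(1)[of "int_decode n"] y(1)[of "int_decode n - 2"] by (subst ennreal_mult[symmetric]) (auto simp: mult.commute intro: less_imp_le)
    finally show "(\<integral>\<^sup>+ x. ennreal (y (int_decode n - 2) / 2 ^ r) * indicator {0..1 / y (int_decode n)} x \<partial>lborel) =
      ennreal (y (int_decode n - 2) / y (int_decode n) / 2 ^ r)" .
  qed
  also have "\<dots> \<le> 1"
    unfolding suminf_eq_SUP
  proof (rule SUP_least)
    fix k
    have "(\<Sum>n<k. y (int_decode n - 2) / y (int_decode n)) = (\<Sum>i\<in>(\<lambda>n. int_decode n - 2) ` {..<k}. y i / y (i + 2))"
      by (subst sum.reindex) (auto simp: inj_on_def int_decode_eq)
    also have "\<dots> \<le> S" by (intro sumy) auto
    also have "\<dots> \<le> 2 ^ r" using r by simp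
    finally have "(\<Sum>n<k. y (int_decode n - 2) / y (int_decode n)) / 2 ^ r \<le> 1" by simp
    then have "(\<Sum>n<k. y (int_decode n - 2) / y (int_decode n) / 2 ^ r) \<le> 1" by (simp add: sum_divide_distrib)
    then have "ennreal (\<Sum>n<k. y (int_decode n - 2) / y (int_decode n) / 2 ^ r) \<le> ennreal 1" by (rule ennreal_leI)
    then show "(\<Sum>n<k. ennreal (y (int_decode n - 2) / y (int_decode n) / 2 ^ r)) \<le> 1"
      using y(1) by (subst sum_ennreal) (auto intro: less_imp_le)
  qed
  finally have int: "(\<integral>\<^sup>+ x\<in>{0..}. ennreal (Hs (\<bar>1 / phi_inv (tilde Hs) x\<bar> / cJ)) \<partial>lborel) \<le> 1" .
  have "luxemburg Hs (\<lambda>x. ereal (1 / phi_inv (tilde Hs) x)) \<le> ennreal cJ"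
    unfolding luxemburg_def using int cJ by (intro Inf_lower) auto
  then have "luxemburg Hs (\<lambda>x. ereal (1 / phi_inv (tilde Hs) x)) < \<infinity>" by (auto intro: le_less_trans)
  then have J: "condition_J H" unfolding condition_J_def using comp by blast
  show ?thesis
  proof (rule that[of H m, OF H N J])
    show "0 < m x \<and> phi_inv H x = x / m x" if "0 < x" for x
      using that mpos[OF that] kpos[OF that] by (simp add: Hinv m_def)
    show "B powr real_of_int i / 2 \<le> m x" if "y i \<le> x" for i x using m_low[OF that] by (simp add: c_def)
    show "m x \<le> B powr (real_of_int i + 1)" if "y i \<le> x" "x \<le> y (i + 1)" for i x
      using m_upp[of x i] that y(1)[of i] by (simp add: c_def)
    show "\<exists>i. y i \<le> x \<and> x < y (i + 1)" if "0 < x" for x by (rule block[OF that])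
  qed
qed

section \<open>Verifying the convexity relation for the constructed function\<close>

text \<open>\<open>K\<close> is the supremum of the hinge functions
  \<open>R u / u * max 0 (x - u)\<close>, hence convex. The hypothesis bounds every hinge by
  \<open>A * R x\<close>, and the hinge with \<open>u = x / 2\<close> has the value
  \<open>R (x / 2)\<close> at \<open>x\<close>.\<close>

lemma almost_increasing_ratio_phi_equiv_convex:
  fixes R :: "real \<Rightarrow> real"
  assumes R: "phi_function R" and A: "1 \<le> A" and ratio: "\<And>x y. 0 < x \<Longrightarrow> x \<le> y \<Longrightarrow> R x / x \<le> A * (R y / y)"
  shows "\<exists>K. convex_on {0..} K \<and> phi_equiv R K"
proof -
  define h where "h u x = R u / u * max 0 (x - u)" for u x :: real
  have Rp: "0 < R u" if "0 < u" for u using phi_function_pos[OF R that] .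
  have hA: "h u x \<le> A * R x" if u: "0 < u" and x: "0 \<le> x" for u x
  proof (cases "x \<le> u")
    case True
    then show ?thesis using phi_function_nonneg[OF R x] A by (simp add: h_def max_def)
  next
    case False
    then have x0: "0 < x" using u by simp
    have "h u x \<le> R u / u * x" unfolding h_def using u Rp[OF u] False by (intro mult_left_mono) auto
    also have "\<dots> \<le> A * (R x / x) * x" using ratio[OF u, of x] False x0 by (intro mult_right_mono) auto
    finally show ?thesis using x0 by simp
  qed
  define K where "K x = (SUP u\<in>{0<..}. h u x)" for x
  have bdd: "bdd_above ((\<lambda>u. h u x) ` {0<..})" if "0 \<le> x" for x
    using hA[OF _ that] by (intro bdd_aboveI[of _ "A * R x"]) auto
  have hK: "h u x \<le> K x" if "0 < u" "0 \<le> x" for u x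
    unfolding K_def using that bdd[OF that(2)] by (intro cSUP_upper) auto
  have KA: "K x \<le> A * R x" if "0 \<le> x" for x
    unfolding K_def using hA that by (intro cSUP_least) auto
  have "convex_on {0..} K"
  proof (rule convex_onI)
    fix t x y :: real assume t: "0 < t" "t < 1" and x: "x \<in> {0..}" and y: "y \<in> {0..}"
    have "K ((1 - t) *\<^sub>R x + t *\<^sub>R y) \<le> (1 - t) * K x + t * K y"
      unfolding K_def[of "(1 - t) *\<^sub>R x + t *\<^sub>R y"]
    proof (rule cSUP_least)
      fix u :: real assume "u \<in> {0<..}"
      then have u: "0 < u" by simp
      have "(1 - t) *\<^sub>R x + t *\<^sub>R y - u = (1 - t) * (x - u) + t * (y - u)" by (simp add: algebra_simps)
      also have "\<dots> \<le> (1 - t) * max 0 (x - u) + t * max 0 (y - u)" using t by (intro add_mono mult_left_mono) auto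
      finally have "max 0 ((1 - t) *\<^sub>R x + t *\<^sub>R y - u) \<le> (1 - t) * max 0 (x - u) + t * max 0 (y - u)"
        using t by auto
      then have "h u ((1 - t) *\<^sub>R x + t *\<^sub>R y) \<le> R u / u * ((1 - t) * max 0 (x - u) + t * max 0 (y - u))"
        unfolding h_def using u Rp[OF u] by (intro mult_left_mono) auto
      also have "\<dots> = (1 - t) * h u x + t * h u y" by (simp only: h_def distrib_left mult.left_commute)
      also have "\<dots> \<le> (1 - t) * K x + t * K y" using t x y u by (intro add_mono mult_left_mono hK) auto
      finally show "h u ((1 - t) *\<^sub>R x + t *\<^sub>R y) \<le> (1 - t) * K x + t * K y" .
    qed auto
    then show "K ((1 - t) *\<^sub>R x + t *\<^sub>R y) \<le> (1 - t) * K x + t * K y" .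
  qed simp
  \<comment> \<open>The ratio hypothesis between \<open>x\<close> and \<open>A\<^sup>2 * x\<close>
    turns the outer factor \<open>A\<close> into a dilation by \<open>A\<^sup>2\<close>; the 2 comes
    from the hinge at \<open>x / 2\<close>.\<close>
  moreover have "phi_equiv R K"
    unfolding phi_equiv_def
  proof (intro exI[of _ "2 * A\<^sup>2"] conjI allI impI)
    show "0 < 2 * A\<^sup>2" using A by simp
    have A2: "1 \<le> A\<^sup>2" using A by simp
    fix x :: real assume x: "0 \<le> x"
    show "R (x / (2 * A\<^sup>2)) \<le> K x"
    proof (cases "x = 0")
      case True
      then show ?thesis using hK[of 1 0] phi_function_zero[OF R] by (simp add: h_def)
    next
      case False
      then have x0: "0 < x / 2" using x by simp
      have "x / (2 * A\<^sup>2) \<le> x / 2" using x A2 by (intro divide_left_mono) auto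
      then have "R (x / (2 * A\<^sup>2)) \<le> R (x / 2)" using x by (intro phi_function_mono[OF R]) auto
      also have "\<dots> = h (x / 2) x" using x0 by (simp add: h_def max_def)
      also have "\<dots> \<le> K x" by (rule hK[OF x0 x])
      finally show ?thesis .
    qed
    show "K x \<le> R (2 * A\<^sup>2 * x)"
    proof (cases "x = 0")
      case True
      then show ?thesis using KA[of 0] phi_function_zero[OF R] by simp
    next
      case False
      then have x0: "0 < x" using x by simp
      have le: "x \<le> A\<^sup>2 * x" using A2 x0 mult_right_mono[of 1 "A\<^sup>2" x] by simp
      have "R x / x \<le> A * (R (A\<^sup>2 * x) / (A\<^sup>2 * x))" by (rule ratio[OF x0 le])
      also have "\<dots> = R (A\<^sup>2 * x) / A / x" using A x0 by (simp add: power2_eq_square)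
      finally have "R x \<le> R (A\<^sup>2 * x) / A" using x0 unfolding divide_le_cancel by blast
      then have "A * R x \<le> R (A\<^sup>2 * x)" using A by (simp add: field_simps)
      also have "\<dots> \<le> R (2 * A\<^sup>2 * x)" using x0 A2 by (intro phi_function_mono[OF R] mult_right_mono) auto
      finally show ?thesis using KA[OF x] by simp
    qed
  qed
  ultimately show ?thesis by blast
qed

text \<open>Chaining through the block ends costs \<open>B\<close> per full block, with
  \<open>A0\<close> entering at most once there, since only block 0 has that constant. The partial
  blocks at both ends are each allowed \<open>A0 * B\<close>, which explains the cube.\<close>

lemma block_ratio_bound:
  fixes b :: "int \<Rightarrow> real" and \<rho> :: "real \<Rightarrow> real"
  assumes B: "1 \<le> B" and A0: "1 \<le> A0" and bmono: "\<And>i. b i \<le> b (i + 1)"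
    and \<rho>: "\<And>i s. b i \<le> s \<Longrightarrow> 0 \<le> \<rho> s"
    and blk: "\<And>i s t. b i \<le> s \<Longrightarrow> s \<le> t \<Longrightarrow> t \<le> b (i + 1) \<Longrightarrow> \<rho> t \<le> (if i = 0 then A0 else B) * \<rho> s"
    and s: "b i \<le> s" "s \<le> b (i + 1)" and t: "b j \<le> t" "t \<le> b (j + 1)" and st: "s \<le> t" and ij: "i \<le> j"
  shows "\<rho> t \<le> A0 ^ 3 * B powr (real_of_int (j - i) + 2) * \<rho> s"
proof -
  have one: "\<rho> t \<le> (A0 * B) * \<rho> s" if "b i \<le> s" "s \<le> t" "t \<le> b (i + 1)" for i s t
  proof -
    have "\<rho> t \<le> (if i = 0 then A0 else B) * \<rho> s" by (rule blk[OF that])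
    also have "\<dots> \<le> (A0 * B) * \<rho> s"
      using A0 B \<rho>[OF that(1)] mult_mono[of A0 A0 1 B] mult_mono[of 1 A0 B B] by (intro mult_right_mono) auto
    finally show ?thesis .
  qed
  \<comment> \<open>Normalising weight: it absorbs the constant of each block, so that the quotient
    of \<open>\<rho>\<close> by \<open>Z\<close> decreases along the block ends.\<close>
  define Z where "Z i = (if i \<le> 0 then 1 else A0) * B powr real_of_int i" for i :: int
  have Zpos: "0 < Z i" for i using A0 B by (simp add: Z_def)
  have Zs: "(if i = 0 then A0 else B) * Z i \<le> Z (i + 1)" for i
  proof -
    have e: "B powr (real_of_int i + 1) = B * B powr real_of_int i" using B by (simp add: powr_add)
    consider "i < 0" | "i = 0" | "0 < i" by linarith
    then show ?thesis
    proof cases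
      case 2
      then show ?thesis using A0 B by (simp add: Z_def)
    qed (use e A0 B in \<open>auto simp: Z_def\<close>)
  qed
  have nodes: "\<rho> (b (k + int n)) / Z (k + int n) \<le> \<rho> (b k) / Z k" for k n
  proof (induction n)
    case (Suc n)
    let ?l = "k + int n"
    have "\<rho> (b (?l + 1)) \<le> (if ?l = 0 then A0 else B) * \<rho> (b ?l)" by (rule blk) (use bmono in auto)
    then have "\<rho> (b (?l + 1)) * Z ?l \<le> (if ?l = 0 then A0 else B) * \<rho> (b ?l) * Z ?l"
      using Zpos[of ?l] by (intro mult_right_mono) auto
    also have "\<dots> = ((if ?l = 0 then A0 else B) * Z ?l) * \<rho> (b ?l)" by simp
    also have "\<dots> \<le> Z (?l + 1) * \<rho> (b ?l)" using Zs[of ?l] \<rho>[of ?l "b ?l"] by (intro mult_right_mono) auto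
    finally have "\<rho> (b (?l + 1)) / Z (?l + 1) \<le> \<rho> (b ?l) / Z ?l"
      using Zpos[of ?l] Zpos[of "?l + 1"] by (simp add: field_simps)
    then show ?case using Suc by (simp add: add_ac)
  qed simp
  show ?thesis
  proof (cases "i = j")
    case True
    have "\<rho> t \<le> (A0 * B) * \<rho> s" using one[of i s t] s t st True by simp
    also have "\<dots> \<le> A0 ^ 3 * B powr (real_of_int (j - i) + 2) * \<rho> s"
    proof (intro mult_right_mono mult_mono)
      show "A0 \<le> A0 ^ 3" using A0 power_increasing[of 1 3 A0] by simp
      show "B \<le> B powr (real_of_int (j - i) + 2)" using B True powr_mono[of 1 2 B] by simp
    qed (use A0 B \<rho>[OF s(1)] in auto)
    finally show ?thesis .
  next
    case False
    define n where "n = nat (j - (i + 1))"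
    have n: "j = i + 1 + int n" using False ij by (simp add: n_def)
    have Zr: "Z j / Z (i + 1) \<le> A0 * B powr (real_of_int (j - i) - 1)"
    proof -
      have "Z j \<le> A0 * B powr real_of_int j" using A0 B by (auto simp: Z_def)
      moreover have "B powr real_of_int (i + 1) \<le> Z (i + 1)" using A0 B by (auto simp: Z_def)
      ultimately have "Z j / Z (i + 1) \<le> A0 * B powr real_of_int j / B powr real_of_int (i + 1)"
        using A0 B Zpos[of j] by (intro frac_le) auto
      also have "\<dots> = A0 * B powr (real_of_int (j - i) - 1)" using B by (simp add: powr_diff powr_add)
      finally show ?thesis .
    qed
    have "\<rho> t \<le> (A0 * B) * \<rho> (b j)" using t by (intro one) auto
    also have "\<rho> (b j) \<le> Z j / Z (i + 1) * \<rho> (b (i + 1))"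
      using nodes[of "i + 1" n] Zpos[of j] Zpos[of "i + 1"] n by (simp add: field_simps)
    also have "\<dots> \<le> A0 * B powr (real_of_int (j - i) - 1) * \<rho> (b (i + 1))"
      using Zr \<rho>[of "i + 1" "b (i + 1)"] by (intro mult_right_mono) auto
    also have "\<rho> (b (i + 1)) \<le> (A0 * B) * \<rho> s" using s by (intro one) auto
    finally have "\<rho> t \<le> (A0 * B) * (A0 * B powr (real_of_int (j - i) - 1) * ((A0 * B) * \<rho> s))"
      using A0 B by (simp add: mult_left_mono)
    also have "\<dots> = A0 ^ 3 * (B powr (real_of_int (j - i) - 1) * B * B) * \<rho> s" by (simp add: power3_eq_cube)
    also have "B powr (real_of_int (j - i) - 1) * B * B = B powr (real_of_int (j - i) + 1)"
      using B powr_add[of B "real_of_int (j - i) - 1" 1] powr_add[of B "real_of_int (j - i)" 1] by simp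
    also have "A0 ^ 3 * B powr (real_of_int (j - i) + 1) * \<rho> s \<le> A0 ^ 3 * B powr (real_of_int (j - i) + 2) * \<rho> s"
      using A0 B \<rho>[OF s(1)] by (intro mult_right_mono mult_left_mono powr_mono) auto
    finally show ?thesis .
  qed
qed

lemma phi_function_comp:
  assumes "phi_function F" "phi_function G"
  shows "phi_function (\<lambda>x. F (G x))"
proof (rule phi_functionI_surj)
  show "strict_mono_on {0..} (\<lambda>x. F (G x))"
    using phi_function_less_iff[OF assms(1)] phi_function_less_iff[OF assms(2)] phi_function_nonneg[OF assms(2)]
    by (intro strict_mono_onI) auto
  show "(\<lambda>x. F (G x)) ` {0..} = {0..}"
    using phi_function_image[OF assms(1)] phi_function_image[OF assms(2)] by (simp flip: image_image)
qed

text \<open>Per block \<open>G1 t / t\<close> grows at most by about \<open>B\<close>, and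
  \<open>m\<close> grows by about \<open>B\<close>, so \<open>s * m (G1 s) / G1 s\<close> is almost
  increasing. At \<open>s = R x\<close>, with \<open>R\<close> the inverse of \<open>G1\<close>
  after \<open>H\<close>, this quotient is \<open>R x / x\<close>, and its almost monotonicity gives
  the required convexity.\<close>

lemma N_function_of_q_concave:
  assumes F: "phi_function F" and G: "phi_function G" "dilatory G" and q: "0 < q"
    and low: "boyd_lower (OL_norm F G) > 0" and conc: "q_concave (OL_norm F G) q"
  shows "\<exists>H. N_function H \<and> condition_J H \<and> phi_succ (\<lambda>t. phi_inv G t powr q) (phi_inv H)"
proof -
  let ?N = "OL_norm F G"
  obtain C where C: "0 < C" and c: "\<forall>(n::nat) (f::nat \<Rightarrow> real \<Rightarrow> real). (\<forall>i<n. in_space ?N (f i)) \<longrightarrow>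
      ?N (\<lambda>x. (\<Sum>i<n. \<bar>f i x\<bar> powr q) powr (1 / q))
        \<ge> ennreal ((1 / C) * (\<Sum>i<n. enn2real (?N (f i)) powr q) powr (1 / q))"
    using conc unfolding q_concave_def by (elim exE conjE) (rule that)
  obtain K1 where K1: "1 \<le> K1" "\<And>t. 0 \<le> t \<Longrightarrow> 2 * F t \<le> F (K1 * t)"
    using boyd_lower_doubling[OF F G(1) low] by blast
  obtain K2 where K2: "1 \<le> K2" "\<And>t. 0 \<le> t \<Longrightarrow> 2 * G t \<le> G (K2 * t)"
    using dilatory_multiple[OF G, of 2] by auto
  \<comment> \<open>One base that is doubling for \<open>F\<close>, as the test intervals need, and
    for \<open>G\<close>, as the thresholds and blocks need.\<close>
  define b where "b = K1 + K2"
  have b: "1 < b" "K1 \<le> b" "K2 \<le> b" using K1 K2 by (auto simp: b_def)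
  have bF: "2 * F t \<le> F (b * t)" if "0 \<le> t" for t
    using K1(2)[OF that] phi_function_mono[OF F, of "K1 * t" "b * t"] that K1(1) b mult_right_mono[OF b(2) that] by simp
  have bG: "2 * G t \<le> G (b * t)" if "0 \<le> t" for t
    using K2(2)[OF that] phi_function_mono[OF G(1), of "K2 * t" "b * t"] that K2(1) b mult_right_mono[OF b(3) that] by simp
  \<comment> \<open>Powers of \<open>b\<close> in the argument of \<open>G\<close> are powers of
    \<open>\<beta>\<close> in the argument of \<open>G1\<close>.\<close>
  define \<beta> where "\<beta> = b powr q"
  have \<beta>: "1 < \<beta>" using b q by (simp add: \<beta>_def gr_one_powr)
  define G1 where "G1 = power_comp G q"
  have G1: "phi_function G1" unfolding G1_def by (rule phi_function_power_comp[OF G(1) q])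
  have \<beta>G: "2 * G1 t \<le> G1 (\<beta> * t)" if "0 \<le> t" for t
    using bG[of "t powr (1/q)"] that q b by (simp add: G1_def power_comp_def \<beta>_def powr_mult powr_powr)
  have \<beta>k: "G1 (\<beta> powr real_of_int k) = G (b powr real_of_int k)" for k
    using q b by (simp add: G1_def power_comp_def \<beta>_def powr_powr)
  have test: "(\<Sum>k\<in>A. s k / \<beta> powr real_of_int k) \<le> (C * b) powr q"
    if A: "finite A" and s: "\<And>k. k \<in> A \<Longrightarrow> 0 \<le> s k" and le: "(\<Sum>k\<in>A. G1 (s k) / G1 (\<beta> powr real_of_int k)) \<le> 1" for A :: "int set" and s
  proof -
    have "(\<Sum>k\<in>A. G (s k powr (1/q)) / G (b powr real_of_int k)) \<le> 1"
      using le unfolding \<beta>k by (simp add: G1_def power_comp_def)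
    then have "(\<Sum>k\<in>A. (s k powr (1/q) / b powr real_of_int k) powr q) \<le> (C * b) powr q"
      by (intro q_concave_test_step[OF F G(1) q C c b(1) bF A]) auto
    also have "(\<Sum>k\<in>A. (s k powr (1/q) / b powr real_of_int k) powr q) = (\<Sum>k\<in>A. s k / \<beta> powr real_of_int k)"
    proof (intro sum.cong refl)
      fix k assume "k \<in> A"
      have "(s k powr (1/q) / b powr real_of_int k) powr q = (s k powr (1/q)) powr q / (b powr real_of_int k) powr q"
        by (rule powr_divide)
      then show "(s k powr (1/q) / b powr real_of_int k) powr q = s k / \<beta> powr real_of_int k"
        using s[OF \<open>k \<in> A\<close>] q by (simp add: powr_powr \<beta>_def mult.commute)
    qed
    finally show ?thesis .
  qed
  obtain e Cc where e: "1 \<le> Cc" "\<And>k. 0 \<le> e k" "\<And>k. e k \<le> \<beta> powr (real_of_int k - 1)"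
    "\<And>A. finite A \<Longrightarrow> (\<Sum>k\<in>A. G1 (e k) / G1 (\<beta> powr real_of_int k)) \<le> 1"
    "\<And>A. finite A \<Longrightarrow> (\<Sum>k\<in>A. e k / \<beta> powr real_of_int k) \<le> (C * b) powr q"
    "\<And>k s. e k < s \<Longrightarrow> s \<le> \<beta> powr (real_of_int k - 1) \<Longrightarrow>
       G1 (\<beta> powr real_of_int k) / \<beta> powr real_of_int k \<le> Cc * (G1 s / s)"
  proof (rule almost_concave_thresholds[OF G1 \<beta> \<beta>G, of "(C * b) powr q"], goal_cases)
    case (3 A s)
    then show ?case by (intro test) auto
  next
    case (4 C' e')
    show ?case by (rule 4(1)[OF 4(2-)])
  qed auto
  obtain B A0 and P :: "int \<Rightarrow> int" where B: "2 \<le> B" and A0: "1 \<le> A0"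
    and gap: "\<And>i. 2 * B * G1 (\<beta> powr real_of_int (P i)) \<le> G1 (\<beta> powr real_of_int (P (i + 1)))"
    and blk: "\<And>i s t. \<beta> powr real_of_int (P i) \<le> s \<Longrightarrow> s \<le> t \<Longrightarrow> t \<le> \<beta> powr real_of_int (P (i + 1)) \<Longrightarrow>
       G1 t / t \<le> (if i = 0 then A0 else B) * (G1 s / s)"
    and sumy: "\<And>A. finite A \<Longrightarrow> (\<Sum>i\<in>A. G1 (\<beta> powr real_of_int (P i)) / G1 (\<beta> powr real_of_int (P (i + 2)))) \<le> 10"
  proof (rule block_sequence[OF G1 \<beta> \<beta>G, of Cc e "(C * b) powr q"], goal_cases)
    case (7 k s)
    then show ?case by (intro e(6))
  next
    case (8 B A0 P)
    show ?case by (rule 8(1)[OF 8(2-)])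
  qed (auto intro: e)
  define p where "p i = \<beta> powr real_of_int (P i)" for i
  have ppos: "0 < p i" for i using \<beta> by (simp add: p_def)
  define y where "y i = G1 (p i)" for i
  have ypos: "0 < y i" for i using phi_function_pos[OF G1 ppos] by (simp add: y_def)
  obtain H m where H: "phi_function H" "N_function H" "condition_J H"
    and m: "\<And>x. 0 < x \<Longrightarrow> 0 < m x \<and> phi_inv H x = x / m x"
    and mlow: "\<And>i x. y i \<le> x \<Longrightarrow> x \<le> y (i + 1) \<Longrightarrow> B powr real_of_int i / 2 \<le> m x"
    and mupp: "\<And>i x. y i \<le> x \<Longrightarrow> x \<le> y (i + 1) \<Longrightarrow> m x \<le> B powr (real_of_int i + 1)"
    and ex: "\<And>x. 0 < x \<Longrightarrow> \<exists>i. y i \<le> x \<and> x < y (i + 1)"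
  proof (rule N_function_of_blocks[of B y 10], goal_cases)
    case 3
    show ?case using gap by (simp add: y_def p_def)
  next
    case 4
    then show ?case using sumy by (simp add: y_def p_def)
  next
    case (5 H m)
    show ?case by (rule 5(1)[OF 5(2-)])
  qed (use B ypos in auto)
  have ysuc: "y i \<le> y (i + 1)" for i
  proof -
    have "1 * y i \<le> 2 * B * y i" using B ypos[of i] by (intro mult_right_mono) auto
    then show ?thesis using gap[of i] by (simp add: y_def p_def)
  qed
  have psuc: "p i \<le> p (i + 1)" for i
    using ysuc[of i] phi_function_le_iff[OF G1, of "p i" "p (i + 1)"] ppos[of i] ppos[of "i + 1"] by (simp add: y_def)
  have pmono: "p i \<le> p j" if "i \<le> j" for i j
  proof -
    have "p i \<le> p (i + int n)" for n
    proof (induction n)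
      case (Suc n)
      then show ?case using psuc[of "i + int n"] by (simp add: add_ac)
    qed simp
    from this[of "nat (j - i)"] show ?thesis using that by simp
  qed
  \<comment> \<open>\<open>A0 ^ 3 * B\<^sup>2\<close> is the loss in comparing blocks; the remaining
    2 and \<open>B\<close> are the gaps between \<open>m\<close> and the powers of
    \<open>B\<close>.\<close>
  define A where "A = 2 * A0 ^ 3 * B ^ 3"
  have A: "1 \<le> A" using A0 B mult_mono[of 1 "A0 ^ 3" 1 "B ^ 3"] by (simp add: A_def)
  have ratio: "s * m (G1 s) / G1 s \<le> A * (t * m (G1 t) / G1 t)" if s: "0 < s" and st: "s \<le> t" for s t
  proof -
    have t: "0 < t" using s st by simp
    have Gs: "0 < G1 s" and Gt: "0 < G1 t" using phi_function_pos[OF G1] s t by auto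
    obtain i where i: "y i \<le> G1 s" "G1 s < y (i + 1)" using ex[OF Gs] by blast
    obtain j where j: "y j \<le> G1 t" "G1 t < y (j + 1)" using ex[OF Gt] by blast
    have si: "p i \<le> s" "s < p (i + 1)"
      using i phi_function_le_iff[OF G1, of "p i" s] phi_function_less_iff[OF G1, of s "p (i + 1)"] ppos[of i] ppos[of "i + 1"] s by (auto simp: y_def)
    have tj: "p j \<le> t" "t < p (j + 1)"
      using j phi_function_le_iff[OF G1, of "p j" t] phi_function_less_iff[OF G1, of t "p (j + 1)"] ppos[of j] ppos[of "j + 1"] t by (auto simp: y_def)
    have ij: "i \<le> j"
    proof (rule ccontr)
      assume "\<not> i \<le> j"
      then have "p (j + 1) \<le> p i" by (intro pmono) auto
      then show False using si tj st by simp
    qed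
    have "G1 t / t \<le> A0 ^ 3 * B powr (real_of_int (j - i) + 2) * (G1 s / s)"
    proof (rule block_ratio_bound[of B A0 p "\<lambda>t. G1 t / t", OF _ A0 psuc _ _ si(1) _ tj(1) _ st ij])
      show "0 \<le> G1 u / u" if "p k \<le> u" for k u
        using that ppos[of k] phi_function_nonneg[OF G1, of u] by simp
      show "G1 u / u \<le> (if k = 0 then A0 else B) * (G1 v / v)" if "p k \<le> v" "v \<le> u" "u \<le> p (k + 1)" for k u v
        using blk[of k v u] that by (simp add: p_def)
    qed (use B si tj in auto)
    also have "B powr (real_of_int (j - i) + 2) = B\<^sup>2 * (B powr real_of_int j / B powr real_of_int i)"
      using B by (simp add: powr_add powr_diff powr_numeral)
    also have "A0 ^ 3 * (B\<^sup>2 * (B powr real_of_int j / B powr real_of_int i)) * (G1 s / s) \<le>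
      A0 ^ 3 * (B\<^sup>2 * ((2 * m (G1 t)) / (m (G1 s) / B))) * (G1 s / s)"
    proof (intro mult_right_mono mult_left_mono frac_le)
      show "B powr real_of_int j \<le> 2 * m (G1 t)" using mlow[of j "G1 t"] j by simp
      have "m (G1 s) \<le> B * B powr real_of_int i" using mupp[of i "G1 s"] i B by (simp add: powr_add mult.commute)
      then show "m (G1 s) / B \<le> B powr real_of_int i" using B by (simp add: field_simps)
    qed (use A0 B m[OF Gs] m[OF Gt] Gs s in auto)
    also have "\<dots> = A * (m (G1 t) / m (G1 s)) * (G1 s / s)" using B by (simp add: A_def power3_eq_cube power2_eq_square)
    finally have "G1 t / t \<le> A * (m (G1 t) / m (G1 s)) * (G1 s / s)" .
    then show ?thesis using s t Gs Gt m[OF Gs] m[OF Gt] by (simp add: field_simps)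
  qed
  define R where "R x = phi_inv G1 (H x)" for x
  have R: "phi_function R" unfolding R_def by (rule phi_function_comp[OF phi_function_phi_inv[OF G1] H(1)])
  have Rx: "R x / x = R x * m (G1 (R x)) / G1 (R x)" if x: "0 < x" for x
  proof -
    have Hx: "0 < H x" using phi_function_pos[OF H(1) x] .
    have GR: "G1 (R x) = H x" unfolding R_def using Hx by (intro phi_inv_right[OF G1]) auto
    have "x = H x / m (H x)" using m[OF Hx] phi_inv_left[OF H(1), of x] x by simp
    then show ?thesis unfolding GR using m[OF Hx] Hx by (metis divide_divide_eq_right)
  qed
  have "\<exists>K. convex_on {0..} K \<and> phi_equiv R K"
  proof (rule almost_increasing_ratio_phi_equiv_convex[OF R A])
    fix x x' :: real assume x: "0 < x" "x \<le> x'"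
    have "0 < R x" "R x \<le> R x'" using phi_function_pos[OF R x(1)] phi_function_mono[OF R _ x(2)] x by auto
    then show "R x / x \<le> A * (R x' / x')" using ratio[of "R x" "R x'"] Rx[of x] Rx[of x'] x by simp
  qed
  then obtain K where K: "convex_on {0..} K" "phi_equiv R K" by blast
  have "((\<lambda>t. phi_inv G t powr q) \<circ> phi_inv (phi_inv H)) x = R x" if "0 \<le> x" for x
    using phi_inv_phi_inv[OF H(1) that] phi_inv_power_comp[OF G(1) q phi_function_nonneg[OF H(1) that]] by (simp add: R_def G1_def)
  note Req = this
  obtain d where d: "0 < d" "\<forall>t\<ge>0. R (t / d) \<le> K t \<and> K t \<le> R (d * t)" using K(2) unfolding phi_equiv_def by blast
  have "phi_equiv ((\<lambda>t. phi_inv G t powr q) \<circ> phi_inv (phi_inv H)) K"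
    unfolding phi_equiv_def
  proof (intro exI[of _ d] conjI allI impI d(1))
    fix t :: real assume t: "0 \<le> t"
    show "((\<lambda>t. phi_inv G t powr q) \<circ> phi_inv (phi_inv H)) (t / d) \<le> K t"
      using d t by (subst Req) auto
    show "K t \<le> ((\<lambda>t. phi_inv G t powr q) \<circ> phi_inv (phi_inv H)) (d * t)"
      using d t by (subst Req) auto
  qed
  then have "phi_succ (\<lambda>t. phi_inv G t powr q) (phi_inv H)" unfolding phi_succ_def using K(1) by blast
  then show ?thesis using H by blast
qed

theorem theorem5p4:
  fixes F G :: "real \<Rightarrow> real" and q :: real
  assumes "phi_function F" and "phi_function G" and "dilatory G"
    and "boyd_lower (OL_norm F G) > 0"
    and "0 < q"
  shows "(boyd_upper (OL_norm F G) < ereal q \<and>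
          (\<exists>H. N_function H \<and> condition_J H \<and>
               phi_succ (\<lambda>t. phi_inv G t powr q) (phi_inv H))
          \<longrightarrow> q_concave (OL_norm F G) q)
       \<and> (q_concave (OL_norm F G) q \<longrightarrow>
          boyd_upper (OL_norm F G) \<le> ereal q \<and>
          (\<exists>H. N_function H \<and> condition_J H \<and>
               phi_succ (\<lambda>t. phi_inv G t powr q) (phi_inv H)))"
proof (intro conjI impI)
  assume "boyd_upper (OL_norm F G) < ereal q \<and>
    (\<exists>H. N_function H \<and> condition_J H \<and> phi_succ (\<lambda>t. phi_inv G t powr q) (phi_inv H))"
  then obtain H where "boyd_upper (OL_norm F G) < ereal q" "N_function H" "condition_J H"
    "phi_succ (\<lambda>t. phi_inv G t powr q) (phi_inv H)" by blast
  then show "q_concave (OL_norm F G) q"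
    using q_concave_of_condition_J[OF assms(1-3,5,4)] unfolding N_function_def by blast
next
  assume "q_concave (OL_norm F G) q"
  then show "boyd_upper (OL_norm F G) \<le> ereal q"
    "\<exists>H. N_function H \<and> condition_J H \<and> phi_succ (\<lambda>t. phi_inv G t powr q) (phi_inv H)"
    using boyd_upper_le_of_q_concave[OF assms(1,2,5)] N_function_of_q_concave[OF assms(1-3,5,4)] by blast+
qed

end
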